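(* Let $N\ge 1$ be an integer, $0<s<1$, $N>2s$, $0<t<2s$, $\lambda_1,\lambda_2\in(0,\Lambda_{N,s})$, let $\alpha,\beta>1$ with $\alpha+\beta\le 2^*_s(t)$, and let $h\ge 0$, $h\not\equiv 0$, satisfy $h\in L^{\frac{2^*_s(t)}{2^*_s(t)-\alpha-\beta},t}(\mathbb{R}^N)$ (meaning $h\in L^\infty(\mathbb{R}^N)$ if $\alpha+\beta=2^*_s(t)$). Assume either $\alpha+\beta<2^*_s(t)$, or $\alpha+\beta=2^*_s(t)$ and $h$ is continuous in a neighbourhood of $0$ and near $\infty$, with $h(0)=\lim_{|x|\to+\infty}h(x)=0$. Let $z^{(1)}_\mu,z^{(2)}_\mu$ ($\mu>0$) be the solutions of the uncoupled equations described in the context. Then: (i) If $\alpha\ge2$ and $\mathscr{C}(\lambda_1,t,s)>\mathscr{C}(\lambda_2,t,s)$, there exists $\tilde\nu>0$ such that, for any $0<\nu<\tilde\nu$, the couple $(0,z^{(2)}_\mu)$ is the ground state of $(S_{\alpha,\beta})$. (ii) If $\beta\ge2$ and $\mathscr{C}(\lambda_2,t,s)>\mathscr{C}(\lambda_1,t,s)$, there exists $\tilde\nu>0$ such that, for any $0<\nu<\tilde\nu$, the couple $(z^{(1)}_\mu,0)$ is the ground state of $(S_{\alpha,\beta})$. (iii) In particular, if $\alpha,\beta\ge2$, there exists $\tilde\nu>0$ such that, for any $0<\nu<\tilde\nu$, the couple $(0,z^{(2)}_\mu)$ is a ground state of $(S_{\alpha,\beta})$ if $\mathscr{C}(\lambda_1,t,s)>\mathscr{C}(\lambda_2,t,s)$,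 whereas $(z^{(1)}_\mu,0)$ is a ground state otherwise.
   Context: Notation. $2^*_s(t)=\frac{2(N-t)}{N-2s}$. $L^{p,t}(\mathbb{R}^N)$ is the space of measurable $u$ with $\int_{\mathbb{R}^N}\frac{|u|^p}{|x|^t}dx<\infty$. $\mathcal{D}^{s,2}(\mathbb{R}^N)$ is the completion of $C_0^\infty(\mathbb{R}^N)$ for the norm $\|u\|_{\mathcal{D}^{s,2}}^2=\iint_{\mathbb{R}^{2N}}\frac{|u(x)-u(y)|^2}{|x-y|^{N+2s}}dydx$. $\Lambda_{N,s}>0$ is the best (largest) constant in the fractional Hardy inequality $\Lambda_{N,s}\int_{\mathbb{R}^N}\frac{u^2}{|x|^{2s}}dx\le\|u\|^2_{\mathcal{D}^{s,2}}$, $u\in\mathcal{D}^{s,2}(\mathbb{R}^N)$. For $\lambda\in(0,\Lambda_{N,s})$ put $\|u\|_{\lambda,s}^2=\|u\|_{\mathcal{D}^{s,2}}^2-\lambda\int_{\mathbb{R}^N}\frac{u^2}{|x|^{2s}}dx$ (an equivalent norm). $\mathbb{D}=\mathcal{D}^{s,2}(\mathbb{R}^N)\times\mathcal{D}^{s,2}(\mathbb{R}^N)$ with $\|(u,v)\|_{\mathbb{D}}^2=\|u\|_{\lambda_1,s}^2+\|v\|_{\lambda_2,s}^2$. For $\lambda\in(0,\Lambda_{N,s})$, $$\mathcal{S}(\lambda,t,s)=\inf_{u\in\mathcal{D}^{s,2}(\mathbb{R}^N),\,u\not\equiv0}\frac{\|u\|_{\lambda,s}^2}{\left(\int_{\mathbb{R}^N}\frac{|u|^{2^*_s(t)}}{|x|^t}dx\right)^{2/2^*_s(t)}},\qquad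 \mathscr{C}(\lambda,t,s)=\frac{2s-t}{2(N-t)}\left[\mathcal{S}(\lambda,t,s)\right]^{\frac{N-t}{2s-t}}.$$ It is known that $\mathcal{S}(\lambda,t,s)>0$ is attained by positive functions. For $j=1,2$, $z^{(j)}$ denotes a minimizer for $\mathcal{S}(\lambda_j,t,s)$, positive in $\mathbb{R}^N\setminus\{0\}$ and normalized so that it solves $(-\Delta)^s z-\lambda_j\frac{z}{|x|^{2s}}=\frac{z^{2^*_s(t)-1}}{|x|^t}$, and $z^{(j)}_\mu(x)=\mu^{-\frac{N-2s}{2}}z^{(j)}(x/\mu)$, $\mu>0$, which solves the same equation; $\|z^{(j)}_\mu\|_{\lambda_j,s}^2=\int_{\mathbb{R}^N}\frac{|z^{(j)}_\mu|^{2^*_s(t)}}{|x|^t}dx=[\mathcal{S}(\lambda_j,t,s)]^{\frac{N-t}{2s-t}}$. System $(S_{\alpha,\beta})$, with coupling parameter $\nu>0$: $$(-\Delta)^s u-\lambda_1\frac{u}{|x|^{2s}}-\frac{u^{2^*_s(t)-1}}{|x|^t}=\nu\alpha h(x)\frac{u^{\alpha-1}v^\beta}{|x|^t},\quad (-\Delta)^s v-\lambda_2\frac{v}{|x|^{2s}}-\frac{v^{2^*_s(t)-1}}{|x|^t}=\nu\beta h(x)\frac{u^{\alpha}v^{\beta-1}}{|x|^t}\ \text{ in }\mathbb{R}^N.$$ Equations are understood variationally, $(-\Delta)^s$ being the operator associated with the bilinear form $\iint\frac{(u(x)-u(y))(\varphi(x)-\varphi(y))}{|x-y|^{N+2s}}dydx$: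 solutions of the system are critical points in $\mathbb{D}$ of the $C^1$ functional $$\mathcal{J}_\nu(u,v)=\tfrac12\|(u,v)\|_{\mathbb{D}}^2-\frac{1}{2^*_s(t)}\int_{\mathbb{R}^N}\frac{|u|^{2^*_s(t)}+|v|^{2^*_s(t)}}{|x|^t}dx-\nu\int_{\mathbb{R}^N}h(x)\frac{|u|^\alpha|v|^\beta}{|x|^t}dx.$$ A bound state is a critical point of $\mathcal{J}_\nu$ in $\mathbb{D}\setminus\{(0,0)\}$. A ground state is a bound state $(\tilde u,\tilde v)$ with $\tilde u,\tilde v\ge0$ such that $\mathcal{J}_\nu(\tilde u,\tilde v)=\min\{\mathcal{J}_\nu(u,v):(u,v)\in\mathbb{D}\setminus\{(0,0)\},\ u,v\ge0,\ \mathcal{J}_\nu'(u,v)=0\}$. (Components of a ground state may vanish identically.) *)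

theory Defs
  imports "HOL-Analysis.Analysis"
begin

text \<open>
  Functions are pointwise representatives; \<open>u \<equiv> 0\<close> and \<open>u \<ge> 0\<close> are read almost everywhere.
  The ambient space is an arbitrary Euclidean space with dimension \<open>N = DIM('a)\<close>.
  Since \<open>0 powr r = 0\<close> and \<open>x / 0 = 0\<close>, the singular weights vanish at the origin and on the
  diagonal; these are null sets.
\<close>

primrec C_k :: "nat \<Rightarrow> ('a::euclidean_space \<Rightarrow> real) \<Rightarrow> bool" where
  "C_k 0 f \<longleftrightarrow> continuous_on UNIV f"
| "C_k (Suc k) f \<longleftrightarrow> f differentiable_on UNIV \<and>
     (\<forall>b\<in>Basis. C_k k (\<lambda>x. frechet_derivative f (at x) b))"

definition test_functions :: "('a::euclidean_space \<Rightarrow> real) set" where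
  "test_functions = {f. (\<forall>k. C_k k f) \<and> compact (closure {x. f x \<noteq> 0})}"

definition weighted_Lp :: "real \<Rightarrow> real \<Rightarrow> ('a::euclidean_space \<Rightarrow> real) set" where
  "weighted_Lp p t = {u \<in> borel_measurable lebesgue.
     (\<integral>\<^sup>+x. ennreal (\<bar>u x\<bar> powr p / norm x powr t) \<partial>lebesgue) < \<infinity>}"

definition L_infinity :: "('a::euclidean_space \<Rightarrow> real) set" where
  "L_infinity = {u \<in> borel_measurable lebesgue. \<exists>C. AE x in lebesgue. \<bar>u x\<bar> \<le> C}"

definition gagliardo_form ::
    "real \<Rightarrow> ('a::euclidean_space \<Rightarrow> real) \<Rightarrow> ('a \<Rightarrow> real) \<Rightarrow> real" where
  "gagliardo_form s u w = (\<integral>(x, y). (u x - u y) * (w x - w y) /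
     norm (x - y) powr (real DIM('a) + 2 * s) \<partial>(lebesgue \<Otimes>\<^sub>M lebesgue))"

text \<open>The square of the Gagliardo seminorm as an extended nonnegative number.\<close>
definition gagliardo_sq :: "real \<Rightarrow> ('a::euclidean_space \<Rightarrow> real) \<Rightarrow> ennreal" where
  "gagliardo_sq s u = (\<integral>\<^sup>+(x, y). ennreal ((u x - u y)\<^sup>2 /
     norm (x - y) powr (real DIM('a) + 2 * s)) \<partial>(lebesgue \<Otimes>\<^sub>M lebesgue))"

text \<open>
  The completion of the test functions for the Gagliardo norm, realised as a function space
  (possible for \<open>N > 2 s\<close> by the Sobolev inequality): the class of a Cauchy sequence is
  identified with the almost everywhere limit of a subsequence. The almost everywhere
  convergence excludes nonzero constants, on which the seminorm vanishes.
\<close>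
definition D_space :: "real \<Rightarrow> ('a::euclidean_space \<Rightarrow> real) set" where
  "D_space s = {u \<in> borel_measurable lebesgue. \<exists>\<phi>. (\<forall>n::nat. \<phi> n \<in> test_functions) \<and>
     (\<lambda>n. gagliardo_sq s (\<lambda>x. u x - \<phi> n x)) \<longlonglongrightarrow> 0 \<and>
     (AE x in lebesgue. (\<lambda>n. \<phi> n x) \<longlonglongrightarrow> u x)}"

definition hardy_constant :: "'a::euclidean_space itself \<Rightarrow> real \<Rightarrow> real" where
  "hardy_constant _ s = Sup {c. 0 \<le> c \<and> (\<forall>u \<in> (D_space s :: ('a \<Rightarrow> real) set).
     ennreal c * (\<integral>\<^sup>+x. ennreal ((u x)\<^sup>2 / norm x powr (2 * s)) \<partial>lebesgue) \<le> gagliardo_sq s u)}"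

definition crit_exp :: "'a::euclidean_space itself \<Rightarrow> real \<Rightarrow> real \<Rightarrow> real" where
  "crit_exp _ s t = 2 * (real DIM('a) - t) / (real DIM('a) - 2 * s)"

definition hardy_form ::
    "real \<Rightarrow> real \<Rightarrow> ('a::euclidean_space \<Rightarrow> real) \<Rightarrow> ('a \<Rightarrow> real) \<Rightarrow> real" where
  "hardy_form lam s u w =
     gagliardo_form s u w - lam * (\<integral>x. u x * w x / norm x powr (2 * s) \<partial>lebesgue)"

definition norm_sq :: "real \<Rightarrow> real \<Rightarrow> ('a::euclidean_space \<Rightarrow> real) \<Rightarrow> real" where
  "norm_sq lam s u = hardy_form lam s u u"

definition crit_integral :: "real \<Rightarrow> real \<Rightarrow> ('a::euclidean_space \<Rightarrow> real) \<Rightarrow> real" where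
  "crit_integral s t u = (\<integral>x. \<bar>u x\<bar> powr crit_exp TYPE('a) s t / norm x powr t \<partial>lebesgue)"

definition S_quotient :: "real \<Rightarrow> real \<Rightarrow> real \<Rightarrow> ('a::euclidean_space \<Rightarrow> real) \<Rightarrow> real" where
  "S_quotient lam t s u =
     norm_sq lam s u / crit_integral s t u powr (2 / crit_exp TYPE('a) s t)"

definition S_const :: "'a::euclidean_space itself \<Rightarrow> real \<Rightarrow> real \<Rightarrow> real \<Rightarrow> real" where
  "S_const _ lam t s =
     Inf (S_quotient lam t s ` {u :: 'a \<Rightarrow> real. u \<in> D_space s \<and> \<not> (AE x in lebesgue. u x = 0)})"

definition C_const :: "'a::euclidean_space itself \<Rightarrow> real \<Rightarrow> real \<Rightarrow> real \<Rightarrow> real" where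
  "C_const _ lam t s = (2 * s - t) / (2 * (real DIM('a) - t)) *
     S_const TYPE('a) lam t s powr ((real DIM('a) - t) / (2 * s - t))"

definition solves_uncoupled ::
    "real \<Rightarrow> real \<Rightarrow> real \<Rightarrow> ('a::euclidean_space \<Rightarrow> real) \<Rightarrow> bool" where
  "solves_uncoupled lam t s z \<longleftrightarrow> (\<forall>\<phi> \<in> D_space s. hardy_form lam s z \<phi> =
     (\<integral>x. z x powr (crit_exp TYPE('a) s t - 1) * \<phi> x / norm x powr t \<partial>lebesgue))"

definition normalized_minimizer ::
    "real \<Rightarrow> real \<Rightarrow> real \<Rightarrow> ('a::euclidean_space \<Rightarrow> real) \<Rightarrow> bool" where
  "normalized_minimizer lam t s z \<longleftrightarrow> z \<in> D_space s \<and> (\<forall>x. x \<noteq> 0 \<longrightarrow> 0 < z x) \<and>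
     S_quotient lam t s z = S_const TYPE('a) lam t s \<and> solves_uncoupled lam t s z"

definition rescale ::
    "real \<Rightarrow> ('a::euclidean_space \<Rightarrow> real) \<Rightarrow> real \<Rightarrow> 'a \<Rightarrow> real" where
  "rescale s z mu = (\<lambda>x. mu powr (- (real DIM('a) - 2 * s) / 2) * z (x /\<^sub>R mu))"

definition pair_norm ::
    "real \<Rightarrow> real \<Rightarrow> real \<Rightarrow> ('a::euclidean_space \<Rightarrow> real) \<times> ('a \<Rightarrow> real) \<Rightarrow> real" where
  "pair_norm lam1 lam2 s = (\<lambda>(u, v). sqrt (norm_sq lam1 s u + norm_sq lam2 s v))"

definition J_fun :: "real \<Rightarrow> real \<Rightarrow> real \<Rightarrow> real \<Rightarrow> real \<Rightarrow> real \<Rightarrow>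
    ('a::euclidean_space \<Rightarrow> real) \<Rightarrow> real \<Rightarrow> ('a \<Rightarrow> real) \<times> ('a \<Rightarrow> real) \<Rightarrow> real" where
  "J_fun lam1 lam2 t s \<alpha> \<beta> h \<nu> = (\<lambda>(u, v).
     1 / 2 * (pair_norm lam1 lam2 s (u, v))\<^sup>2
     - 1 / crit_exp TYPE('a) s t *
        (\<integral>x. (\<bar>u x\<bar> powr crit_exp TYPE('a) s t + \<bar>v x\<bar> powr crit_exp TYPE('a) s t)
           / norm x powr t \<partial>lebesgue)
     - \<nu> * (\<integral>x. h x * (\<bar>u x\<bar> powr \<alpha> * \<bar>v x\<bar> powr \<beta>) / norm x powr t \<partial>lebesgue))"

text \<open>
  Vanishing of the Frechet derivative of \<open>J_fun\<close> on \<open>D_space s \<times> D_space s\<close>, spelled out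
  because the energy space is a set of functions and not a normed-space type.
\<close>
definition critical_point :: "real \<Rightarrow> real \<Rightarrow> real \<Rightarrow> real \<Rightarrow> real \<Rightarrow> real \<Rightarrow>
    ('a::euclidean_space \<Rightarrow> real) \<Rightarrow> real \<Rightarrow> ('a \<Rightarrow> real) \<times> ('a \<Rightarrow> real) \<Rightarrow> bool" where
  "critical_point lam1 lam2 t s \<alpha> \<beta> h \<nu> = (\<lambda>(u, v).
     u \<in> D_space s \<and> v \<in> D_space s \<and>
     (\<forall>\<epsilon>>0. \<exists>\<delta>>0. \<forall>\<phi> \<in> D_space s. \<forall>\<psi> \<in> D_space s. pair_norm lam1 lam2 s (\<phi>, \<psi>) < \<delta> \<longrightarrow>
        \<bar>J_fun lam1 lam2 t s \<alpha> \<beta> h \<nu> (\<lambda>x. u x + \<phi> x, \<lambda>x. v x + \<psi> x)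
           - J_fun lam1 lam2 t s \<alpha> \<beta> h \<nu> (u, v)\<bar>
        \<le> \<epsilon> * pair_norm lam1 lam2 s (\<phi>, \<psi>)))"

definition bound_state :: "real \<Rightarrow> real \<Rightarrow> real \<Rightarrow> real \<Rightarrow> real \<Rightarrow> real \<Rightarrow>
    ('a::euclidean_space \<Rightarrow> real) \<Rightarrow> real \<Rightarrow> ('a \<Rightarrow> real) \<times> ('a \<Rightarrow> real) \<Rightarrow> bool" where
  "bound_state lam1 lam2 t s \<alpha> \<beta> h \<nu> = (\<lambda>(u, v).
     critical_point lam1 lam2 t s \<alpha> \<beta> h \<nu> (u, v) \<and>
     \<not> ((AE x in lebesgue. u x = 0) \<and> (AE x in lebesgue. v x = 0)))"

definition nonneg_bound_states :: "real \<Rightarrow> real \<Rightarrow> real \<Rightarrow> real \<Rightarrow> real \<Rightarrow> real \<Rightarrow>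
    ('a::euclidean_space \<Rightarrow> real) \<Rightarrow> real \<Rightarrow> (('a \<Rightarrow> real) \<times> ('a \<Rightarrow> real)) set" where
  "nonneg_bound_states lam1 lam2 t s \<alpha> \<beta> h \<nu> = {(u, v).
     bound_state lam1 lam2 t s \<alpha> \<beta> h \<nu> (u, v) \<and>
     (AE x in lebesgue. 0 \<le> u x) \<and> (AE x in lebesgue. 0 \<le> v x)}"

definition ground_state :: "real \<Rightarrow> real \<Rightarrow> real \<Rightarrow> real \<Rightarrow> real \<Rightarrow> real \<Rightarrow>
    ('a::euclidean_space \<Rightarrow> real) \<Rightarrow> real \<Rightarrow> ('a \<Rightarrow> real) \<times> ('a \<Rightarrow> real) \<Rightarrow> bool" where
  "ground_state lam1 lam2 t s \<alpha> \<beta> h \<nu> p \<longleftrightarrow>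
     is_arg_min (J_fun lam1 lam2 t s \<alpha> \<beta> h \<nu>)
       (\<lambda>q. q \<in> nonneg_bound_states lam1 lam2 t s \<alpha> \<beta> h \<nu>) p"

end

theory Submission
  imports Defs
begin

text \<open>
  A couple with one vanishing component decouples the system, so \<open>(0, z)\<close> with \<open>z\<close> a minimizer of the second
  equation is a natural candidate, of level \<open>(1 / 2 - 1 / p) S2 powr (p / (p - 2))\<close>, where \<open>p\<close> is the
  critical exponent and \<open>S1\<close>, \<open>S2\<close> are the two best constants. Two things have to be shown: that it is
  critical for the coupled functional, and that for weak coupling no nonnegative bound state lies below it.

  Both rest on the Hardy-Sobolev inequality \<open>S crit u powr (2 / p) \<le> norm_sq u\<close>
  (\<open>hardy_sobolev_inequality\<close>). It is extracted from the minimizer: tested with itself, the equation gives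
  \<open>norm_sq z = crit z\<close>, this number is positive since \<open>lam\<close> is below the Hardy constant, and minimality
  turns it into \<open>S > 0\<close>. That the real-valued quadratic form is meaningful and coercive on the energy space depends on
  the finiteness of the Gagliardo energy (\<open>gagliardo_sq_D_space_finite\<close>).

  Criticality (\<open>semitrivial_critical_point\<close>) holds because the linear terms at \<open>z\<close> cancel by the equation
  (\<open>energy_expansion\<close>) and the coupling has order \<open>\<alpha> > 1\<close> in the first component. The rescaled
  minimizers inherit it since norm and critical integral are invariant under \<open>rescale\<close>.

  For the lower bound, let \<open>(u, v)\<close> be a bound state, \<open>a\<close> and \<open>b\<close> its critical integrals and \<open>K \<ge> 0\<close> its
  coupling integral. Testing with \<open>(u, 0)\<close> and \<open>(0, v)\<close> (\<open>nehari_first\<close>, \<open>nehari_second\<close>) and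
  inserting Hardy-Sobolev gives
  \<open>S1 a powr (2 / p) \<le> a + \<nu> \<alpha> K\<close> and \<open>S2 b powr (2 / p) \<le> b + \<nu> \<beta> K\<close>,
  while the functional is at least \<open>(1 / 2 - 1 / p) (a + b)\<close>. By Hoelder's inequality (\<open>coupling_bound\<close>)
  \<open>K\<close> is at most a multiple of \<open>a powr (\<alpha> / p) b powr (\<beta> / p)\<close>. If \<open>\<alpha> \<ge> 2\<close>, dividing the first inequality by
  \<open>a powr (2 / p)\<close> shows that a nonzero first component satisfies
  \<open>a \<ge> (S1 - O(\<nu>)) powr (p / (p - 2))\<close>; for \<open>S1 > S2\<close> and small \<open>\<nu>\<close> it alone exceeds the level. If
  \<open>S1 = S2\<close> and \<open>\<alpha>, \<beta> \<ge> 2\<close>, both components obey such a bound and their sum nearly doubles the level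
  (\<open>nehari_lower_bound\<close>). If a component vanishes, the one-equation bound applies to the other. The remaining
  claims follow by exchanging the components (\<open>ground_state_swap\<close>).
\<close>

section \<open>Affine changes of variables for Lebesgue measure\<close>

lemma sigma_finite_lebesgue: "sigma_finite_measure (lebesgue :: 'a::euclidean_space measure)"
proof
  obtain A :: "'a set set" where A: "countable A" "A \<subseteq> sets lborel" "\<Union>A = space lborel"
      "\<forall>a\<in>A. emeasure lborel a \<noteq> \<infinity>"
    using lborel.sigma_finite_countable by blast
  then show "\<exists>A::'a set set. countable A \<and> A \<subseteq> sets lebesgue \<and> \<Union>A = space lebesgue \<and>
      (\<forall>a\<in>A. emeasure lebesgue a \<noteq> \<infinity>)"
    by (intro exI[of _ A]) (auto simp: sets_completionI_sets)
qed

interpretation lebesgue_pair: pair_sigma_finite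
    "lebesgue :: 'a::euclidean_space measure" "lebesgue :: 'a::euclidean_space measure"
  by (simp add: pair_sigma_finite_def sigma_finite_lebesgue)

lemma lebesgue_affine_map:
  fixes d :: "'a::euclidean_space"
  assumes "c \<noteq> 0"
  shows "(\<lambda>x. c *\<^sub>R x + d) \<in> lebesgue \<rightarrow>\<^sub>M lebesgue"
    and "lebesgue = density (distr lebesgue lebesgue (\<lambda>x. c *\<^sub>R x + d)) (\<lambda>_. ennreal (\<bar>c\<bar> ^ DIM('a)))"
proof -
  have eq: "(\<lambda>x. d + (\<Sum>j\<in>Basis. (c * (x \<bullet> j)) *\<^sub>R j)) = (\<lambda>x. c *\<^sub>R x + d)"
    unfolding scaleR_scaleR[symmetric] scaleR_sum_right[symmetric]
    by (auto simp add: euclidean_representation ac_simps)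
  show "(\<lambda>x. c *\<^sub>R x + d) \<in> lebesgue \<rightarrow>\<^sub>M lebesgue"
    using lebesgue_affine_measurable[of "\<lambda>_. c" d] assms by (simp add: eq)
  show "lebesgue = density (distr lebesgue lebesgue (\<lambda>x. c *\<^sub>R x + d)) (\<lambda>_. ennreal (\<bar>c\<bar> ^ DIM('a)))"
    using lebesgue_affine_euclidean[of "\<lambda>_. c" d] assms by (simp add: eq)
qed

lemma measurable_compose_scaleR:
  fixes f :: "'a::euclidean_space \<Rightarrow> 'b"
  assumes "f \<in> lebesgue \<rightarrow>\<^sub>M M"
  shows "(\<lambda>x. f (c *\<^sub>R x)) \<in> lebesgue \<rightarrow>\<^sub>M M"
  using measurable_compose[OF lebesgue_measurable_scaling assms] .

lemma nn_integral_lebesgue_affine: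
  fixes f :: "'a::euclidean_space \<Rightarrow> ennreal"
  assumes f: "f \<in> borel_measurable lebesgue" and c: "c \<noteq> 0"
  shows "(\<integral>\<^sup>+x. f x \<partial>lebesgue) = ennreal (\<bar>c\<bar> ^ DIM('a)) * (\<integral>\<^sup>+x. f (c *\<^sub>R x + d) \<partial>lebesgue)"
proof -
  let ?T = "\<lambda>x::'a. c *\<^sub>R x + d"
  have f': "f \<in> borel_measurable (distr lebesgue lebesgue ?T)"
    using f by simp
  have "(\<integral>\<^sup>+x. f x \<partial>lebesgue) =
      (\<integral>\<^sup>+x. f x \<partial>density (distr lebesgue lebesgue ?T) (\<lambda>_. ennreal (\<bar>c\<bar> ^ DIM('a))))"
    using lebesgue_affine_map(2)[OF c, of d] by simp
  also have "\<dots> = (\<integral>\<^sup>+x. ennreal (\<bar>c\<bar> ^ DIM('a)) * f x \<partial>distr lebesgue lebesgue ?T)"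
    by (subst nn_integral_density) (use f in auto)
  also have "\<dots> = ennreal (\<bar>c\<bar> ^ DIM('a)) * (\<integral>\<^sup>+x. f x \<partial>distr lebesgue lebesgue ?T)"
    by (rule nn_integral_cmult[OF f'])
  also have "(\<integral>\<^sup>+x. f x \<partial>distr lebesgue lebesgue ?T) = (\<integral>\<^sup>+x. f (?T x) \<partial>lebesgue)"
    by (rule nn_integral_distr[OF lebesgue_affine_map(1)[OF c]]) (use f in auto)
  finally show ?thesis .
qed

lemma AE_lebesgue_scaleR:
  fixes P :: "'a::euclidean_space \<Rightarrow> bool"
  assumes P: "AE x in lebesgue. P x" and c: "c \<noteq> 0"
  shows "AE x in lebesgue. P (c *\<^sub>R x)"
proof -
  obtain N where N: "N \<in> null_sets lebesgue" "{x. \<not> P x} \<subseteq> N"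
    using P by (auto simp: eventually_ae_filter)
  have ind: "indicator N \<in> borel_measurable lebesgue" using N by auto
  have "ennreal (\<bar>c\<bar> ^ DIM('a)) * (\<integral>\<^sup>+x. indicator N (c *\<^sub>R x) \<partial>lebesgue) =
      (\<integral>\<^sup>+x. indicator N x \<partial>lebesgue)"
    using nn_integral_lebesgue_affine[OF ind c, of 0] by simp
  also have "\<dots> = emeasure lebesgue N" using N by (intro nn_integral_indicator) auto
  also have "\<dots> = 0" using N by auto
  finally have "(\<integral>\<^sup>+x. indicator N (c *\<^sub>R x) \<partial>lebesgue) = 0"
    using c by simp
  then have "AE x in lebesgue. (indicator N (c *\<^sub>R x) :: ennreal) = 0"
    by (subst (asm) nn_integral_0_iff_AE) (use measurable_compose_scaleR[OF ind] in auto)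
  then show ?thesis
    by eventually_elim (use N(2) in \<open>auto simp: indicator_def split: if_splits\<close>)
qed

lemma AE_lebesgue_nonzero: "AE x in lebesgue. (x::'a::euclidean_space) \<noteq> 0"
  by (rule AE_I[where N = "{0}"]) auto

lemma borel_measurable_weight:
  "u \<in> borel_measurable lebesgue \<Longrightarrow>
    (\<lambda>x. u x / norm x powr r) \<in> borel_measurable (lebesgue :: 'a::euclidean_space measure)"
proof -
  assume u[measurable]: "u \<in> borel_measurable lebesgue"
  have [measurable]: "(\<lambda>x::'a. norm x powr r) \<in> borel_measurable lebesgue"
    by (rule measurable_completion) simp
  show ?thesis by measurable
qed

text \<open>
  The product measure carries a product of two completed \<open>\<sigma>\<close>-algebras. The kernel
  \<open>norm (x - y)\<close> is Borel on the plain product, and is pulled back along the projections, each of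
  which is measurable from Lebesgue to Borel sets.
\<close>

lemma borel_measurable_difference_kernel:
  assumes "u \<in> borel_measurable lebesgue" "w \<in> borel_measurable lebesgue"
  shows "(\<lambda>(x::'a::euclidean_space, y). (u x - u y) * (w x - w y) / norm (x - y) powr r)
    \<in> borel_measurable (lebesgue \<Otimes>\<^sub>M lebesgue)"
proof -
  have [measurable]: "(\<lambda>x::'a. x) \<in> lebesgue \<rightarrow>\<^sub>M borel"
    by (rule measurable_completion) simp
  note assms[measurable]
  have [measurable]: "(\<lambda>p::'a\<times>'a. fst p) \<in> lebesgue \<Otimes>\<^sub>M lebesgue \<rightarrow>\<^sub>M borel"
     "(\<lambda>p::'a\<times>'a. snd p) \<in> lebesgue \<Otimes>\<^sub>M lebesgue \<rightarrow>\<^sub>M borel"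
    by measurable
  have [measurable]: "(\<lambda>p::'a\<times>'a. norm (fst p - snd p) powr r) \<in> borel_measurable (lebesgue \<Otimes>\<^sub>M lebesgue)"
    by measurable
  have "(\<lambda>p. (u (fst p) - u (snd p)) * (w (fst p) - w (snd p)) / norm (fst p - snd p) powr r)
    \<in> borel_measurable (lebesgue \<Otimes>\<^sub>M lebesgue)"
    by measurable
  then show ?thesis by (simp add: case_prod_beta')
qed

lemma borel_measurable_gagliardo_kernel:
  assumes "u \<in> borel_measurable lebesgue"
  shows "(\<lambda>(x::'a::euclidean_space, y). (u x - u y)\<^sup>2 / norm (x - y) powr r)
    \<in> borel_measurable (lebesgue \<Otimes>\<^sub>M lebesgue)"
  using borel_measurable_difference_kernel[OF assms assms] by (simp add: power2_eq_square)

lemma weighted_nn_integral_scaleR: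
  fixes g :: "'a::euclidean_space \<Rightarrow> real"
  assumes g: "g \<in> borel_measurable lebesgue" and c: "0 < c"
  shows "(\<integral>\<^sup>+x. ennreal (g (c *\<^sub>R x) / norm x powr r) \<partial>lebesgue) =
    ennreal (c powr (r - real DIM('a))) * (\<integral>\<^sup>+x. ennreal (g x / norm x powr r) \<partial>lebesgue)"
proof -
  let ?F = "\<lambda>x. ennreal (g x / norm x powr r)"
  have F: "?F \<in> borel_measurable lebesgue"
    using borel_measurable_weight[OF g] by measurable
  have pt: "ennreal (g (c *\<^sub>R x) / norm x powr r) = ennreal (c powr r) * ?F (c *\<^sub>R x)" for x
    using c by (subst ennreal_mult'[symmetric]) (auto simp: powr_mult)
  have "(\<integral>\<^sup>+x. ennreal (g (c *\<^sub>R x) / norm x powr r) \<partial>lebesgue) =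
      ennreal (c powr r) * (\<integral>\<^sup>+x. ?F (c *\<^sub>R x) \<partial>lebesgue)"
    unfolding pt by (rule nn_integral_cmult) (rule measurable_compose_scaleR[OF F])
  also have "ennreal (c powr r) =
      ennreal (c powr (r - real DIM('a))) * ennreal (\<bar>c\<bar> ^ DIM('a))"
    using c by (subst ennreal_mult[symmetric]) (auto simp: powr_diff powr_realpow)
  also have "\<dots> * (\<integral>\<^sup>+x. ?F (c *\<^sub>R x) \<partial>lebesgue) =
      ennreal (c powr (r - real DIM('a))) * (\<integral>\<^sup>+x. ?F x \<partial>lebesgue)"
    using nn_integral_lebesgue_affine[OF F, of c 0] c by (simp add: mult.assoc)
  finally show ?thesis .
qed

lemma gagliardo_sq_iterated:
  fixes u :: "'a::euclidean_space \<Rightarrow> real"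
  assumes "u \<in> borel_measurable lebesgue"
  shows "gagliardo_sq s u = (\<integral>\<^sup>+x. \<integral>\<^sup>+y. ennreal ((u x - u y)\<^sup>2 /
     norm (x - y) powr (real DIM('a) + 2 * s)) \<partial>lebesgue \<partial>lebesgue)"
proof -
  have "(\<lambda>p. ennreal ((u (fst p) - u (snd p))\<^sup>2 / norm (fst p - snd p) powr (real DIM('a) + 2 * s)))
      \<in> borel_measurable (lebesgue \<Otimes>\<^sub>M lebesgue)"
    using borel_measurable_gagliardo_kernel[OF assms, of "real DIM('a) + 2 * s"]
    by (simp add: case_prod_beta')
  from sigma_finite_measure.nn_integral_fst[OF sigma_finite_lebesgue this] show ?thesis
    unfolding gagliardo_sq_def by (simp add: case_prod_beta')
qed

text \<open>
  The kernel is homogeneous of degree \<open>- N - 2 s\<close> and each of the two integrations contributes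
  the Jacobian \<open>c ^ N\<close>, so a dilation by \<open>c\<close> multiplies the energy by
  \<open>c powr (N + 2 s) / c powr (2 N)\<close>.
\<close>

lemma gagliardo_sq_scaleR:
  fixes u :: "'a::euclidean_space \<Rightarrow> real"
  assumes u: "u \<in> borel_measurable lebesgue" and c: "0 < c"
  shows "gagliardo_sq s (\<lambda>x. k * u (c *\<^sub>R x)) =
    ennreal (k\<^sup>2 * c powr (2 * s - real DIM('a))) * gagliardo_sq s u"
proof -
  let ?r = "real DIM('a) + 2 * s"
  let ?F = "\<lambda>x y. ennreal ((u x - u y)\<^sup>2 / norm (x - y) powr ?r)"
  let ?I = "\<lambda>x. \<integral>\<^sup>+y. ?F x y \<partial>lebesgue"
  have F: "(\<lambda>p. ?F (fst p) (snd p)) \<in> borel_measurable (lebesgue \<Otimes>\<^sub>M lebesgue)"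
    using borel_measurable_gagliardo_kernel[OF u, of ?r] by (simp add: case_prod_beta')
  have F1: "?F x \<in> borel_measurable lebesgue" for x
    using measurable_compose_Pair1[OF _ F, of x] by simp
  have I: "?I \<in> borel_measurable lebesgue"
    using sigma_finite_measure.borel_measurable_nn_integral_fst[OF sigma_finite_lebesgue F] by simp
  have uc: "(\<lambda>x. k * u (c *\<^sub>R x)) \<in> borel_measurable lebesgue"
    using measurable_compose_scaleR[OF u, of c] by measurable
  have cr: "norm (c *\<^sub>R x - c *\<^sub>R y) powr ?r = c powr ?r * norm (x - y) powr ?r" for x y :: 'a
    using c by (simp add: powr_mult flip: scaleR_diff_right)
  have pt: "ennreal ((k * u (c *\<^sub>R x) - k * u (c *\<^sub>R y))\<^sup>2 / norm (x - y) powr ?r) =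
      ennreal (k\<^sup>2 * c powr ?r) * ?F (c *\<^sub>R x) (c *\<^sub>R y)" for x y
    using c unfolding cr
    by (subst ennreal_mult'[symmetric]) (auto simp: power_mult_distrib simp flip: right_diff_distrib)
  let ?d = "ennreal (c ^ DIM('a))"
  have inner: "?d * (\<integral>\<^sup>+y. ?F x (c *\<^sub>R y) \<partial>lebesgue) = ?I x" for x
    using nn_integral_lebesgue_affine[OF F1[of x], of c 0] c by simp
  have outer: "?d * (\<integral>\<^sup>+x. ?I (c *\<^sub>R x) \<partial>lebesgue) = (\<integral>\<^sup>+x. ?I x \<partial>lebesgue)"
    using nn_integral_lebesgue_affine[OF I, of c 0] c by simp
  have split: "ennreal (k\<^sup>2 * c powr ?r) = ennreal (k\<^sup>2 * c powr (2 * s - real DIM('a))) * ?d * ?d"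
    using c by (simp add: ennreal_mult'[symmetric] mult.assoc powr_diff powr_add powr_realpow[symmetric])
  have "gagliardo_sq s (\<lambda>x. k * u (c *\<^sub>R x)) =
      (\<integral>\<^sup>+x. \<integral>\<^sup>+y. ennreal (k\<^sup>2 * c powr ?r) * ?F (c *\<^sub>R x) (c *\<^sub>R y) \<partial>lebesgue \<partial>lebesgue)"
    unfolding gagliardo_sq_iterated[OF uc] pt ..
  also have "\<dots> = (\<integral>\<^sup>+x. ennreal (k\<^sup>2 * c powr ?r) * (\<integral>\<^sup>+y. ?F (c *\<^sub>R x) (c *\<^sub>R y) \<partial>lebesgue) \<partial>lebesgue)"
    by (intro nn_integral_cong nn_integral_cmult) (rule measurable_compose_scaleR[OF F1])
  also have "\<dots> = (\<integral>\<^sup>+x. ennreal (k\<^sup>2 * c powr (2 * s - real DIM('a))) * ?d * ?I (c *\<^sub>R x) \<partial>lebesgue)"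
    by (intro nn_integral_cong) (simp only: split mult.assoc inner)
  also have "\<dots> = ennreal (k\<^sup>2 * c powr (2 * s - real DIM('a))) * ?d * (\<integral>\<^sup>+x. ?I (c *\<^sub>R x) \<partial>lebesgue)"
    by (intro nn_integral_cmult) (rule measurable_compose_scaleR[OF I])
  also have "\<dots> = ennreal (k\<^sup>2 * c powr (2 * s - real DIM('a))) * gagliardo_sq s u"
    unfolding gagliardo_sq_iterated[OF u] outer[symmetric] by (simp add: mult.assoc)
  finally show ?thesis .
qed

section \<open>Finite Gagliardo energy of test functions\<close>

lemma emeasure_lebesgue_cball:
  assumes "0 \<le> r"
  shows "emeasure lebesgue (cball (x::'a::euclidean_space) r) =
    ennreal (unit_ball_vol (real DIM('a)) * r ^ DIM('a))"
  using emeasure_cball[OF assms, of x] by simp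

text \<open>
  The numerator \<open>min ((norm z)\<^sup>2) 1\<close> is what a bounded Lipschitz function leaves of the difference
  quotient. On a dyadic annulus of radius \<open>r\<close> it is at most \<open>min (r\<^sup>2) 1\<close>, the denominator is comparable to
  \<open>r powr (N + 2 s)\<close> and the volume to \<open>r ^ N\<close>. The bound \<open>r powr (2 - 2 s)\<close> is summable over small dyadic
  radii because \<open>s < 1\<close>, and \<open>r powr (- 2 s)\<close> over large ones because \<open>0 < s\<close>.
\<close>

lemma gagliardo_cutoff_annulus:
  fixes r :: real
  assumes r: "0 < r" and s: "0 < s"
  shows "(\<integral>\<^sup>+z. ennreal (min ((norm z)\<^sup>2) 1 / norm z powr (real DIM('a) + 2 * s)) *
      indicator {z::'a::euclidean_space. r / 2 < norm z \<and> norm z \<le> r} z \<partial>lebesgue) \<le>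
    ennreal (unit_ball_vol (real DIM('a)) * 2 powr (real DIM('a) + 2 * s) * (min (r\<^sup>2) 1 * r powr (- (2 * s))))"
proof -
  let ?a = "real DIM('a) + 2 * s"
  let ?c = "min (r\<^sup>2) 1 / (r / 2) powr ?a"
  have pt: "ennreal (min ((norm z)\<^sup>2) 1 / norm z powr ?a) *
      indicator {z::'a. r / 2 < norm z \<and> norm z \<le> r} z \<le> ennreal ?c * indicator (cball 0 r) z" for z :: 'a
  proof (cases "r / 2 < norm z \<and> norm z \<le> r")
    case True
    have "(norm z)\<^sup>2 \<le> r\<^sup>2" using True by (intro power_mono) auto
    then have "min ((norm z)\<^sup>2) 1 \<le> min (r\<^sup>2) 1" by auto
    then have "min ((norm z)\<^sup>2) 1 / norm z powr ?a \<le> ?c"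
      using True r s by (intro frac_le powr_mono2) auto
    then show ?thesis using True by (auto intro: ennreal_leI)
  qed auto
  have "(\<integral>\<^sup>+z. ennreal (min ((norm z)\<^sup>2) 1 / norm z powr ?a) *
      indicator {z::'a. r / 2 < norm z \<and> norm z \<le> r} z \<partial>lebesgue)
    \<le> (\<integral>\<^sup>+z. ennreal ?c * indicator (cball 0 r) (z::'a) \<partial>lebesgue)"
    by (rule nn_integral_mono) (rule pt)
  also have "\<dots> = ennreal ?c * emeasure lebesgue (cball (0::'a) r)"
    by (rule nn_integral_cmult_indicator) auto
  also have "\<dots> = ennreal ?c * ennreal (unit_ball_vol (real DIM('a)) * r ^ DIM('a))"
    using r emeasure_lebesgue_cball[of r "0::'a"] by simp
  also have "\<dots> = ennreal (?c * (unit_ball_vol (real DIM('a)) * r ^ DIM('a)))"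
    using r by (intro ennreal_mult[symmetric]) auto
  also have "?c * (unit_ball_vol (real DIM('a)) * r ^ DIM('a)) =
    unit_ball_vol (real DIM('a)) * 2 powr ?a * (min (r\<^sup>2) 1 * r powr (- (2 * s)))"
    using r by (simp add: powr_divide powr_add powr_minus powr_realpow field_simps)
  finally show ?thesis .
qed

lemma gagliardo_cutoff_finite:
  assumes s: "0 < s" "s < 1"
  shows "(\<integral>\<^sup>+z. ennreal (min ((norm z)\<^sup>2) 1 / norm z powr (real DIM('a) + 2 * s))
    \<partial>(lebesgue :: 'a::euclidean_space measure)) < \<infinity>"
proof -
  let ?g = "\<lambda>z::'a. ennreal (min ((norm z)\<^sup>2) 1 / norm z powr (real DIM('a) + 2 * s))"
  let ?A = "\<lambda>r. {z::'a. r / 2 < norm z \<and> norm z \<le> r}"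
  let ?K = "unit_ball_vol (real DIM('a)) * 2 powr (real DIM('a) + 2 * s)"
  have A: "?A r \<in> sets lebesgue" for r
  proof -
    have "?A r \<in> sets borel" by measurable
    then show ?thesis by (simp add: sets_completionI_sets)
  qed
  have g: "?g \<in> borel_measurable lebesgue"
    by (rule measurable_completion) simp
  have mA: "(\<lambda>z. ?g z * indicator (?A r) z) \<in> borel_measurable lebesgue" for r
    by (rule borel_measurable_times_ennreal[OF g borel_measurable_indicator[OF A]])
  have mS: "(\<lambda>z. \<Sum>n. ?g z * indicator (?A (r n)) z) \<in> borel_measurable lebesgue" for r :: "nat \<Rightarrow> real"
    by (rule borel_measurable_suminf_order) (rule mA)
  have fin: "(\<Sum>n. \<integral>\<^sup>+z. ?g z * indicator (?A (r n)) z \<partial>lebesgue) < \<infinity>"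
    if r: "\<And>n. 0 < r n" and sum: "summable (\<lambda>n. min ((r n)\<^sup>2) 1 * r n powr (- (2 * s)))"
    for r :: "nat \<Rightarrow> real"
  proof -
    have "(\<Sum>n. \<integral>\<^sup>+z. ?g z * indicator (?A (r n)) z \<partial>lebesgue) \<le>
        (\<Sum>n. ennreal (?K * (min ((r n)\<^sup>2) 1 * r n powr (- (2 * s)))))"
      using gagliardo_cutoff_annulus[OF r s(1), where 'a='a] by (intro suminf_le) auto
    also have "\<dots> = ennreal (\<Sum>n. ?K * (min ((r n)\<^sup>2) 1 * r n powr (- (2 * s))))"
      using sum by (intro suminf_ennreal2 summable_mult) auto
    finally show ?thesis by (simp add: order.strict_trans1)
  qed
  have pw: "\<And>n. (2::real) ^ n = 2 powr (real n)" by (simp add: powr_realpow)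
  have inner: "(\<Sum>n. \<integral>\<^sup>+z. ?g z * indicator (?A (1 / 2 ^ n)) z \<partial>lebesgue) < \<infinity>"
  proof (rule fin)
    have eq: "min ((1 / 2 ^ n)\<^sup>2) 1 * (1 / 2 ^ n) powr (- (2 * s)) = (2 powr (2 * s - 2)) ^ n" for n
    proof -
      have "min ((1 / 2 ^ n)\<^sup>2) 1 = ((1 / 2 ^ n)\<^sup>2 :: real)" by (simp add: power_divide)
      also have "\<dots> * (1 / 2 ^ n) powr (- (2 * s)) = 2 powr (- 2 * real n) * 2 powr (2 * s * real n)"
        by (simp add: pw power_divide powr_divide powr_powr powr_minus field_simps power2_eq_square
            flip: powr_add)
      also have "\<dots> = (2 powr (2 * s - 2)) powr real n"
        by (simp add: powr_powr algebra_simps flip: powr_add)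
      finally show ?thesis by (simp add: powr_realpow)
    qed
    have "(2::real) powr (2 * s - 2) < 2 powr 0" using s by (intro powr_less_mono) auto
    then show "summable (\<lambda>n. min ((1 / 2 ^ n)\<^sup>2) 1 * (1 / 2 ^ n) powr (- (2 * s)))"
      unfolding eq by (intro summable_geometric) auto
  qed auto
  have outer: "(\<Sum>n. \<integral>\<^sup>+z. ?g z * indicator (?A (2 ^ n)) z \<partial>lebesgue) < \<infinity>"
  proof (rule fin)
    have eq: "min ((2 ^ n)\<^sup>2) 1 * (2 ^ n) powr (- (2 * s)) = (2 powr (- (2 * s))) ^ n" for n
    proof -
      have "min (((2::real) ^ n)\<^sup>2) 1 = 1" by (simp add: min_def power_mult[symmetric] antisym)
      moreover have "((2::real) ^ n) powr (- (2 * s)) = (2 powr (- (2 * s))) powr real n"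
        by (simp add: pw powr_powr mult.commute)
      ultimately show ?thesis by (simp add: powr_realpow)
    qed
    have "(2::real) powr (- (2 * s)) < 2 powr 0" using s by (intro powr_less_mono) auto
    then show "summable (\<lambda>n. min ((2 ^ n)\<^sup>2) 1 * (2 ^ n) powr (- (2 * s)))"
      unfolding eq by (intro summable_geometric) auto
  qed auto
  \<comment> \<open>Away from the origin the dyadic annuli inside and outside the unit sphere exhaust the space.\<close>
  have cover: "?g z \<le> (\<Sum>n. ?g z * indicator (?A (1 / 2 ^ n)) z) + (\<Sum>n. ?g z * indicator (?A (2 ^ n)) z)" for z
  proof (cases "z = 0")
    case False
    have le: "?g z \<le> (\<Sum>n. ?g z * indicator (?A (r n)) z)" if "z \<in> ?A (r n)" for r n
    proof -
      have "?g z = (\<Sum>i\<in>{n}. ?g z * indicator (?A (r i)) z)" using that by simp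
      also have "\<dots> \<le> (\<Sum>n. ?g z * indicator (?A (r n)) z)" by (rule sum_le_suminf) auto
      finally show ?thesis .
    qed
    show ?thesis
    proof (cases "norm z \<le> 1")
      case True
      define P where "P n \<longleftrightarrow> 1 / 2 ^ Suc n < norm z" for n
      have "\<exists>n. P n"
      proof -
        obtain n where "(1/2)^n < norm z" using real_arch_pow_inv[of "norm z" "1/2"] False by auto
        moreover have "(1/2::real)^Suc n \<le> (1/2)^n" by simp
        ultimately have "(1/2)^Suc n < norm z" by linarith
        then show ?thesis by (intro exI[of _ n]) (simp add: P_def power_divide)
      qed
      define n where "n = (LEAST n. P n)"
      have Pn: "P n" unfolding n_def using \<open>\<exists>n. P n\<close> by (rule LeastI_ex)
      have "norm z \<le> 1 / 2 ^ n"
      proof (cases n)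
        case (Suc m)
        then have "\<not> P m" using not_less_Least[of m P] by (simp add: n_def)
        then show ?thesis using Suc by (simp add: P_def)
      qed (use True in simp)
      then have "z \<in> ?A (1 / 2 ^ n)" using Pn by (simp add: P_def)
      from le[of "\<lambda>n. 1 / 2 ^ n", OF this] show ?thesis
        by (rule order_trans) (rule add_increasing2[OF _ order_refl], simp)
    next
      case False
      define P where "P n \<longleftrightarrow> norm z \<le> 2 ^ n" for n
      have "\<exists>n. P n" unfolding P_def using real_arch_pow[of 2 "norm z"] by (auto intro: less_imp_le)
      define n where "n = (LEAST n. P n)"
      have Pn: "P n" unfolding n_def using \<open>\<exists>n. P n\<close> by (rule LeastI_ex)
      have "n \<noteq> 0"
      proof
        assume "n = 0"
        then show False using Pn False unfolding P_def by simp
      qed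
      then obtain m where m: "n = Suc m" by (cases n) auto
      then have "\<not> P m" using not_less_Least[of m P] by (simp add: n_def)
      then have "z \<in> ?A (2 ^ n)" using Pn m by (simp add: P_def)
      from le[of "\<lambda>n. 2 ^ n", OF this] show ?thesis
        by (rule order_trans) (rule add_increasing[OF _ order_refl], simp)
    qed
  qed simp
  have "(\<integral>\<^sup>+z. ?g z \<partial>lebesgue) \<le>
    (\<integral>\<^sup>+z. (\<Sum>n. ?g z * indicator (?A (1 / 2 ^ n)) z) + (\<Sum>n. ?g z * indicator (?A (2 ^ n)) z) \<partial>lebesgue)"
    by (rule nn_integral_mono) (rule cover)
  also have "\<dots> = (\<Sum>n. \<integral>\<^sup>+z. ?g z * indicator (?A (1 / 2 ^ n)) z \<partial>lebesgue) +
      (\<Sum>n. \<integral>\<^sup>+z. ?g z * indicator (?A (2 ^ n)) z \<partial>lebesgue)"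
    by (simp only: nn_integral_add[OF mS mS] nn_integral_suminf[OF mA])
  also have "\<dots> < \<infinity>" using inner outer by simp
  finally show ?thesis .
qed

text \<open>
  The class \<open>C_k\<close> controls partial derivatives only. On a ball these are bounded by compactness, hence so is
  the operator norm of the full derivative, and the mean value inequality applies because a ball is convex.
\<close>

lemma C_1_bounded_Lipschitz_cball:
  fixes f :: "'a::euclidean_space \<Rightarrow> real"
  assumes "C_k (Suc 0) f"
  obtains L where "0 \<le> L" "\<And>x y. x \<in> cball 0 R \<Longrightarrow> y \<in> cball 0 R \<Longrightarrow> \<bar>f x - f y\<bar> \<le> L * norm (x - y)"
proof -
  let ?d = "\<lambda>b x. frechet_derivative f (at x) b"
  have diff: "f differentiable_on UNIV" and cont: "\<And>b. b \<in> Basis \<Longrightarrow> continuous_on UNIV (?d b)"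
    using assms by auto
  have "\<exists>B. \<forall>x\<in>cball 0 R. \<bar>?d b x\<bar> \<le> B" if "b \<in> Basis" for b
  proof -
    have "compact (?d b ` cball 0 R)"
      using cont[OF that] by (intro compact_continuous_image) (auto intro: continuous_on_subset)
    then have "bounded (?d b ` cball 0 R)" by (rule compact_imp_bounded)
    then show ?thesis by (auto simp: bounded_iff)
  qed
  then obtain B where B: "\<And>b x. b \<in> Basis \<Longrightarrow> x \<in> cball 0 R \<Longrightarrow> \<bar>?d b x\<bar> \<le> B b" by metis
  let ?L = "\<Sum>b\<in>Basis. \<bar>B b\<bar>"
  have der: "(f has_derivative frechet_derivative f (at x)) (at x)" for x
    using diff by (simp add: differentiable_on_def frechet_derivative_works[symmetric])
  have on: "onorm (frechet_derivative f (at x)) \<le> ?L" if x: "x \<in> cball 0 R" for x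
  proof (rule onorm_le)
    fix h :: 'a
    let ?D = "frechet_derivative f (at x)"
    have lin: "linear ?D" using der[of x] by (rule has_derivative_linear)
    have "?D h = ?D (\<Sum>b\<in>Basis. (h \<bullet> b) *\<^sub>R b)" by (simp add: euclidean_representation)
    also have "\<dots> = (\<Sum>b\<in>Basis. (h \<bullet> b) * ?D b)"
      by (simp add: linear_sum[OF lin] linear_cmul[OF lin])
    finally have "norm (?D h) \<le> (\<Sum>b\<in>Basis. \<bar>h \<bullet> b\<bar> * \<bar>?D b\<bar>)"
      using sum_abs[of "\<lambda>b. (h \<bullet> b) * ?D b" Basis] by (simp add: abs_mult)
    also have "\<dots> \<le> (\<Sum>b\<in>Basis. norm h * \<bar>B b\<bar>)"
    proof (intro sum_mono mult_mono)
      fix b :: 'a assume b: "b \<in> Basis"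
      show "\<bar>h \<bullet> b\<bar> \<le> norm h" by (rule Basis_le_norm[OF b])
      show "\<bar>?D b\<bar> \<le> \<bar>B b\<bar>" using B[OF b x] by linarith
    qed auto
    finally show "norm (?D h) \<le> ?L * norm h" by (simp add: sum_distrib_left mult.commute)
  qed
  show ?thesis
  proof (rule that[of ?L])
    show "0 \<le> ?L" by (simp add: sum_nonneg)
    fix x y :: 'a assume "x \<in> cball 0 R" "y \<in> cball 0 R"
    then show "\<bar>f x - f y\<bar> \<le> ?L * norm (x - y)"
      using differentiable_bound[of "cball 0 R" f "\<lambda>x. frechet_derivative f (at x)" ?L x y] on der
      by (auto simp: has_derivative_at_withinI)
  qed
qed

lemma test_function_borel: "\<phi> \<in> test_functions \<Longrightarrow> \<phi> \<in> borel_measurable lebesgue"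
  unfolding test_functions_def using C_k.simps(1)[of \<phi>]
  by (auto intro!: measurable_completion borel_measurable_continuous_onI)

text \<open>
  A difference vanishes unless one of the two points lies in the support \<open>K\<close>. Nearby points are
  controlled by the Lipschitz constant on a ball that contains the unit neighbourhood of \<open>K\<close>, distant
  ones by the supremum.
\<close>

lemma test_function_difference_bound:
  fixes \<phi> :: "'a::euclidean_space \<Rightarrow> real"
  assumes "\<phi> \<in> test_functions"
  obtains K C where "compact K" "0 \<le> C" "\<And>x y. (\<phi> x - \<phi> y)\<^sup>2 \<le>
    C * min ((norm (x - y))\<^sup>2) 1 * (indicator K x + indicator K y)"
proof -
  define K where "K = closure {x. \<phi> x \<noteq> 0}"
  have K: "compact K" and C: "\<And>k. C_k k \<phi>" using assms by (auto simp: test_functions_def K_def)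
  have out: "\<phi> x = 0" if "x \<notin> K" for x
    using that closure_subset[of "{x. \<phi> x \<noteq> 0}"] by (auto simp: K_def)
  have cont: "continuous_on UNIV \<phi>" using C[of 0] by simp
  have "bounded (\<phi> ` K)"
    using K cont by (intro compact_imp_bounded compact_continuous_image) (auto intro: continuous_on_subset)
  then obtain M0 where M0: "\<And>x. x \<in> K \<Longrightarrow> \<bar>\<phi> x\<bar> \<le> M0" by (auto simp: bounded_iff)
  define M where "M = \<bar>M0\<bar>"
  have M: "\<bar>\<phi> x\<bar> \<le> M" for x using M0[of x] out[of x] by (cases "x \<in> K") (auto simp: M_def)
  obtain R where R: "\<And>x. x \<in> K \<Longrightarrow> norm x \<le> R"
    using compact_imp_bounded[OF K] by (auto simp: bounded_iff)
  obtain L where L: "0 \<le> L"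
    "\<And>x y. x \<in> cball 0 (R + 1) \<Longrightarrow> y \<in> cball 0 (R + 1) \<Longrightarrow> \<bar>\<phi> x - \<phi> y\<bar> \<le> L * norm (x - y)"
    using C_1_bounded_Lipschitz_cball[OF C] by blast
  let ?C = "L\<^sup>2 + (2 * M)\<^sup>2"
  have main: "(\<phi> x - \<phi> y)\<^sup>2 \<le> ?C * min ((norm (x - y))\<^sup>2) 1" if xy: "x \<in> K \<or> y \<in> K" for x y
  proof (cases "norm (x - y) \<le> 1")
    case True
    have "norm x \<le> R + 1 \<and> norm y \<le> R + 1"
      using xy R[of x] R[of y] True norm_triangle_ineq2[of x y] norm_triangle_ineq2[of y x]
      by (auto simp: norm_minus_commute)
    then have "\<bar>\<phi> x - \<phi> y\<bar> \<le> L * norm (x - y)" by (intro L) auto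
    then have "(\<phi> x - \<phi> y)\<^sup>2 \<le> (L * norm (x - y))\<^sup>2" by (rule power2_le_iff_abs_le[THEN iffD2, rotated]) (use L in auto)
    also have "\<dots> \<le> ?C * (norm (x - y))\<^sup>2"
      unfolding power_mult_distrib by (intro mult_right_mono) auto
    also have "(norm (x - y))\<^sup>2 = min ((norm (x - y))\<^sup>2) 1"
      using True by (simp add: min_def power_le_one)
    finally show ?thesis .
  next
    case False
    then have m: "min ((norm (x - y))\<^sup>2) 1 = 1" by (simp add: min_def power2_eq_square) (smt (verit) mult_le_cancel_left1 norm_ge_zero)
    have "\<bar>\<phi> x - \<phi> y\<bar> \<le> 2 * M" using M[of x] M[of y] by linarith
    then have "(\<phi> x - \<phi> y)\<^sup>2 \<le> (2 * M)\<^sup>2" by (rule power2_le_iff_abs_le[THEN iffD2, rotated]) (auto simp: M_def)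
    then show ?thesis unfolding m by (simp add: add_increasing)
  qed
  show ?thesis
  proof (rule that[of K ?C])
    fix x y :: 'a
    show "(\<phi> x - \<phi> y)\<^sup>2 \<le> ?C * min ((norm (x - y))\<^sup>2) 1 * (indicator K x + indicator K y)"
    proof (cases "x \<in> K \<or> y \<in> K")
      case True
      have "1 \<le> (indicator K x + indicator K y :: real)" using True by (auto simp: indicator_def)
      then have "?C * min ((norm (x - y))\<^sup>2) 1 * 1 \<le>
          ?C * min ((norm (x - y))\<^sup>2) 1 * (indicator K x + indicator K y)"
        by (intro mult_left_mono) auto
      with main[OF True] show ?thesis by simp
    qed (simp add: out)
  qed (use K in auto)
qed

text \<open>
  Integrating the preceding bound, translation invariance decouples the two variables and leaves twice the
  measure of the support times the integral over the dyadic annuli.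
\<close>

lemma gagliardo_sq_test_function_finite:
  fixes \<phi> :: "'a::euclidean_space \<Rightarrow> real"
  assumes \<phi>: "\<phi> \<in> test_functions" and s: "0 < s" "s < 1"
  shows "gagliardo_sq s \<phi> < \<infinity>"
proof -
  obtain K C where K: "compact K" and C: "0 \<le> C" and bound: "\<And>x y. (\<phi> x - \<phi> y)\<^sup>2 \<le>
      C * min ((norm (x - y))\<^sup>2) 1 * (indicator K x + indicator K y)"
    using test_function_difference_bound[OF \<phi>] by metis
  let ?r = "real DIM('a) + 2 * s"
  let ?g = "\<lambda>z::'a. ennreal (min ((norm z)\<^sup>2) 1 / norm z powr ?r)"
  have Ks: "K \<in> sets lebesgue" using K by (simp add: compact_imp_closed borel_closed sets_completionI_sets)
  then have [measurable]: "indicator K \<in> borel_measurable (lebesgue :: 'a measure)" by simp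
  have gborel: "?g \<in> borel_measurable borel" by simp
  have gm: "?g \<in> borel_measurable lebesgue" by (rule measurable_completion) simp
  have [measurable]: "(\<lambda>x::'a. x) \<in> lebesgue \<rightarrow>\<^sub>M borel"
    by (rule measurable_completion) simp
  have [measurable]: "(\<lambda>p::'a\<times>'a. fst p) \<in> lebesgue \<Otimes>\<^sub>M lebesgue \<rightarrow>\<^sub>M borel"
     "(\<lambda>p::'a\<times>'a. snd p) \<in> lebesgue \<Otimes>\<^sub>M lebesgue \<rightarrow>\<^sub>M borel"
    by measurable
  have G[measurable]: "(\<lambda>p::'a\<times>'a. ?g (fst p - snd p)) \<in> borel_measurable (lebesgue \<Otimes>\<^sub>M lebesgue)"
    by (rule measurable_compose[OF _ gborel]) measurable
  have trans: "(\<integral>\<^sup>+y. ?g (x - y) \<partial>lebesgue) = (\<integral>\<^sup>+z. ?g z \<partial>lebesgue)" for x :: 'a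
    using nn_integral_lebesgue_affine[OF gm, of "-1" x] by simp
  have m1: "(\<lambda>p. indicator K (fst p) * ?g (fst p - snd p)) \<in> borel_measurable (lebesgue \<Otimes>\<^sub>M lebesgue)"
    and m2: "(\<lambda>p. indicator K (snd p) * ?g (fst p - snd p)) \<in> borel_measurable (lebesgue \<Otimes>\<^sub>M lebesgue)"
    by measurable
  have g1: "(\<lambda>y. ?g (x - y)) \<in> borel_measurable lebesgue" for x :: 'a
    using measurable_compose_Pair1[OF _ G, of x] by simp
  have half1: "(\<integral>\<^sup>+p. indicator K (fst p) * ?g (fst p - snd p) \<partial>(lebesgue \<Otimes>\<^sub>M lebesgue))
      = emeasure lebesgue K * (\<integral>\<^sup>+z. ?g z \<partial>lebesgue)"
  proof -
    have "(\<integral>\<^sup>+p. indicator K (fst p) * ?g (fst p - snd p) \<partial>(lebesgue \<Otimes>\<^sub>M lebesgue)) =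
        (\<integral>\<^sup>+x. \<integral>\<^sup>+y. indicator K x * ?g (x - y) \<partial>lebesgue \<partial>lebesgue)"
      using sigma_finite_measure.nn_integral_fst[OF sigma_finite_lebesgue m1] by simp
    also have "\<dots> = (\<integral>\<^sup>+x. indicator K x * (\<integral>\<^sup>+z. ?g z \<partial>lebesgue) \<partial>lebesgue)"
      by (intro nn_integral_cong) (simp add: nn_integral_cmult[OF g1] trans)
    finally show ?thesis using Ks by (simp add: nn_integral_multc)
  qed
  have half2: "(\<integral>\<^sup>+p. indicator K (snd p) * ?g (fst p - snd p) \<partial>(lebesgue \<Otimes>\<^sub>M lebesgue))
      = emeasure lebesgue K * (\<integral>\<^sup>+z. ?g z \<partial>lebesgue)"
  proof -
    have sym: "?g (x - y) = ?g (y - x)" for x y :: 'a by (simp add: norm_minus_commute)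
    have "(\<integral>\<^sup>+p. indicator K (snd p) * ?g (fst p - snd p) \<partial>(lebesgue \<Otimes>\<^sub>M lebesgue)) =
        (\<integral>\<^sup>+y. \<integral>\<^sup>+x. indicator K y * ?g (x - y) \<partial>lebesgue \<partial>lebesgue)"
      using lebesgue_pair.nn_integral_snd[OF m2] by simp
    also have "\<dots> = (\<integral>\<^sup>+y. \<integral>\<^sup>+x. indicator K y * ?g (y - x) \<partial>lebesgue \<partial>lebesgue)"
      by (subst sym) (rule refl)
    also have "\<dots> = (\<integral>\<^sup>+x. indicator K x * (\<integral>\<^sup>+z. ?g z \<partial>lebesgue) \<partial>lebesgue)"
      by (intro nn_integral_cong) (simp add: nn_integral_cmult[OF g1] trans)
    finally show ?thesis using Ks by (simp add: nn_integral_multc)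
  qed
  have pt: "ennreal ((\<phi> x - \<phi> y)\<^sup>2 / norm (x - y) powr ?r) \<le>
      ennreal C * (indicator K x * ?g (x - y) + indicator K y * ?g (x - y))" for x y
  proof -
    have "(\<phi> x - \<phi> y)\<^sup>2 / norm (x - y) powr ?r \<le>
      C * min ((norm (x - y))\<^sup>2) 1 * (indicator K x + indicator K y) / norm (x - y) powr ?r"
      by (rule divide_right_mono[OF bound]) simp
    also have "\<dots> = C * ((indicator K x + indicator K y) * (min ((norm (x - y))\<^sup>2) 1 / norm (x - y) powr ?r))"
      by simp
    finally have "ennreal ((\<phi> x - \<phi> y)\<^sup>2 / norm (x - y) powr ?r) \<le> ennreal \<dots>"
      by (rule ennreal_leI)
    also have "\<dots> = ennreal C * (indicator K x * ?g (x - y) + indicator K y * ?g (x - y))"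
    proof -
      have "ennreal (indicator K x + indicator K y) = indicator K x + indicator K y"
        by (simp add: ennreal_indicator)
      then show ?thesis
        using C by (subst ennreal_mult, simp, simp, subst ennreal_mult) (auto simp: distrib_right)
    qed
    finally show ?thesis .
  qed
  have Kfin: "emeasure lebesgue K < \<infinity>"
    using emeasure_compact_finite[OF K] K by (simp add: compact_imp_closed)
  have "gagliardo_sq s \<phi> \<le> (\<integral>\<^sup>+p. ennreal C * (indicator K (fst p) * ?g (fst p - snd p) +
      indicator K (snd p) * ?g (fst p - snd p)) \<partial>(lebesgue \<Otimes>\<^sub>M lebesgue))"
    unfolding gagliardo_sq_def case_prod_beta' by (rule nn_integral_mono) (rule pt)
  also have "\<dots> = ennreal C * (emeasure lebesgue K * (\<integral>\<^sup>+z. ?g z \<partial>lebesgue) +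
      emeasure lebesgue K * (\<integral>\<^sup>+z. ?g z \<partial>lebesgue))"
    using m1 m2 by (simp add: nn_integral_cmult nn_integral_add half1 half2)
  also have "\<dots> < \<infinity>"
    using gagliardo_cutoff_finite[OF s, where 'a='a] Kfin
    by (simp add: ennreal_mult_less_top del: emeasure_completion)
  finally show ?thesis .
qed

section \<open>The energy space is invariant under sums, multiples and dilations\<close>

lemma C_k_scaleR:
  fixes f :: "'a::euclidean_space \<Rightarrow> real"
  assumes "C_k n f"
  shows "C_k n (\<lambda>x. k * f (c *\<^sub>R x))"
  using assms
proof (induction n arbitrary: f k)
  case 0
  then have "continuous_on UNIV f" by simp
  then have "continuous_on UNIV (\<lambda>x. f (c *\<^sub>R x))"
    by (rule continuous_on_compose2) (auto intro!: continuous_intros)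
  then show ?case by (auto intro!: continuous_intros)
next
  case (Suc n)
  let ?g = "\<lambda>x. k * f (c *\<^sub>R x)"
  have diff: "f differentiable_on UNIV" and part: "\<And>b. b \<in> Basis \<Longrightarrow> C_k n (\<lambda>x. frechet_derivative f (at x) b)"
    using Suc.prems by auto
  have der: "(f has_derivative frechet_derivative f (at x)) (at x)" for x
    using diff by (simp add: differentiable_on_def frechet_derivative_works[symmetric])
  have der': "(?g has_derivative (\<lambda>h. k * frechet_derivative f (at (c *\<^sub>R x)) (c *\<^sub>R h))) (at x)" for x
  proof -
    have "((\<lambda>x. c *\<^sub>R x) has_derivative (\<lambda>h. c *\<^sub>R h)) (at x)"
      by (auto intro!: derivative_eq_intros)
    then have "((\<lambda>x. f (c *\<^sub>R x)) has_derivative (\<lambda>h. frechet_derivative f (at (c *\<^sub>R x)) (c *\<^sub>R h))) (at x)"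
      using der by (rule has_derivative_compose)
    then show ?thesis by (rule has_derivative_mult_right)
  qed
  have "frechet_derivative ?g (at x) b = (k * c) * frechet_derivative f (at (c *\<^sub>R x)) b" for x b
    using frechet_derivative_at[OF der'[of x], symmetric]
      linear_cmul[OF has_derivative_linear[OF der[of "c *\<^sub>R x"]], of c b] by simp
  then show ?case
    using der' Suc.IH[OF part] by (auto simp: differentiable_on_def differentiable_def)
qed

lemma C_k_add:
  fixes f g :: "'a::euclidean_space \<Rightarrow> real"
  assumes "C_k n f" "C_k n g"
  shows "C_k n (\<lambda>x. f x + g x)"
  using assms
proof (induction n arbitrary: f g)
  case 0
  then show ?case by (auto intro!: continuous_intros)
next
  case (Suc n)
  have der: "(f has_derivative frechet_derivative f (at x)) (at x)"
      "(g has_derivative frechet_derivative g (at x)) (at x)" for x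
    using Suc.prems by (auto simp: differentiable_on_def frechet_derivative_works[symmetric])
  have der': "((\<lambda>x. f x + g x) has_derivative
      (\<lambda>h. frechet_derivative f (at x) h + frechet_derivative g (at x) h)) (at x)" for x
    using der by (intro has_derivative_add)
  have "frechet_derivative (\<lambda>x. f x + g x) (at x) b =
      frechet_derivative f (at x) b + frechet_derivative g (at x) b" for x b
    using frechet_derivative_at[OF der'[of x], symmetric] by simp
  then show ?case
    using der' Suc.IH Suc.prems by (auto simp: differentiable_on_def differentiable_def)
qed

lemma test_function_scaleR:
  fixes \<phi> :: "'a::euclidean_space \<Rightarrow> real"
  assumes \<phi>: "\<phi> \<in> test_functions" and c: "c \<noteq> 0"
  shows "(\<lambda>x. k * \<phi> (c *\<^sub>R x)) \<in> test_functions"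
proof -
  let ?S = "{x. \<phi> x \<noteq> 0}"
  have K: "compact (closure ?S)" using \<phi> by (simp add: test_functions_def)
  have im: "compact ((*\<^sub>R) (inverse c) ` closure ?S)" by (rule compact_scaling[OF K])
  have "{x. k * \<phi> (c *\<^sub>R x) \<noteq> 0} \<subseteq> (*\<^sub>R) (inverse c) ` closure ?S"
  proof
    fix x assume "x \<in> {x. k * \<phi> (c *\<^sub>R x) \<noteq> 0}"
    then have "c *\<^sub>R x \<in> ?S" by simp
    then have "c *\<^sub>R x \<in> closure ?S" by (rule subsetD[OF closure_subset])
    then have "inverse c *\<^sub>R (c *\<^sub>R x) \<in> (*\<^sub>R) (inverse c) ` closure ?S" by (rule imageI)
    then show "x \<in> (*\<^sub>R) (inverse c) ` closure ?S" using c by simp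
  qed
  then have "closure {x. k * \<phi> (c *\<^sub>R x) \<noteq> 0} \<subseteq> (*\<^sub>R) (inverse c) ` closure ?S"
    by (rule closure_minimal) (rule compact_imp_closed[OF im])
  then have "compact (closure {x. k * \<phi> (c *\<^sub>R x) \<noteq> 0})"
    using im by (meson bounded_subset closed_closure compact_eq_bounded_closed)
  moreover have "C_k j (\<lambda>x. k * \<phi> (c *\<^sub>R x))" for j
    using \<phi> by (intro C_k_scaleR) (simp add: test_functions_def)
  ultimately show ?thesis unfolding test_functions_def by blast
qed

lemma test_function_add:
  fixes \<phi> \<psi> :: "'a::euclidean_space \<Rightarrow> real"
  assumes "\<phi> \<in> test_functions" "\<psi> \<in> test_functions"
  shows "(\<lambda>x. \<phi> x + \<psi> x) \<in> test_functions"
proof -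
  have "bounded {x. \<phi> x \<noteq> 0}" "bounded {x. \<psi> x \<noteq> 0}"
    using assms by (auto simp: test_functions_def)
  then have "bounded ({x. \<phi> x \<noteq> 0} \<union> {x. \<psi> x \<noteq> 0})" by simp
  then have "bounded {x. \<phi> x + \<psi> x \<noteq> 0}" by (rule bounded_subset) auto
  moreover have "C_k j (\<lambda>x. \<phi> x + \<psi> x)" for j
    using assms by (intro C_k_add) (simp_all add: test_functions_def)
  ultimately show ?thesis by (simp add: test_functions_def)
qed

lemma D_space_borel: "u \<in> D_space s \<Longrightarrow> u \<in> borel_measurable lebesgue"
  by (simp add: D_space_def)

lemma D_space_scaleR:
  fixes u :: "'a::euclidean_space \<Rightarrow> real"
  assumes u: "u \<in> D_space s" and c: "0 < c"
  shows "(\<lambda>x. k * u (c *\<^sub>R x)) \<in> D_space s"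
proof -
  note um = D_space_borel[OF u]
  obtain \<phi> where \<phi>: "\<And>n::nat. \<phi> n \<in> test_functions"
    "(\<lambda>n. gagliardo_sq s (\<lambda>x. u x - \<phi> n x)) \<longlonglongrightarrow> 0" "AE x in lebesgue. (\<lambda>n. \<phi> n x) \<longlonglongrightarrow> u x"
    using u by (auto simp: D_space_def)
  let ?\<psi> = "\<lambda>n x. k * \<phi> n (c *\<^sub>R x)"
  have eq: "gagliardo_sq s (\<lambda>x. k * u (c *\<^sub>R x) - ?\<psi> n x) =
     ennreal (k\<^sup>2 * c powr (2 * s - real DIM('a))) * gagliardo_sq s (\<lambda>x. u x - \<phi> n x)" for n
  proof -
    have "(\<lambda>x. u x - \<phi> n x) \<in> borel_measurable lebesgue"
      using um test_function_borel[OF \<phi>(1)] by measurable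
    from gagliardo_sq_scaleR[OF this c, of s k] show ?thesis
      by (simp add: right_diff_distrib)
  qed
  have "(\<lambda>n. gagliardo_sq s (\<lambda>x. k * u (c *\<^sub>R x) - ?\<psi> n x)) \<longlonglongrightarrow>
      ennreal (k\<^sup>2 * c powr (2 * s - real DIM('a))) * 0"
    unfolding eq by (rule ennreal_tendsto_cmult) (use \<phi>(2) in auto)
  moreover have "AE x in lebesgue. (\<lambda>n. ?\<psi> n x) \<longlonglongrightarrow> k * u (c *\<^sub>R x)"
    using AE_lebesgue_scaleR[OF \<phi>(3), of c] c by (auto elim!: eventually_mono intro!: tendsto_intros)
  moreover have "\<forall>n. ?\<psi> n \<in> test_functions"
    using test_function_scaleR[OF \<phi>(1)] c by auto
  moreover have "(\<lambda>x. k * u (c *\<^sub>R x)) \<in> borel_measurable lebesgue"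
    using measurable_compose_scaleR[OF um, of c] by measurable
  ultimately show ?thesis by (auto simp: D_space_def)
qed

lemma D_space_cmult: "u \<in> D_space s \<Longrightarrow> (\<lambda>x. k * u x) \<in> D_space s"
  using D_space_scaleR[of u s 1 k] by simp

lemma gagliardo_sq_add_le:
  fixes u w :: "'a::euclidean_space \<Rightarrow> real"
  assumes u: "u \<in> borel_measurable lebesgue" and w: "w \<in> borel_measurable lebesgue"
  shows "gagliardo_sq s (\<lambda>x. u x + w x) \<le> 2 * gagliardo_sq s u + 2 * gagliardo_sq s w"
proof -
  let ?r = "real DIM('a) + 2 * s"
  let ?k = "\<lambda>u p. (u (fst p) - u (snd p))\<^sup>2 / norm (fst p - snd p :: 'a) powr ?r"
  have m: "(\<lambda>p. ennreal (?k v p)) \<in> borel_measurable (lebesgue \<Otimes>\<^sub>M lebesgue)"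
    if "v \<in> borel_measurable lebesgue" for v
    using borel_measurable_gagliardo_kernel[OF that, of ?r] by (simp add: case_prod_beta')
  have pt: "ennreal (?k (\<lambda>x. u x + w x) p) \<le> 2 * ennreal (?k u p) + 2 * ennreal (?k w p)" for p
  proof -
    have sq: "(a + b)\<^sup>2 \<le> 2 * a\<^sup>2 + 2 * b\<^sup>2" for a b :: real
      using zero_le_power2[of "a - b"] by (simp add: power2_eq_square algebra_simps)
    have "?k (\<lambda>x. u x + w x) p \<le> (2 * (u (fst p) - u (snd p))\<^sup>2 + 2 * (w (fst p) - w (snd p))\<^sup>2) / norm (fst p - snd p) powr ?r"
      using sq[of "u (fst p) - u (snd p)" "w (fst p) - w (snd p)"]
      by (intro divide_right_mono) (auto simp: algebra_simps)
    also have "\<dots> = 2 * ?k u p + 2 * ?k w p" by (simp add: add_divide_distrib)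
    finally have "ennreal (?k (\<lambda>x. u x + w x) p) \<le> ennreal (2 * ?k u p + 2 * ?k w p)" by (rule ennreal_leI)
    also have "\<dots> = 2 * ennreal (?k u p) + 2 * ennreal (?k w p)"
      using ennreal_mult[of 2 "?k u p"] ennreal_mult[of 2 "?k w p"] by (subst ennreal_plus) auto
    finally show ?thesis .
  qed
  have "gagliardo_sq s (\<lambda>x. u x + w x) \<le>
      (\<integral>\<^sup>+p. 2 * ennreal (?k u p) + 2 * ennreal (?k w p) \<partial>(lebesgue \<Otimes>\<^sub>M lebesgue))"
    unfolding gagliardo_sq_def case_prod_beta' by (rule nn_integral_mono) (rule pt)
  also have "\<dots> = 2 * gagliardo_sq s u + 2 * gagliardo_sq s w"
    unfolding gagliardo_sq_def case_prod_beta' using m[OF u] m[OF w]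
    by (subst nn_integral_add) (auto simp: nn_integral_cmult)
  finally show ?thesis .
qed

lemma D_space_add:
  fixes u w :: "'a::euclidean_space \<Rightarrow> real"
  assumes u: "u \<in> D_space s" and w: "w \<in> D_space s"
  shows "(\<lambda>x. u x + w x) \<in> D_space s"
proof -
  note um = D_space_borel[OF u] and wm = D_space_borel[OF w]
  obtain \<phi> where \<phi>: "\<And>n::nat. \<phi> n \<in> test_functions"
    "(\<lambda>n. gagliardo_sq s (\<lambda>x. u x - \<phi> n x)) \<longlonglongrightarrow> 0" "AE x in lebesgue. (\<lambda>n. \<phi> n x) \<longlonglongrightarrow> u x"
    using u by (auto simp: D_space_def)
  obtain \<psi> where \<psi>: "\<And>n::nat. \<psi> n \<in> test_functions"
    "(\<lambda>n. gagliardo_sq s (\<lambda>x. w x - \<psi> n x)) \<longlonglongrightarrow> 0" "AE x in lebesgue. (\<lambda>n. \<psi> n x) \<longlonglongrightarrow> w x"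
    using w by (auto simp: D_space_def)
  let ?\<theta> = "\<lambda>n x. \<phi> n x + \<psi> n x"
  have le: "gagliardo_sq s (\<lambda>x. (u x + w x) - ?\<theta> n x) \<le>
      2 * gagliardo_sq s (\<lambda>x. u x - \<phi> n x) + 2 * gagliardo_sq s (\<lambda>x. w x - \<psi> n x)" for n
  proof -
    have "(\<lambda>x. u x - \<phi> n x) \<in> borel_measurable lebesgue" "(\<lambda>x. w x - \<psi> n x) \<in> borel_measurable lebesgue"
      using um wm test_function_borel[OF \<phi>(1)] test_function_borel[OF \<psi>(1)] by measurable
    from gagliardo_sq_add_le[OF this, of s] show ?thesis by (simp add: algebra_simps)
  qed
  have lim: "(\<lambda>n. 2 * gagliardo_sq s (\<lambda>x. u x - \<phi> n x) + 2 * gagliardo_sq s (\<lambda>x. w x - \<psi> n x))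
      \<longlonglongrightarrow> 2 * 0 + 2 * 0"
    using \<phi>(2) \<psi>(2) by (intro tendsto_add ennreal_tendsto_cmult) auto
  have "(\<lambda>n. gagliardo_sq s (\<lambda>x. (u x + w x) - ?\<theta> n x)) \<longlonglongrightarrow> 0"
  proof (rule tendsto_sandwich)
    show "\<forall>\<^sub>F n in sequentially. 0 \<le> gagliardo_sq s (\<lambda>x. (u x + w x) - ?\<theta> n x)" by simp
    show "(\<lambda>_. 0) \<longlonglongrightarrow> (0 :: ennreal)" by (rule tendsto_const)
    show "\<forall>\<^sub>F n in sequentially. gagliardo_sq s (\<lambda>x. (u x + w x) - ?\<theta> n x) \<le>
        2 * gagliardo_sq s (\<lambda>x. u x - \<phi> n x) + 2 * gagliardo_sq s (\<lambda>x. w x - \<psi> n x)"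
      using le by simp
    show "(\<lambda>n. 2 * gagliardo_sq s (\<lambda>x. u x - \<phi> n x) + 2 * gagliardo_sq s (\<lambda>x. w x - \<psi> n x)) \<longlonglongrightarrow> 0"
      using lim by simp
  qed
  moreover have "AE x in lebesgue. (\<lambda>n. ?\<theta> n x) \<longlonglongrightarrow> u x + w x"
    using \<phi>(3) \<psi>(3) by eventually_elim (rule tendsto_add)
  moreover have "\<forall>n. ?\<theta> n \<in> test_functions"
    using test_function_add[OF \<phi>(1) \<psi>(1)] by auto
  moreover have "(\<lambda>x. u x + w x) \<in> borel_measurable lebesgue"
    using um wm by measurable
  ultimately show ?thesis by (auto simp: D_space_def)
qed

text \<open>
  The completion is defined through differences to test functions. Its elements have finite energy because
  test functions have; without this the real-valued form would read an infinite energy as \<open>0\<close>.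
\<close>

lemma gagliardo_sq_D_space_finite:
  fixes u :: "'a::euclidean_space \<Rightarrow> real"
  assumes u: "u \<in> D_space s" and s: "0 < s" "s < 1"
  shows "gagliardo_sq s u < \<infinity>"
proof -
  obtain \<phi> where \<phi>: "\<And>n::nat. \<phi> n \<in> test_functions"
    "(\<lambda>n. gagliardo_sq s (\<lambda>x. u x - \<phi> n x)) \<longlonglongrightarrow> 0"
    using u by (auto simp: D_space_def)
  have "eventually (\<lambda>n. gagliardo_sq s (\<lambda>x. u x - \<phi> n x) < 1) sequentially"
    using \<phi>(2) by (rule order_tendstoD) simp
  then obtain n where n: "gagliardo_sq s (\<lambda>x. u x - \<phi> n x) < 1"
    by (auto simp: eventually_sequentially)
  have \<phi>m: "\<phi> n \<in> borel_measurable lebesgue" by (rule test_function_borel[OF \<phi>(1)])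
  have dm: "(\<lambda>x. u x - \<phi> n x) \<in> borel_measurable lebesgue"
    using D_space_borel[OF u] \<phi>m by measurable
  have "gagliardo_sq s (\<lambda>x. (u x - \<phi> n x) + \<phi> n x) \<le>
      2 * gagliardo_sq s (\<lambda>x. u x - \<phi> n x) + 2 * gagliardo_sq s (\<phi> n)"
    by (rule gagliardo_sq_add_le[OF dm \<phi>m])
  also have "\<dots> < \<infinity>"
    using n gagliardo_sq_test_function_finite[OF \<phi>(1)[of n] s]
    by (auto simp: ennreal_mult_less_top intro: order.strict_trans)
  finally show ?thesis by simp
qed

section \<open>Hoelder and Taylor inequalities\<close>

lemma powr_Young:
  fixes a b :: real
  assumes "0 \<le> \<alpha>" "0 \<le> \<beta>" "\<alpha> + \<beta> = 1" "0 \<le> a" "0 \<le> b"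
  shows "a powr \<alpha> * b powr \<beta> \<le> \<alpha> * a + \<beta> * b"
proof (cases "a = 0 \<or> b = 0")
  case True
  then show ?thesis using assms by auto
next
  case False
  then show ?thesis using assms by (intro Youngs_inequality_0) auto
qed

lemma powr_Young3:
  fixes a b c :: real
  assumes "0 \<le> \<alpha>" "0 \<le> \<beta>" "0 \<le> \<gamma>" "\<alpha> + \<beta> + \<gamma> = 1" "0 < \<alpha>" "0 \<le> a" "0 \<le> b" "0 \<le> c"
  shows "a powr \<alpha> * b powr \<beta> * c powr \<gamma> \<le> \<alpha> * a + \<beta> * b + \<gamma> * c"
proof (cases "\<gamma> = 1")
  case False
  define \<theta> where "\<theta> = \<alpha> + \<beta>"
  have \<theta>: "\<theta> > 0" using assms by (auto simp: \<theta>_def)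
  have 1: "a powr (\<alpha> / \<theta>) * b powr (\<beta> / \<theta>) \<le> \<alpha> / \<theta> * a + \<beta> / \<theta> * b"
    using assms \<theta> by (intro powr_Young) (auto simp: \<theta>_def add_divide_distrib[symmetric])
  have "a powr \<alpha> * b powr \<beta> * c powr \<gamma> = (a powr (\<alpha> / \<theta>) * b powr (\<beta> / \<theta>)) powr \<theta> * c powr \<gamma>"
    using \<theta> by (simp add: powr_mult powr_powr)
  also have "\<dots> \<le> \<theta> * (a powr (\<alpha> / \<theta>) * b powr (\<beta> / \<theta>)) + \<gamma> * c"
    using assms \<theta> by (intro powr_Young) (auto simp: \<theta>_def)
  also have "\<dots> \<le> \<theta> * (\<alpha> / \<theta> * a + \<beta> / \<theta> * b) + \<gamma> * c"
    using 1 \<theta> by (intro add_right_mono mult_left_mono) auto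
  also have "\<dots> = \<alpha> * a + \<beta> * b + \<gamma> * c"
    using \<theta> by (simp add: field_simps)
  finally show ?thesis .
qed (use assms in auto)

text \<open>
  The exponents sum to one, so both sides are homogeneous in each function separately. Integrability is the
  weighted arithmetic-geometric mean inequality applied pointwise.
\<close>

lemma Holder3:
  fixes f g k :: "'b \<Rightarrow> real"
  assumes exps: "0 < \<alpha>" "0 < \<beta>" "0 < \<gamma>" "\<alpha> + \<beta> + \<gamma> = 1"
    and int: "integrable M f" "integrable M g" "integrable M k"
    and nonneg: "\<And>x. 0 \<le> f x" "\<And>x. 0 \<le> g x" "\<And>x. 0 \<le> k x"
  shows "integrable M (\<lambda>x. f x powr \<alpha> * g x powr \<beta> * k x powr \<gamma>)" (is ?int)
    and "(\<integral>x. f x powr \<alpha> * g x powr \<beta> * k x powr \<gamma> \<partial>M) \<le>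
      (\<integral>x. f x \<partial>M) powr \<alpha> * (\<integral>x. g x \<partial>M) powr \<beta> * (\<integral>x. k x \<partial>M) powr \<gamma>" (is ?le)
proof -
  note [measurable] = borel_measurable_integrable[OF int(1)] borel_measurable_integrable[OF int(2)]
    borel_measurable_integrable[OF int(3)]
  let ?P = "\<lambda>x. f x powr \<alpha> * g x powr \<beta> * k x powr \<gamma>"
  have meas: "?P \<in> borel_measurable M" by measurable
  show ?int
  proof (rule Bochner_Integration.integrable_bound[OF _ meas])
    show "integrable M (\<lambda>x. \<alpha> * f x + \<beta> * g x + \<gamma> * k x)" using int by auto
    show "AE x in M. norm (?P x) \<le> norm (\<alpha> * f x + \<beta> * g x + \<gamma> * k x)"
      using exps nonneg powr_Young3[of \<alpha> \<beta> \<gamma>] by (auto intro!: AE_I2)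
  qed
  let ?F = "\<integral>x. f x \<partial>M" and ?G = "\<integral>x. g x \<partial>M" and ?K = "\<integral>x. k x \<partial>M"
  have FGK: "0 \<le> ?F" "0 \<le> ?G" "0 \<le> ?K" using nonneg by (auto intro: integral_nonneg)
  have zero: "(\<integral>x. ?P x \<partial>M) = 0" if "AE x in M. f x = 0 \<or> g x = 0 \<or> k x = 0"
    by (rule integral_eq_zero_AE) (use that in eventually_elim, auto)
  show ?le
  proof (cases "?F = 0 \<or> ?G = 0 \<or> ?K = 0")
    case True
    then have "AE x in M. f x = 0 \<or> g x = 0 \<or> k x = 0"
      using int nonneg
      by (auto simp: integral_nonneg_eq_0_iff_AE)
    from zero[OF this] show ?thesis by simp
  next
    case False
    then have pos: "0 < ?F" "0 < ?G" "0 < ?K" using FGK by auto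
    let ?c = "?F powr \<alpha> * ?G powr \<beta> * ?K powr \<gamma>"
    \<comment> \<open>After normalising the three integrals to 1, the claim is the integrated weighted
      arithmetic-geometric mean inequality.\<close>
    have pt: "?P x \<le> ?c * (\<alpha> * (f x / ?F) + \<beta> * (g x / ?G) + \<gamma> * (k x / ?K))" for x
    proof -
      have "?P x = ?c * ((f x / ?F) powr \<alpha> * (g x / ?G) powr \<beta> * (k x / ?K) powr \<gamma>)"
        using pos nonneg by (simp add: powr_divide)
      also have "\<dots> \<le> ?c * (\<alpha> * (f x / ?F) + \<beta> * (g x / ?G) + \<gamma> * (k x / ?K))"
        using exps pos nonneg by (intro mult_left_mono powr_Young3) auto
      finally show ?thesis .
    qed
    have "(\<integral>x. ?P x \<partial>M) \<le> (\<integral>x. ?c * (\<alpha> * (f x / ?F) + \<beta> * (g x / ?G) + \<gamma> * (k x / ?K)) \<partial>M)"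
      using \<open>?int\<close> int pt by (intro integral_mono) auto
    also have "\<dots> = ?c * (\<alpha> * (?F / ?F) + \<beta> * (?G / ?G) + \<gamma> * (?K / ?K))"
      using int by simp
    also have "\<dots> = ?c" using pos exps by simp
    finally show ?thesis .
  qed
qed

text \<open>
  The case of three functions in which the last two coincide and share the exponent \<open>\<beta>\<close>.
\<close>

lemma Holder2:
  fixes f g :: "'b \<Rightarrow> real"
  assumes exps: "0 < \<alpha>" "0 < \<beta>" "\<alpha> + \<beta> = 1"
    and int: "integrable M f" "integrable M g"
    and nonneg: "\<And>x. 0 \<le> f x" "\<And>x. 0 \<le> g x"
  shows "integrable M (\<lambda>x. f x powr \<alpha> * g x powr \<beta>)"
    and "(\<integral>x. f x powr \<alpha> * g x powr \<beta> \<partial>M) \<le> (\<integral>x. f x \<partial>M) powr \<alpha> * (\<integral>x. g x \<partial>M) powr \<beta>"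
proof -
  have eq: "g x powr (\<beta>/2) * g x powr (\<beta>/2) = g x powr \<beta>" for x
    by (simp flip: powr_add)
  have eq': "(\<integral>x. g x \<partial>M) powr (\<beta>/2) * (\<integral>x. g x \<partial>M) powr (\<beta>/2) = (\<integral>x. g x \<partial>M) powr \<beta>"
    by (simp flip: powr_add)
  note H = Holder3[of \<alpha> "\<beta>/2" "\<beta>/2" M f g g]
  show "integrable M (\<lambda>x. f x powr \<alpha> * g x powr \<beta>)"
    using H(1) assms by (simp add: mult.assoc eq)
  show "(\<integral>x. f x powr \<alpha> * g x powr \<beta> \<partial>M) \<le> (\<integral>x. f x \<partial>M) powr \<alpha> * (\<integral>x. g x \<partial>M) powr \<beta>"
    using H(2) assms by (simp add: mult.assoc eq eq')
qed

lemma abs_add_powr_le: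
  fixes a b :: real
  assumes "0 \<le> p"
  shows "\<bar>a + b\<bar> powr p \<le> 2 powr p * (\<bar>a\<bar> powr p + \<bar>b\<bar> powr p)"
proof -
  let ?m = "max \<bar>a\<bar> \<bar>b\<bar>"
  have "\<bar>a + b\<bar> powr p \<le> (2 * ?m) powr p"
    using assms by (intro powr_mono2) auto
  also have "\<dots> = 2 powr p * ?m powr p"
    by (rule powr_mult)
  also have "?m powr p \<le> \<bar>a\<bar> powr p + \<bar>b\<bar> powr p"
    by (auto simp: max_def)
  finally show ?thesis by simp
qed

text \<open>
  For \<open>\<bar>y\<bar> \<le> a / 2\<close> this is Taylor's formula of second order, whose intermediate point stays below
  \<open>2 a\<close>. For larger \<open>y\<close> each of the three terms on the left is dominated by \<open>\<bar>y\<bar> powr p\<close>. The constant adds up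
  what the two regimes need; only its independence of \<open>a\<close> and \<open>y\<close> matters later.
\<close>

lemma powr_Taylor_remainder:
  fixes a y p :: real
  assumes p: "2 < p"
  defines "C \<equiv> p * (p - 1) * 2 powr p + 3 powr p + 2 powr p + p * 2 powr p"
  assumes a: "0 < a"
  shows "\<bar>\<bar>a + y\<bar> powr p - a powr p - p * a powr (p - 1) * y\<bar>
    \<le> C * (a powr (p - 2) * y\<^sup>2 + \<bar>y\<bar> powr p)"
proof (cases "\<bar>y\<bar> \<le> a / 2")
  case True
  define diff where "diff m x = (if m = 0 then x powr p else if m = 1 then p * x powr (p - 1)
      else p * (p - 1) * x powr (p - 2))" for m :: nat and x :: real
  show ?thesis
  proof (cases "y = 0")
    case False
    have "\<exists>t. (if a + y < a then a + y < t \<and> t < a else a < t \<and> t < a + y) \<and>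
      (a + y) powr p = (\<Sum>m<2. diff m a / fact m * (a + y - a) ^ m) + diff 2 t / fact 2 * (a + y - a) ^ 2"
    proof (rule Taylor[where a = "a / 2" and b = "3 * a / 2"])
      show "\<forall>m t. m < 2 \<and> a / 2 \<le> t \<and> t \<le> 3 * a / 2 \<longrightarrow> DERIV (diff m) t :> diff (Suc m) t"
      proof (intro allI impI)
        fix m :: nat and t assume m: "m < 2 \<and> a / 2 \<le> t \<and> t \<le> 3 * a / 2"
        then have t: "t > 0" using a by auto
        have "m = 0 \<or> m = 1" using m by auto
        then show "DERIV (diff m) t :> diff (Suc m) t"
          unfolding diff_def using t by (auto intro!: derivative_eq_intros simp: algebra_simps)
      qed
    qed (use True False a in \<open>auto simp: diff_def fun_eq_iff abs_if split: if_splits\<close>)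
    then obtain \<xi> where \<xi>: "if a + y < a then a + y < \<xi> \<and> \<xi> < a else a < \<xi> \<and> \<xi> < a + y"
      "(a + y) powr p = (\<Sum>m<2. diff m a / fact m * y ^ m) + diff 2 \<xi> / fact 2 * y ^ 2"
      by auto
    have \<xi>': "0 < \<xi>" "\<xi> \<le> 2 * a" using \<xi>(1) True a by (auto split: if_splits)
    have ay: "\<bar>a + y\<bar> = a + y" using True a by auto
    have eq: "\<bar>a + y\<bar> powr p - a powr p - p * a powr (p - 1) * y = p * (p - 1) / 2 * \<xi> powr (p - 2) * y\<^sup>2"
      unfolding ay \<xi>(2) by (simp add: diff_def numeral_2_eq_2)
    have "p * (p - 1) / 2 * \<xi> powr (p - 2) * y\<^sup>2 \<le> p * (p - 1) * (2 * a) powr (p - 2) * y\<^sup>2"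
      using p \<xi>' by (intro mult_right_mono mult_mono powr_mono2) auto
    also have "\<dots> = p * (p - 1) * 2 powr (p - 2) * (a powr (p - 2) * y\<^sup>2)"
      using a by (simp add: powr_mult)
    also have "\<dots> \<le> C * (a powr (p - 2) * y\<^sup>2)"
    proof (rule mult_right_mono)
      have "p * (p - 1) * 2 powr (p - 2) \<le> p * (p - 1) * 2 powr p"
        using p by (intro mult_left_mono) auto
      then show "p * (p - 1) * 2 powr (p - 2) \<le> C"
        using p unfolding C_def by (smt (verit) powr_ge_zero mult_nonneg_nonneg)
    qed auto
    also have "\<dots> \<le> C * (a powr (p - 2) * y\<^sup>2 + \<bar>y\<bar> powr p)"
      using p by (intro mult_left_mono) (auto simp: C_def)
    finally show ?thesis unfolding eq using p by (simp add: abs_mult)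
  qed (use a p in \<open>auto simp: C_def\<close>)
next
  case False
  then have y: "a \<le> 2 * \<bar>y\<bar>" by auto
  let ?Y = "\<bar>y\<bar> powr p"
  have 1: "\<bar>a + y\<bar> powr p \<le> 3 powr p * ?Y"
  proof -
    have "\<bar>a + y\<bar> powr p \<le> (3 * \<bar>y\<bar>) powr p" using y a p by (intro powr_mono2) auto
    then show ?thesis by (simp add: powr_mult)
  qed
  have 2: "a powr p \<le> 2 powr p * ?Y"
  proof -
    have "a powr p \<le> (2 * \<bar>y\<bar>) powr p" using y a p by (intro powr_mono2) auto
    then show ?thesis by (simp add: powr_mult)
  qed
  have 3: "p * a powr (p - 1) * \<bar>y\<bar> \<le> p * 2 powr p * ?Y"
  proof -
    have "a powr (p - 1) \<le> (2 * \<bar>y\<bar>) powr (p - 1)" using y a p by (intro powr_mono2) auto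
    then have "p * a powr (p - 1) * \<bar>y\<bar> \<le> p * (2 * \<bar>y\<bar>) powr (p - 1) * \<bar>y\<bar>"
      using p by (intro mult_right_mono mult_left_mono) auto
    also have "\<dots> = p * 2 powr (p - 1) * (\<bar>y\<bar> powr (p - 1) * \<bar>y\<bar> powr 1)"
      by (simp add: powr_mult)
    also have "\<dots> = p * 2 powr (p - 1) * ?Y" by (subst powr_add[symmetric]) simp
    also have "\<dots> \<le> p * 2 powr p * ?Y"
      using p by (intro mult_right_mono mult_left_mono) auto
    finally show ?thesis .
  qed
  have "\<bar>\<bar>a + y\<bar> powr p - a powr p - p * a powr (p - 1) * y\<bar>
      \<le> \<bar>a + y\<bar> powr p + a powr p + p * a powr (p - 1) * \<bar>y\<bar>"
    using abs_triangle_ineq4[of "\<bar>a + y\<bar> powr p - a powr p" "p * a powr (p - 1) * y"]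
      abs_triangle_ineq4[of "\<bar>a + y\<bar> powr p" "a powr p"] p by (simp add: abs_mult)
  also have "\<dots> \<le> (3 powr p + 2 powr p + p * 2 powr p) * ?Y"
    using 1 2 3 by (simp add: distrib_right)
  also have "\<dots> \<le> C * ?Y"
    using p by (intro mult_right_mono) (auto simp: C_def)
  also have "\<dots> \<le> C * (a powr (p - 2) * y\<^sup>2 + ?Y)"
    using p by (intro mult_left_mono) (auto simp: C_def)
  finally show ?thesis .
qed

section \<open>Scaling invariance of the quadratic form and the critical integral\<close>

lemma gagliardo_form_self:
  fixes u :: "'a::euclidean_space \<Rightarrow> real"
  assumes "u \<in> borel_measurable lebesgue"
  shows "gagliardo_form s u u = enn2real (gagliardo_sq s u)"
proof -
  let ?k = "\<lambda>p. (u (fst p) - u (snd p))\<^sup>2 / norm (fst p - snd p :: 'a) powr (real DIM('a) + 2 * s)"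
  have "?k \<in> borel_measurable (lebesgue \<Otimes>\<^sub>M lebesgue)"
    using borel_measurable_gagliardo_kernel[OF assms, of "real DIM('a) + 2 * s"] by (simp add: case_prod_beta')
  then have "integral\<^sup>L (lebesgue \<Otimes>\<^sub>M lebesgue) ?k = enn2real (\<integral>\<^sup>+p. ennreal (?k p) \<partial>(lebesgue \<Otimes>\<^sub>M lebesgue))"
    by (intro integral_eq_nn_integral) auto
  then show ?thesis
    by (simp add: gagliardo_form_def gagliardo_sq_def case_prod_beta' power2_eq_square)
qed

lemma weighted_integral_eq:
  fixes g :: "'a::euclidean_space \<Rightarrow> real"
  assumes "g \<in> borel_measurable lebesgue" "\<And>x. 0 \<le> g x"
  shows "(\<integral>x. g x / norm x powr r \<partial>lebesgue) = enn2real (\<integral>\<^sup>+x. ennreal (g x / norm x powr r) \<partial>lebesgue)"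
  by (rule integral_eq_nn_integral) (use assms borel_measurable_weight in auto)

lemma norm_sq_eq:
  fixes u :: "'a::euclidean_space \<Rightarrow> real"
  assumes "u \<in> borel_measurable lebesgue"
  shows "norm_sq lam s u = enn2real (gagliardo_sq s u) -
    lam * enn2real (\<integral>\<^sup>+x. ennreal ((u x)\<^sup>2 / norm x powr (2 * s)) \<partial>lebesgue)"
proof -
  have "(\<lambda>x. (u x)\<^sup>2) \<in> borel_measurable lebesgue" using assms by measurable
  from weighted_integral_eq[OF this, of "2 * s"] show ?thesis
    by (simp add: norm_sq_def hardy_form_def gagliardo_form_self[OF assms] power2_eq_square)
qed

lemma norm_sq_cmult: "norm_sq lam s (\<lambda>x. k * u x) = k\<^sup>2 * norm_sq lam s u"
proof -
  have "gagliardo_form s (\<lambda>x. k * u x) (\<lambda>x. k * u x) = k\<^sup>2 * gagliardo_form s u u"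
  proof -
    have eq: "(k * u x - k * u y) * (k * u x - k * u y) / r = k\<^sup>2 * ((u x - u y) * (u x - u y) / r)" for x y r
      by (simp add: power2_eq_square field_simps)
    show ?thesis unfolding gagliardo_form_def case_prod_beta' eq by (rule integral_mult_right_zero)
  qed
  moreover have "(\<integral>x. k * u x * (k * u x) / norm x powr (2 * s) \<partial>lebesgue) =
      k\<^sup>2 * (\<integral>x. u x * u x / norm x powr (2 * s) \<partial>lebesgue)"
  proof -
    have eq: "k * u x * (k * u x) / r = k\<^sup>2 * (u x * u x / r)" for x r
      by (simp add: power2_eq_square)
    show ?thesis unfolding eq by (rule integral_mult_right_zero)
  qed
  ultimately show ?thesis by (simp add: norm_sq_def hardy_form_def algebra_simps)
qed

lemma crit_integral_nonneg: "0 \<le> crit_integral s t u"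
  unfolding crit_integral_def by (rule Bochner_Integration.integral_nonneg) auto

lemma crit_integral_cmult:
  fixes u :: "'a::euclidean_space \<Rightarrow> real"
  shows "crit_integral s t (\<lambda>x. k * u x) = \<bar>k\<bar> powr crit_exp TYPE('a) s t * crit_integral s t u"
proof -
  have eq: "\<bar>k * u x\<bar> powr crit_exp TYPE('a) s t / r =
      \<bar>k\<bar> powr crit_exp TYPE('a) s t * (\<bar>u x\<bar> powr crit_exp TYPE('a) s t / r)" for x r
    by (simp add: abs_mult powr_mult)
  show ?thesis unfolding crit_integral_def eq by (rule integral_mult_right_zero)
qed

lemma rescale_eq_scaleR:
  fixes u :: "'a::euclidean_space \<Rightarrow> real"
  shows "rescale s u \<mu> = (\<lambda>x. \<mu> powr (- (real DIM('a) - 2 * s) / 2) * u (inverse \<mu> *\<^sub>R x))"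
  by (simp add: rescale_def)

lemma rescale_inverse:
  assumes "0 < \<mu>"
  shows "rescale s (rescale s u (inverse \<mu>)) \<mu> = u"
  using assms by (simp add: rescale_def fun_eq_iff powr_minus inverse_powr powr_divide field_simps)

lemma rescale_add: "rescale s (\<lambda>x. u x + w x) \<mu> = (\<lambda>x. rescale s u \<mu> x + rescale s w \<mu> x)"
  by (simp add: rescale_def distrib_left)

lemma rescale_borel: "u \<in> borel_measurable lebesgue \<Longrightarrow> rescale s u \<mu> \<in> borel_measurable lebesgue"
  unfolding rescale_eq_scaleR using measurable_compose_scaleR[of u borel "inverse \<mu>"] by measurable

lemma rescale_D_space: "u \<in> D_space s \<Longrightarrow> 0 < \<mu> \<Longrightarrow> rescale s u \<mu> \<in> D_space s"
  unfolding rescale_eq_scaleR by (rule D_space_scaleR) auto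

text \<open>
  The amplitude factor of \<open>rescale\<close> is exactly what compensates the factor \<open>c powr (2 s - N)\<close> that a
  dilation produces in the Gagliardo energy and in the Hardy integral alike.
\<close>

lemma norm_sq_rescale:
  fixes u :: "'a::euclidean_space \<Rightarrow> real"
  assumes u: "u \<in> borel_measurable lebesgue" and \<mu>: "0 < \<mu>"
  shows "norm_sq lam s (rescale s u \<mu>) = norm_sq lam s u"
proof -
  let ?k = "\<mu> powr (- (real DIM('a) - 2 * s) / 2)" and ?c = "inverse \<mu>"
  have k2: "?k\<^sup>2 * ?c powr (2 * s - real DIM('a)) = 1"
  proof -
    have "?k\<^sup>2 = \<mu> powr (2 * s - real DIM('a))"
      by (simp add: power2_eq_square flip: powr_add)
    moreover have "?c powr (2 * s - real DIM('a)) = inverse (\<mu> powr (2 * s - real DIM('a)))"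
      using \<mu> by (simp add: inverse_powr)
    ultimately show ?thesis using \<mu> by simp
  qed
  have g: "gagliardo_sq s (rescale s u \<mu>) = gagliardo_sq s u"
    unfolding rescale_eq_scaleR using gagliardo_sq_scaleR[OF u, of ?c s ?k] \<mu> k2 by simp
  have "(\<integral>\<^sup>+x. ennreal ((rescale s u \<mu> x)\<^sup>2 / norm x powr (2 * s)) \<partial>lebesgue) =
      (\<integral>\<^sup>+x. ennreal ((u x)\<^sup>2 / norm x powr (2 * s)) \<partial>lebesgue)" (is "?l = ?r")
  proof -
    have m: "(\<lambda>x. ?k\<^sup>2 * (u x)\<^sup>2) \<in> borel_measurable lebesgue" using u by measurable
    have mu: "(\<lambda>x. ennreal ((u x)\<^sup>2 / norm x powr (2 * s))) \<in> borel_measurable lebesgue"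
      using borel_measurable_weight[of "\<lambda>x. (u x)\<^sup>2" "2 * s"] u by measurable
    have "?l = ennreal (?c powr (2 * s - real DIM('a))) *
        (\<integral>\<^sup>+x. ennreal (?k\<^sup>2 * (u x)\<^sup>2 / norm x powr (2 * s)) \<partial>lebesgue)"
      using weighted_nn_integral_scaleR[OF m, of ?c "2 * s"] \<mu>
      by (simp add: rescale_eq_scaleR power_mult_distrib)
    also have "(\<integral>\<^sup>+x. ennreal (?k\<^sup>2 * (u x)\<^sup>2 / norm x powr (2 * s)) \<partial>lebesgue) = ennreal (?k\<^sup>2) * ?r"
      by (subst nn_integral_cmult[OF mu, symmetric]) (simp add: ennreal_mult'[symmetric])
    also have "ennreal (?c powr (2 * s - real DIM('a))) * (ennreal (?k\<^sup>2) * ?r) =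
        ennreal (?k\<^sup>2 * ?c powr (2 * s - real DIM('a))) * ?r"
      by (simp add: ennreal_mult mult_ac)
    finally show ?thesis unfolding k2 by simp
  qed
  with g show ?thesis
    using norm_sq_eq[OF u] norm_sq_eq[OF rescale_borel[OF u]] by simp
qed

text \<open>
  This is the property that singles out the critical exponent: \<open>p (N - 2 s) / 2 = N - t\<close>.
\<close>

lemma crit_integral_rescale:
  fixes u :: "'a::euclidean_space \<Rightarrow> real"
  assumes u: "u \<in> borel_measurable lebesgue" and \<mu>: "0 < \<mu>" and N: "2 * s < real DIM('a)"
  shows "crit_integral s t (rescale s u \<mu>) = crit_integral s t u"
proof -
  let ?p = "crit_exp TYPE('a) s t"
  let ?k = "\<mu> powr (- (real DIM('a) - 2 * s) / 2)" and ?c = "inverse \<mu>"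
  have kp: "?k powr ?p * ?c powr (t - real DIM('a)) = 1"
  proof -
    have "- (real DIM('a) - 2 * s) / 2 * ?p = t - real DIM('a)"
    proof -
      have "- d / 2 * (2 * (real DIM('a) - t) / d) = t - real DIM('a)" if "d \<noteq> 0" for d
        using that by (simp add: field_simps)
      from this[of "real DIM('a) - 2 * s"] N show ?thesis by (simp add: crit_exp_def)
    qed
    then have "?k powr ?p = \<mu> powr (t - real DIM('a))"
      by (simp only: powr_powr)
    moreover have "?c powr (t - real DIM('a)) = inverse (\<mu> powr (t - real DIM('a)))"
      using \<mu> by (simp add: inverse_powr)
    ultimately show ?thesis using \<mu> by simp
  qed
  have m: "(\<lambda>x. ?k powr ?p * \<bar>u x\<bar> powr ?p) \<in> borel_measurable lebesgue" using u by measurable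
  have mu: "(\<lambda>x. \<bar>u x\<bar> powr ?p) \<in> borel_measurable lebesgue" using u by measurable
  have mr: "(\<lambda>x. \<bar>rescale s u \<mu> x\<bar> powr ?p) \<in> borel_measurable lebesgue"
    using rescale_borel[OF u, of s \<mu>] by measurable
  have mu': "(\<lambda>x. ennreal (\<bar>u x\<bar> powr ?p / norm x powr t)) \<in> borel_measurable lebesgue"
    using borel_measurable_weight[OF mu, of t] by measurable
  let ?r = "\<integral>\<^sup>+x. ennreal (\<bar>u x\<bar> powr ?p / norm x powr t) \<partial>lebesgue"
  have "(\<integral>\<^sup>+x. ennreal (\<bar>rescale s u \<mu> x\<bar> powr ?p / norm x powr t) \<partial>lebesgue) =
      ennreal (?c powr (t - real DIM('a))) *
      (\<integral>\<^sup>+x. ennreal (?k powr ?p * \<bar>u x\<bar> powr ?p / norm x powr t) \<partial>lebesgue)"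
    using weighted_nn_integral_scaleR[OF m, of ?c t] \<mu>
    by (simp add: rescale_eq_scaleR abs_mult powr_mult)
  also have "(\<integral>\<^sup>+x. ennreal (?k powr ?p * \<bar>u x\<bar> powr ?p / norm x powr t) \<partial>lebesgue) = ennreal (?k powr ?p) * ?r"
    by (subst nn_integral_cmult[OF mu', symmetric]) (simp add: ennreal_mult'[symmetric])
  also have "ennreal (?c powr (t - real DIM('a))) * (ennreal (?k powr ?p) * ?r) =
      ennreal (?k powr ?p * ?c powr (t - real DIM('a))) * ?r"
    by (simp add: ennreal_mult mult_ac)
  finally show ?thesis
    unfolding crit_integral_def weighted_integral_eq[OF mr powr_ge_zero] weighted_integral_eq[OF mu powr_ge_zero] kp
    by simp
qed

lemma AE_weighted_zero_iff:
  fixes u :: "'a::euclidean_space \<Rightarrow> real"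
  assumes "integrable lebesgue (\<lambda>x. g (u x) / norm x powr r)" "\<And>y. 0 \<le> g y" "\<And>y. g y = 0 \<longleftrightarrow> y = 0"
  shows "(\<integral>x. g (u x) / norm x powr r \<partial>lebesgue) = 0 \<longleftrightarrow> (AE x in lebesgue. u x = 0)"
proof -
  have "(\<integral>x. g (u x) / norm x powr r \<partial>lebesgue) = 0 \<longleftrightarrow> (AE x in lebesgue. g (u x) / norm x powr r = 0)"
    using assms by (intro integral_nonneg_eq_0_iff_AE) auto
  also have "\<dots> \<longleftrightarrow> (AE x in lebesgue. u x = 0)"
    using AE_lebesgue_nonzero[where 'a='a] assms(3) by (intro eventually_subst) (auto elim!: eventually_mono)
  finally show ?thesis .
qed

text \<open>
  The strict gap between \<open>lam\<close> and \<open>c\<close> is what makes the form coercive. If the set of admissible constants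
  were unbounded, its supremum would be an unspecified real; a constant above \<open>lam\<close> exists in that case, too.
\<close>

lemma hardy_inequality_below_constant:
  assumes "0 \<le> lam" "lam < hardy_constant TYPE('a::euclidean_space) s"
  shows "\<exists>c>lam. \<forall>u \<in> (D_space s :: ('a \<Rightarrow> real) set).
    ennreal c * (\<integral>\<^sup>+x. ennreal ((u x)\<^sup>2 / norm x powr (2 * s)) \<partial>lebesgue) \<le> gagliardo_sq s u"
proof -
  let ?X = "{c. 0 \<le> c \<and> (\<forall>u \<in> (D_space s :: ('a \<Rightarrow> real) set).
     ennreal c * (\<integral>\<^sup>+x. ennreal ((u x)\<^sup>2 / norm x powr (2 * s)) \<partial>lebesgue) \<le> gagliardo_sq s u)}"
  have ne: "?X \<noteq> {}" by (auto intro!: exI[of _ 0])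
  have lt: "lam < Sup ?X" using assms(2) by (simp add: hardy_constant_def)
  have "\<exists>c\<in>?X. lam < c"
  proof (cases "bdd_above ?X")
    case True
    then show ?thesis using less_cSup_iff[OF ne True] lt by blast
  next
    case False
    then show ?thesis unfolding bdd_above_def by (meson linorder_le_less_linear)
  qed
  then show ?thesis by auto
qed

section \<open>The Hardy-Sobolev inequality carried by a normalized minimizer\<close>

text \<open>
  The data of one uncoupled equation. The exponent \<open>p\<close> and the best constant \<open>S\<close> are parameters tied down by
  equations, so that two instances with different Hardy parameters share the same \<open>p\<close>.
\<close>

locale hardy_sobolev =
  fixes s t lam p S :: real and z :: "'a::euclidean_space \<Rightarrow> real"
  assumes p_eq: "p = crit_exp TYPE('a) s t" and S_eq: "S = S_const TYPE('a) lam t s"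
    and s: "0 < s" "s < 1" "2 * s < real DIM('a)"
    and t: "0 < t" "t < 2 * s"
    and lam: "0 < lam" "lam < hardy_constant TYPE('a) s"
    and minimizer: "normalized_minimizer lam t s z"
begin

abbreviation nrm :: "('a \<Rightarrow> real) \<Rightarrow> real" where "nrm \<equiv> norm_sq lam s"
abbreviation crit :: "('a \<Rightarrow> real) \<Rightarrow> real" where "crit \<equiv> crit_integral s t"

lemma p_gt_2: "2 < p"
  using s t by (simp add: p_eq crit_exp_def field_simps)

lemma crit_eq: "crit u = (\<integral>x. \<bar>u x\<bar> powr p / norm x powr t \<partial>lebesgue)"
  by (simp add: crit_integral_def p_eq)

lemma S_quotient_eq: "S_quotient lam t s u = nrm u / crit u powr (2 / p)"
  by (simp add: S_quotient_def p_eq)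

lemma D_space_integrable:
  fixes u :: "'a \<Rightarrow> real"
  assumes u: "u \<in> D_space s"
  shows "integrable (lebesgue \<Otimes>\<^sub>M lebesgue) (\<lambda>p. (u (fst p) - u (snd p))\<^sup>2 /
      norm (fst p - snd p) powr (real DIM('a) + 2 * s))"
    and "integrable lebesgue (\<lambda>x. (u x)\<^sup>2 / norm x powr (2 * s))"
proof -
  have um: "u \<in> borel_measurable lebesgue" by (rule D_space_borel[OF u])
  have g: "gagliardo_sq s u < \<infinity>" by (rule gagliardo_sq_D_space_finite[OF u s(1,2)])
  show "integrable (lebesgue \<Otimes>\<^sub>M lebesgue) (\<lambda>p. (u (fst p) - u (snd p))\<^sup>2 /
      norm (fst p - snd p) powr (real DIM('a) + 2 * s))"
    using borel_measurable_gagliardo_kernel[OF um, of "real DIM('a) + 2 * s"] g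
    by (intro integrableI_nonneg) (auto simp: case_prod_beta' gagliardo_sq_def)
  obtain c where c: "lam < c" "\<And>u :: 'a \<Rightarrow> real. u \<in> D_space s \<Longrightarrow>
      ennreal c * (\<integral>\<^sup>+x. ennreal ((u x)\<^sup>2 / norm x powr (2 * s)) \<partial>lebesgue) \<le> gagliardo_sq s u"
    using hardy_inequality_below_constant[OF less_imp_le[OF lam(1)] lam(2)] by blast
  from c(2)[OF u] g have "ennreal c * (\<integral>\<^sup>+x. ennreal ((u x)\<^sup>2 / norm x powr (2 * s)) \<partial>lebesgue) < \<infinity>"
    by (rule order.strict_trans1)
  then have "(\<integral>\<^sup>+x. ennreal ((u x)\<^sup>2 / norm x powr (2 * s)) \<partial>lebesgue) < \<infinity>"
    using c(1) lam by (auto simp: ennreal_mult_less_top)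
  moreover have "(\<lambda>x. (u x)\<^sup>2) \<in> borel_measurable lebesgue" using um by measurable
  ultimately show "integrable lebesgue (\<lambda>x. (u x)\<^sup>2 / norm x powr (2 * s))"
    using borel_measurable_weight by (intro integrableI_nonneg) auto
qed

lemma norm_sq_coercive:
  "\<exists>\<kappa>>0. \<forall>u\<in>D_space s. \<kappa> * (\<integral>x. (u x)\<^sup>2 / norm x powr (2 * s) \<partial>lebesgue) \<le> nrm u"
proof -
  obtain c where c: "lam < c" "\<And>u :: 'a \<Rightarrow> real. u \<in> D_space s \<Longrightarrow>
      ennreal c * (\<integral>\<^sup>+x. ennreal ((u x)\<^sup>2 / norm x powr (2 * s)) \<partial>lebesgue) \<le> gagliardo_sq s u"
    using hardy_inequality_below_constant[OF less_imp_le[OF lam(1)] lam(2)] by blast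
  show ?thesis
  proof (intro exI[of _ "c - lam"] conjI ballI)
    fix u :: "'a \<Rightarrow> real" assume u: "u \<in> D_space s"
    have um: "u \<in> borel_measurable lebesgue" by (rule D_space_borel[OF u])
    let ?V = "\<integral>\<^sup>+x. ennreal ((u x)\<^sup>2 / norm x powr (2 * s)) \<partial>lebesgue"
    have u2: "(\<lambda>x. (u x)\<^sup>2) \<in> borel_measurable lebesgue" using um by measurable
    have "enn2real (ennreal c * ?V) \<le> enn2real (gagliardo_sq s u)"
      using c(2)[OF u] gagliardo_sq_D_space_finite[OF u s(1,2)] by (intro enn2real_mono) auto
    then have "c * enn2real ?V \<le> enn2real (gagliardo_sq s u)"
      using c(1) lam by (simp add: enn2real_mult)
    then show "(c - lam) * (\<integral>x. (u x)\<^sup>2 / norm x powr (2 * s) \<partial>lebesgue) \<le> nrm u"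
      using norm_sq_eq[OF um] weighted_integral_eq[OF u2, of "2 * s"] by (simp add: left_diff_distrib)
  qed (use c in simp)
qed

lemma norm_sq_nonneg: "u \<in> D_space s \<Longrightarrow> 0 \<le> nrm u"
proof -
  assume u: "u \<in> D_space s"
  obtain \<kappa> where \<kappa>: "0 < \<kappa>"
    "\<And>u. u \<in> D_space s \<Longrightarrow> \<kappa> * (\<integral>x. (u x)\<^sup>2 / norm x powr (2 * s) \<partial>lebesgue) \<le> nrm u"
    using norm_sq_coercive by blast
  have "0 \<le> (\<integral>x. (u x)\<^sup>2 / norm x powr (2 * s) \<partial>lebesgue)" by (rule Bochner_Integration.integral_nonneg) auto
  then show "0 \<le> nrm u" using \<kappa>(1) \<kappa>(2)[OF u] by (smt (verit) mult_nonneg_nonneg)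
qed

lemma norm_sq_pos: "u \<in> D_space s \<Longrightarrow> \<not> (AE x in lebesgue. u x = 0) \<Longrightarrow> 0 < nrm u"
proof -
  assume u: "u \<in> D_space s" and nz: "\<not> (AE x in lebesgue. u x = 0)"
  obtain \<kappa> where \<kappa>: "0 < \<kappa>"
    "\<And>u. u \<in> D_space s \<Longrightarrow> \<kappa> * (\<integral>x. (u x)\<^sup>2 / norm x powr (2 * s) \<partial>lebesgue) \<le> nrm u"
    using norm_sq_coercive by blast
  have "(\<integral>x. (u x)\<^sup>2 / norm x powr (2 * s) \<partial>lebesgue) \<noteq> 0"
    using AE_weighted_zero_iff[of "\<lambda>y. y\<^sup>2" u "2 * s"] D_space_integrable(2)[OF u] nz by auto
  moreover have "0 \<le> (\<integral>x. (u x)\<^sup>2 / norm x powr (2 * s) \<partial>lebesgue)" by (rule Bochner_Integration.integral_nonneg) auto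
  ultimately show "0 < nrm u" using \<kappa>(1) \<kappa>(2)[OF u] by (smt (verit) mult_pos_pos)
qed

text \<open>
  Expanding the square needs integrability of the mixed terms, which are dominated by the sum of the two pure ones.
\<close>

lemma norm_sq_add:
  assumes u: "u \<in> D_space s" and w: "w \<in> D_space s"
  shows "nrm (\<lambda>x. u x + w x) = nrm u + 2 * hardy_form lam s u w + nrm w"
proof -
  note um = D_space_borel[OF u] and wm = D_space_borel[OF w]
  let ?r = "real DIM('a) + 2 * s"
  let ?d = "\<lambda>u p. u (fst p) - u (snd p :: 'a) :: real" and ?n = "\<lambda>p. norm (fst p - snd p :: 'a) powr ?r"
  have ab: "\<bar>a * b\<bar> \<le> a\<^sup>2 + b\<^sup>2" for a b :: real
  proof -
    have "2 * (\<bar>a\<bar> * \<bar>b\<bar>) \<le> a\<^sup>2 + b\<^sup>2"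
      using sum_squares_bound[of "\<bar>a\<bar>" "\<bar>b\<bar>"] by (simp add: mult.assoc)
    moreover have "0 \<le> \<bar>a\<bar> * \<bar>b\<bar>" by simp
    ultimately show ?thesis unfolding abs_mult by linarith
  qed
  have quot: "\<bar>a * b / r\<bar> \<le> a\<^sup>2 / r + b\<^sup>2 / r" if "0 \<le> r" for a b r :: real
    using divide_right_mono[OF ab[of a b] that] that by (simp add: abs_divide add_divide_distrib)
  have square: "(a + b) * (a + b) / r = a * a / r + 2 * (a * b / r) + b * b / r" for a b r :: real
  proof -
    have "(a + b) * (a + b) = a * a + 2 * (a * b) + b * b" by algebra
    then show ?thesis by (simp add: add_divide_distrib)
  qed
  have int: "integrable (lebesgue \<Otimes>\<^sub>M lebesgue) (\<lambda>p. ?d u p * ?d u p / ?n p)"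
      "integrable (lebesgue \<Otimes>\<^sub>M lebesgue) (\<lambda>p. ?d w p * ?d w p / ?n p)"
    using D_space_integrable(1)[OF u] D_space_integrable(1)[OF w] by (simp_all add: power2_eq_square)
  have cross: "integrable (lebesgue \<Otimes>\<^sub>M lebesgue) (\<lambda>p. ?d u p * ?d w p / ?n p)"
  proof (rule Bochner_Integration.integrable_bound)
    show "integrable (lebesgue \<Otimes>\<^sub>M lebesgue) (\<lambda>p. (?d u p)\<^sup>2 / ?n p + (?d w p)\<^sup>2 / ?n p)"
      using int by (simp add: power2_eq_square)
    show "(\<lambda>p. ?d u p * ?d w p / ?n p) \<in> borel_measurable (lebesgue \<Otimes>\<^sub>M lebesgue)"
      using borel_measurable_difference_kernel[OF um wm, of ?r] by (simp add: case_prod_beta')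
    show "AE p in lebesgue \<Otimes>\<^sub>M lebesgue. norm (?d u p * ?d w p / ?n p) \<le> norm ((?d u p)\<^sup>2 / ?n p + (?d w p)\<^sup>2 / ?n p)"
    proof (rule AE_I2)
      fix p :: "'a \<times> 'a"
      show "norm (?d u p * ?d w p / ?n p) \<le> norm ((?d u p)\<^sup>2 / ?n p + (?d w p)\<^sup>2 / ?n p)"
        using quot[of "?n p" "?d u p" "?d w p"] by simp
    qed
  qed
  have int': "integrable lebesgue (\<lambda>x. u x * u x / norm x powr (2 * s))"
      "integrable lebesgue (\<lambda>x. w x * w x / norm x powr (2 * s))"
    using D_space_integrable(2)[OF u] D_space_integrable(2)[OF w] by (simp_all add: power2_eq_square)
  have cross': "integrable lebesgue (\<lambda>x. u x * w x / norm x powr (2 * s))"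
  proof (rule Bochner_Integration.integrable_bound)
    show "integrable lebesgue (\<lambda>x. (u x)\<^sup>2 / norm x powr (2 * s) + (w x)\<^sup>2 / norm x powr (2 * s))"
      using int' by (simp add: power2_eq_square)
    show "(\<lambda>x. u x * w x / norm x powr (2 * s)) \<in> borel_measurable lebesgue"
      using um wm by (intro borel_measurable_weight) measurable
    show "AE x in lebesgue. norm (u x * w x / norm x powr (2 * s)) \<le>
        norm ((u x)\<^sup>2 / norm x powr (2 * s) + (w x)\<^sup>2 / norm x powr (2 * s))"
    proof (rule AE_I2)
      fix x :: 'a
      show "norm (u x * w x / norm x powr (2 * s)) \<le> norm ((u x)\<^sup>2 / norm x powr (2 * s) + (w x)\<^sup>2 / norm x powr (2 * s))"
        using quot[of "norm x powr (2 * s)" "u x" "w x"] by simp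
    qed
  qed
  have "gagliardo_form s (\<lambda>x. u x + w x) (\<lambda>x. u x + w x) =
      (\<integral>p. ?d u p * ?d u p / ?n p + 2 * (?d u p * ?d w p / ?n p) + ?d w p * ?d w p / ?n p \<partial>(lebesgue \<Otimes>\<^sub>M lebesgue))"
    unfolding gagliardo_form_def case_prod_beta' square[symmetric]
    by (intro Bochner_Integration.integral_cong refl) (simp add: add_diff_add)
  also have "\<dots> = gagliardo_form s u u + 2 * gagliardo_form s u w + gagliardo_form s w w"
    unfolding gagliardo_form_def case_prod_beta' using int cross by (simp del: times_divide_eq_right)
  finally have G: "gagliardo_form s (\<lambda>x. u x + w x) (\<lambda>x. u x + w x) =
    gagliardo_form s u u + 2 * gagliardo_form s u w + gagliardo_form s w w" .
  have "(\<integral>x. (u x + w x) * (u x + w x) / norm x powr (2 * s) \<partial>lebesgue) =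
    (\<integral>x. u x * u x / norm x powr (2 * s) + 2 * (u x * w x / norm x powr (2 * s)) + w x * w x / norm x powr (2 * s) \<partial>lebesgue)"
    unfolding square ..
  also have "\<dots> = (\<integral>x. u x * u x / norm x powr (2 * s) \<partial>lebesgue) +
    2 * (\<integral>x. u x * w x / norm x powr (2 * s) \<partial>lebesgue) + (\<integral>x. w x * w x / norm x powr (2 * s) \<partial>lebesgue)"
    using int' cross' by (simp del: times_divide_eq_right)
  finally show ?thesis unfolding norm_sq_def hardy_form_def G by (simp add: algebra_simps)
qed

lemma z_D_space: "z \<in> D_space s"
  and z_pos: "\<And>x. x \<noteq> 0 \<Longrightarrow> 0 < z x"
  and z_quotient: "S_quotient lam t s z = S"
  and z_equation: "\<phi> \<in> D_space s \<Longrightarrow> hardy_form lam s z \<phi> =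
     (\<integral>x. z x powr (p - 1) * \<phi> x / norm x powr t \<partial>lebesgue)"
  using minimizer by (auto simp: normalized_minimizer_def solves_uncoupled_def p_eq S_eq)

lemma z_nonzero: "\<not> (AE x in lebesgue. z x = 0)"
proof
  assume "AE x in lebesgue. z x = 0"
  with AE_lebesgue_nonzero have "AE x::'a in lebesgue. False"
    by eventually_elim (use z_pos in force)
  then have "(UNIV :: 'a set) \<in> null_sets lebesgue" by (subst AE_iff_null_sets) auto
  then show False by (simp add: null_sets_def)
qed

text \<open>
  Test the equation of \<open>z\<close> with \<open>z\<close> itself.
\<close>

lemma norm_sq_z: "nrm z = crit z"
proof -
  have "(\<integral>x. z x powr (p - 1) * z x / norm x powr t \<partial>lebesgue) = crit z"
    unfolding crit_eq
  proof (intro Bochner_Integration.integral_cong refl)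
    fix x :: 'a
    show "z x powr (p - 1) * z x / norm x powr t = \<bar>z x\<bar> powr p / norm x powr t"
    proof (cases "x = 0")
      case False
      have "z x powr (p - 1) * z x powr 1 = z x powr p" by (subst powr_add[symmetric]) simp
      with z_pos[OF False] show ?thesis by simp
    qed simp
  qed
  then show ?thesis using z_equation[OF z_D_space] by (simp add: norm_sq_def)
qed

lemma crit_z_pos: "0 < crit z"
  using norm_sq_pos[OF z_D_space z_nonzero] norm_sq_z by simp

lemma S_crit_z: "S = crit z powr (1 - 2 / p)"
  using z_quotient crit_z_pos by (simp add: S_quotient_eq norm_sq_z powr_diff)

text \<open>
  Coercivity makes \<open>nrm z\<close> positive, the equation transfers this to the critical integral, and minimality
  of \<open>z\<close> to the infimum \<open>S\<close>.
\<close>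

lemma S_pos: "0 < S"
  using S_crit_z crit_z_pos by simp

text \<open>
  As \<open>S\<close> is a positive lower bound of the quotient, the critical integral of a nonzero function cannot vanish.
  The Bochner integral of a nonintegrable function is \<open>0\<close>, so this also yields integrability.
\<close>

lemma hardy_sobolev_inequality:
  assumes u: "u \<in> D_space s"
  shows "S * crit u powr (2 / p) \<le> nrm u" (is ?ineq)
    and "integrable lebesgue (\<lambda>x. \<bar>u x\<bar> powr p / norm x powr t)" (is ?int)
    and "crit u = 0 \<longleftrightarrow> (AE x in lebesgue. u x = 0)" (is ?zero)
proof -
  have um: "(\<lambda>x. \<bar>u x\<bar> powr p / norm x powr t) \<in> borel_measurable lebesgue"
    using D_space_borel[OF u] by (intro borel_measurable_weight) measurable
  have "?ineq \<and> ?int \<and> ?zero"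
  proof (cases "AE x in lebesgue. u x = 0")
    case True
    then have ae: "AE x in lebesgue. \<bar>u x\<bar> powr p / norm x powr t = 0" by eventually_elim simp
    then have "crit u = 0" unfolding crit_eq by (rule integral_eq_zero_AE)
    moreover have ?int using integrable_cong_AE[OF um _ ae] by simp
    ultimately show ?thesis using norm_sq_nonneg[OF u] True by simp
  next
    case False
    let ?U = "{u :: 'a \<Rightarrow> real. u \<in> D_space s \<and> \<not> (AE x in lebesgue. u x = 0)}"
    have "bdd_below (S_quotient lam t s ` ?U)"
      by (rule bdd_belowI[of _ 0]) (auto simp: S_quotient_eq intro!: divide_nonneg_nonneg norm_sq_nonneg)
    then have le: "S \<le> S_quotient lam t s u"
      unfolding S_eq S_const_def using u False by (intro cInf_lower) auto
    have "crit u \<noteq> 0"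
    proof
      assume "crit u = 0"
      then show False using le S_pos by (simp add: S_quotient_eq)
    qed
    then have pos: "0 < crit u" using crit_integral_nonneg[of s t u] by simp
    have ?int using \<open>crit u \<noteq> 0\<close> not_integrable_integral_eq unfolding crit_eq by blast
    then show ?thesis using le pos False by (simp add: S_quotient_eq pos_le_divide_eq)
  qed
  then show ?ineq ?int ?zero by auto
qed

lemma crit_le_norm_sq:
  assumes u: "u \<in> D_space s" and r: "0 \<le> r"
  shows "crit u powr r \<le> (nrm u / S) powr (r * p / 2)"
proof -
  have "crit u powr (2 / p) \<le> nrm u / S"
    using hardy_sobolev_inequality(1)[OF u] S_pos by (simp add: field_simps)
  then have "(crit u powr (2 / p)) powr (r * p / 2) \<le> (nrm u / S) powr (r * p / 2)"
    using r p_gt_2 by (intro powr_mono2) auto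
  then show ?thesis using p_gt_2 by (simp add: powr_powr)
qed

definition energy :: "('a \<Rightarrow> real) \<Rightarrow> real" where
  "energy u = nrm u / 2 - crit u / p"

section \<open>Second order expansion of the energy at the minimizer\<close>

text \<open>
  By the equation, \<open>p\<close> times the bilinear form is the first variation of the critical integral at \<open>z\<close>. The
  pointwise Taylor remainder is integrated with Hoelder's inequality, which puts \<open>z powr (p - 2) * \<psi>\<^sup>2\<close> below a
  multiple of \<open>crit \<psi> powr (2 / p)\<close>.
\<close>

lemma crit_integral_expansion:
  "\<exists>C\<ge>0. \<forall>\<psi>\<in>D_space s.
    \<bar>crit (\<lambda>x. z x + \<psi> x) - crit z - p * hardy_form lam s z \<psi>\<bar> \<le> C * (crit \<psi> powr (2 / p) + crit \<psi>)"
proof -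
  obtain C where C: "0 \<le> C" "\<And>a y. 0 < a \<Longrightarrow> \<bar>\<bar>a + y\<bar> powr p - a powr p - p * a powr (p - 1) * y\<bar>
    \<le> C * (a powr (p - 2) * y\<^sup>2 + \<bar>y\<bar> powr p)"
    using powr_Taylor_remainder[OF p_gt_2] p_gt_2
    by (intro that[of "p * (p - 1) * 2 powr p + 3 powr p + 2 powr p + p * 2 powr p"]) auto
  let ?B = "crit z powr ((p - 2) / p)"
  show ?thesis
  proof (intro exI[of _ "C * (?B + 1)"] conjI ballI)
    show "0 \<le> C * (?B + 1)" using C by simp
    fix \<psi> :: "'a \<Rightarrow> real" assume \<psi>: "\<psi> \<in> D_space s"
    note [measurable] = D_space_borel[OF z_D_space] D_space_borel[OF \<psi>]
    let ?w = "\<lambda>x::'a. norm x powr t"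
    let ?f = "\<lambda>x. \<bar>z x\<bar> powr p / ?w x" and ?g = "\<lambda>x. \<bar>\<psi> x\<bar> powr p / ?w x"
    note fi = hardy_sobolev_inequality(2)[OF z_D_space] and gi = hardy_sobolev_inequality(2)[OF \<psi>]
    have p0: "0 < p" "p \<noteq> 0" using p_gt_2 by auto
    have wsplit: "?w x powr (1 - \<theta>) * ?w x powr \<theta> = ?w x" for x \<theta>
      by (simp flip: powr_add)
    have mix: "?f x powr (1 - r / p) * ?g x powr (r / p) = \<bar>z x\<bar> powr (p - r) * \<bar>\<psi> x\<bar> powr r / ?w x" for x r
    proof -
      have "?f x powr (1 - r / p) * ?g x powr (r / p) =
        \<bar>z x\<bar> powr (p - r) * \<bar>\<psi> x\<bar> powr r / (?w x powr (1 - r / p) * ?w x powr (r / p))"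
        using p0 by (simp add: powr_divide powr_powr right_diff_distrib)
      then show ?thesis unfolding wsplit .
    qed
    have H1: "integrable lebesgue (\<lambda>x. \<bar>z x\<bar> powr (p - 1) * \<bar>\<psi> x\<bar> powr 1 / ?w x)"
      using Holder2(1)[OF _ _ _ fi gi, of "1 - 1 / p" "1 / p"] p_gt_2 unfolding mix by simp
    have H2i: "integrable lebesgue (\<lambda>x. \<bar>z x\<bar> powr (p - 2) * \<bar>\<psi> x\<bar> powr 2 / ?w x)"
      using Holder2(1)[OF _ _ _ fi gi, of "1 - 2 / p" "2 / p"] p_gt_2 unfolding mix by simp
    have H2: "(\<integral>x. \<bar>z x\<bar> powr (p - 2) * \<bar>\<psi> x\<bar> powr 2 / ?w x \<partial>lebesgue) \<le> ?B * crit \<psi> powr (2 / p)"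
      using Holder2(2)[OF _ _ _ fi gi, of "1 - 2 / p" "2 / p"] p_gt_2 unfolding mix
      by (simp add: crit_eq diff_divide_distrib)
    let ?l = "\<lambda>x. z x powr (p - 1) * \<psi> x / ?w x"
    have li: "integrable lebesgue ?l"
    proof (rule Bochner_Integration.integrable_bound[OF H1])
      show "?l \<in> borel_measurable lebesgue" by (intro borel_measurable_weight) measurable
      show "AE x in lebesgue. norm (?l x) \<le> norm (\<bar>z x\<bar> powr (p - 1) * \<bar>\<psi> x\<bar> powr 1 / ?w x)"
        using AE_lebesgue_nonzero by eventually_elim (auto simp: abs_mult dest!: z_pos)
    qed
    let ?s = "\<lambda>x. \<bar>z x + \<psi> x\<bar> powr p / ?w x"
    have si: "integrable lebesgue ?s"
      using hardy_sobolev_inequality(2)[OF D_space_add[OF z_D_space \<psi>]] .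
    have diff: "crit (\<lambda>x. z x + \<psi> x) - crit z - p * hardy_form lam s z \<psi> = (\<integral>x. ?s x - ?f x - p * ?l x \<partial>lebesgue)"
      unfolding z_equation[OF \<psi>] crit_eq using si fi li by (simp del: times_divide_eq_right)
    have "\<bar>crit (\<lambda>x. z x + \<psi> x) - crit z - p * hardy_form lam s z \<psi>\<bar> \<le>
        (\<integral>x. \<bar>?s x - ?f x - p * ?l x\<bar> \<partial>lebesgue)"
      unfolding diff by (rule integral_abs_bound)
    also have "\<dots> \<le> (\<integral>x. C * (\<bar>z x\<bar> powr (p - 2) * \<bar>\<psi> x\<bar> powr 2 / ?w x + ?g x) \<partial>lebesgue)"
    proof (rule integral_mono)
      fix x :: 'a
      show "\<bar>?s x - ?f x - p * ?l x\<bar> \<le> C * (\<bar>z x\<bar> powr (p - 2) * \<bar>\<psi> x\<bar> powr 2 / ?w x + ?g x)"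
      proof (cases "x = 0")
        case False
        have "\<bar>?s x - ?f x - p * ?l x\<bar> =
          \<bar>\<bar>z x + \<psi> x\<bar> powr p - z x powr p - p * z x powr (p - 1) * \<psi> x\<bar> / ?w x"
          using z_pos[OF False] by (simp add: abs_divide diff_divide_distrib[symmetric] mult.assoc)
        also have "\<dots> \<le> C * (z x powr (p - 2) * (\<psi> x)\<^sup>2 + \<bar>\<psi> x\<bar> powr p) / ?w x"
          by (intro divide_right_mono C(2) z_pos False) simp
        also have "\<dots> = C * (\<bar>z x\<bar> powr (p - 2) * \<bar>\<psi> x\<bar> powr 2 / ?w x + ?g x)"
          using z_pos[OF False] by (simp add: add_divide_distrib powr_numeral flip: times_divide_eq_right)
        finally show ?thesis .
      qed simp
    next
      show "integrable lebesgue (\<lambda>x. \<bar>?s x - ?f x - p * ?l x\<bar>)"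
        by (intro integrable_abs Bochner_Integration.integrable_diff integrable_mult_right si fi li)
      show "integrable lebesgue (\<lambda>x. C * (\<bar>z x\<bar> powr (p - 2) * \<bar>\<psi> x\<bar> powr 2 / ?w x + ?g x))"
        by (intro integrable_mult_right Bochner_Integration.integrable_add H2i gi)
    qed
    also have "\<dots> = C * ((\<integral>x. \<bar>z x\<bar> powr (p - 2) * \<bar>\<psi> x\<bar> powr 2 / ?w x \<partial>lebesgue) + crit \<psi>)"
      using H2i gi by (simp add: crit_eq)
    also have "\<dots> \<le> C * (?B * crit \<psi> powr (2 / p) + crit \<psi>)"
      using C(1) H2 by (intro mult_left_mono) auto
    also have "\<dots> \<le> C * ((?B + 1) * (crit \<psi> powr (2 / p) + crit \<psi>))"
      using C(1) crit_integral_nonneg[of s t \<psi>] by (intro mult_left_mono) (auto simp: algebra_simps)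
    finally show "\<bar>crit (\<lambda>x. z x + \<psi> x) - crit z - p * hardy_form lam s z \<psi>\<bar> \<le>
        C * (?B + 1) * (crit \<psi> powr (2 / p) + crit \<psi>)" by (simp add: mult.assoc)
  qed
qed

lemma energy_rescale: "u \<in> borel_measurable lebesgue \<Longrightarrow> 0 < \<mu> \<Longrightarrow> energy (rescale s u \<mu>) = energy u"
  using s by (simp add: energy_def norm_sq_rescale crit_integral_rescale)

text \<open>
  For \<open>\<mu> = 1\<close> the linear parts of the quadratic form and of the critical integral cancel by the equation, and the
  Hardy-Sobolev inequality turns the remainder into powers of the norm. Every other \<open>\<mu>\<close> reduces to this one,
  with the same constant, because energy and norm are invariant under \<open>rescale\<close>.
\<close>

lemma energy_expansion:
  "\<exists>C\<ge>0. \<forall>\<psi>\<in>D_space s. \<forall>\<mu>>0.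
    \<bar>energy (\<lambda>x. rescale s z \<mu> x + \<psi> x) - energy (rescale s z \<mu>)\<bar> \<le> C * (nrm \<psi> + nrm \<psi> powr (p / 2))"
proof -
  obtain C where C: "0 \<le> C" "\<And>\<psi>. \<psi> \<in> D_space s \<Longrightarrow>
    \<bar>crit (\<lambda>x. z x + \<psi> x) - crit z - p * hardy_form lam s z \<psi>\<bar> \<le> C * (crit \<psi> powr (2 / p) + crit \<psi>)"
    using crit_integral_expansion by blast
  let ?K = "C * (1 / S + 1 / S powr (p / 2)) + 1"
  have main: "\<bar>energy (\<lambda>x. z x + \<psi> x) - energy z\<bar> \<le> ?K * (nrm \<psi> + nrm \<psi> powr (p / 2))"
    if \<psi>: "\<psi> \<in> D_space s" for \<psi>
  proof -
    let ?R = "crit (\<lambda>x. z x + \<psi> x) - crit z - p * hardy_form lam s z \<psi>"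
    let ?n = "nrm \<psi>"
    have n: "0 \<le> ?n" by (rule norm_sq_nonneg[OF \<psi>])
    have "energy (\<lambda>x. z x + \<psi> x) - energy z = ?n / 2 - ?R / p"
      unfolding energy_def norm_sq_add[OF z_D_space \<psi>] using p_gt_2 by (simp add: field_simps)
    moreover have "\<bar>?R / p\<bar> \<le> \<bar>?R\<bar>"
    proof -
      have "\<bar>?R\<bar> * 1 \<le> \<bar>?R\<bar> * p" using p_gt_2 by (intro mult_left_mono) auto
      then show ?thesis using p_gt_2 by (simp add: abs_divide divide_le_eq)
    qed
    moreover have "\<bar>e\<bar> \<le> m + r" if "e = m / 2 - q" "\<bar>q\<bar> \<le> r" "0 \<le> m" for e m q r :: real
      using that by linarith
    ultimately have "\<bar>energy (\<lambda>x. z x + \<psi> x) - energy z\<bar> \<le> ?n + \<bar>?R\<bar>"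
      using n by blast
    moreover have "\<bar>?R\<bar> \<le> C * (?n / S + (?n / S) powr (p / 2))"
    proof -
      have "crit \<psi> powr (2 / p) \<le> ?n / S" "crit \<psi> \<le> (?n / S) powr (p / 2)"
        using crit_le_norm_sq[OF \<psi>, of "2 / p"] crit_le_norm_sq[OF \<psi>, of 1] p_gt_2 n S_pos
          crit_integral_nonneg[of s t \<psi>] by auto
      then show ?thesis using C(2)[OF \<psi>] C(1) by (smt (verit) mult_left_mono)
    qed
    moreover have "C * (?n / S + (?n / S) powr (p / 2)) \<le> C * (1 / S + 1 / S powr (p / 2)) * (?n + ?n powr (p / 2))"
    proof -
      have "?n / S + (?n / S) powr (p / 2) \<le> (1 / S + 1 / S powr (p / 2)) * (?n + ?n powr (p / 2))"
        using n S_pos by (simp add: powr_divide algebra_simps)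
      then show ?thesis using C(1) by (simp add: mult.assoc mult_left_mono)
    qed
    moreover have "?n \<le> ?n + ?n powr (p / 2)" by simp
    ultimately show ?thesis by (simp only: distrib_right mult_1)
  qed
  show ?thesis
  proof (intro exI[of _ ?K] conjI ballI allI impI)
    show "0 \<le> ?K" using C(1) S_pos by simp
    fix \<psi> :: "'a \<Rightarrow> real" and \<mu> :: real assume \<psi>: "\<psi> \<in> D_space s" and \<mu>: "0 < \<mu>"
    let ?\<psi> = "rescale s \<psi> (inverse \<mu>)"
    have \<psi>': "?\<psi> \<in> D_space s" using rescale_D_space[OF \<psi>] \<mu> by simp
    have "(\<lambda>x. rescale s z \<mu> x + \<psi> x) = rescale s (\<lambda>x. z x + ?\<psi> x) \<mu>"
      by (simp add: rescale_add rescale_inverse[OF \<mu>])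
    moreover have "nrm ?\<psi> = nrm \<psi>" using norm_sq_rescale[OF D_space_borel[OF \<psi>]] \<mu> by simp
    ultimately show "\<bar>energy (\<lambda>x. rescale s z \<mu> x + \<psi> x) - energy (rescale s z \<mu>)\<bar> \<le> ?K * (nrm \<psi> + nrm \<psi> powr (p / 2))"
      using main[OF \<psi>'] \<mu> by (simp add: energy_rescale D_space_borel[OF z_D_space] D_space_borel[OF D_space_add[OF z_D_space \<psi>']])
  qed
qed

end

section \<open>Elementary estimates\<close>

lemma abs_integral_le_dominating:
  fixes f g :: "'b \<Rightarrow> real"
  assumes "integrable M g" "AE x in M. \<bar>f x\<bar> \<le> g x"
  shows "\<bar>\<integral>x. f x \<partial>M\<bar> \<le> (\<integral>x. g x \<partial>M)"
proof (cases "integrable M f")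
  case True
  have "\<bar>\<integral>x. f x \<partial>M\<bar> \<le> (\<integral>x. \<bar>f x\<bar> \<partial>M)" by (rule integral_abs_bound)
  also have "\<dots> \<le> (\<integral>x. g x \<partial>M)"
    using True assms by (intro integral_mono_AE) auto
  finally show ?thesis .
next
  case False
  have "AE x in M. 0 \<le> g x" using assms(2) by eventually_elim linarith
  then have "0 \<le> (\<integral>x. g x \<partial>M)" by (rule integral_nonneg_AE)
  then show ?thesis using False by (simp add: not_integrable_integral_eq)
qed

text \<open>
  Makes a bound of order larger than one usable in the definition of the derivative.
\<close>

lemma superlinear_small:
  fixes \<gamma> C \<epsilon> :: real
  assumes "1 < \<gamma>" "0 \<le> C" "0 < \<epsilon>"
  shows "\<exists>\<delta>>0. \<delta> \<le> 1 \<and> (\<forall>n. 0 \<le> n \<and> n < \<delta> \<longrightarrow> C * n powr \<gamma> \<le> \<epsilon> * n)"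
proof -
  let ?\<delta> = "min 1 ((\<epsilon> / (C + 1)) powr (1 / (\<gamma> - 1)))"
  have "C * n powr \<gamma> \<le> \<epsilon> * n" if n: "0 \<le> n" "n < ?\<delta>" for n
  proof (cases "n = 0")
    case False
    have "n powr (\<gamma> - 1) \<le> ((\<epsilon> / (C + 1)) powr (1 / (\<gamma> - 1))) powr (\<gamma> - 1)"
      using n assms by (intro powr_mono2) auto
    also have "\<dots> = \<epsilon> / (C + 1)" using assms by (simp add: powr_powr)
    finally have "C * n powr (\<gamma> - 1) \<le> C * (\<epsilon> / (C + 1))"
      using assms by (intro mult_left_mono) auto
    also have "\<dots> \<le> \<epsilon>" using assms by (simp add: field_simps)
    finally have "C * n powr (\<gamma> - 1) * n \<le> \<epsilon> * n" using n by (intro mult_right_mono) auto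
    moreover have "n powr (\<gamma> - 1) * n powr 1 = n powr \<gamma>" by (subst powr_add[symmetric]) simp
    ultimately show ?thesis using n by (simp add: mult.assoc)
  qed simp
  then show ?thesis using assms by (intro exI[of _ ?\<delta>]) auto
qed

lemma DERIV_eq_0_of_sublinear:
  fixes g :: "real \<Rightarrow> real"
  assumes der: "(g has_real_derivative d) (at 0)"
    and small: "\<And>\<eta>. 0 < \<eta> \<Longrightarrow> \<exists>\<delta>>0. \<forall>e. \<bar>e\<bar> < \<delta> \<longrightarrow> \<bar>g e - g 0\<bar> \<le> \<eta> * \<bar>e\<bar>"
  shows "d = 0"
proof -
  have "(\<lambda>e. (g (0 + e) - g 0) / e) \<midarrow>0\<rightarrow> d" using der by (simp add: DERIV_def)
  moreover have "(\<lambda>e. (g (0 + e) - g 0) / e) \<midarrow>0\<rightarrow> 0"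
  proof (rule LIM_I)
    fix r :: real assume r: "0 < r"
    obtain \<delta> where \<delta>: "\<delta> > 0" "\<And>e. \<bar>e\<bar> < \<delta> \<Longrightarrow> \<bar>g e - g 0\<bar> \<le> r / 2 * \<bar>e\<bar>"
      using small[of "r / 2"] r by auto
    show "\<exists>s>0. \<forall>x::real. x \<noteq> 0 \<and> norm (x - 0) < s \<longrightarrow> norm ((g (0 + x) - g 0) / x - 0) < r"
    proof (intro exI[of _ \<delta>] conjI allI impI)
      fix x :: real assume x: "x \<noteq> 0 \<and> norm (x - 0) < \<delta>"
      then have "\<bar>g x - g 0\<bar> \<le> r / 2 * \<bar>x\<bar>" using \<delta>(2)[of x] by simp
      also have "\<dots> < r * \<bar>x\<bar>" using x r by simp
      finally show "norm ((g (0 + x) - g 0) / x - 0) < r"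
        using x by (simp add: abs_divide divide_less_eq)
    qed (rule \<delta>(1))
  qed
  ultimately show ?thesis by (rule LIM_unique)
qed

text \<open>
  With \<open>S a powr (2 / p) \<le> a\<close>, the Hardy-Sobolev inequality on the Nehari manifold, divided by \<open>a powr (2 / p)\<close>,
  this is the lower bound that identifies the least level of one equation.
\<close>

lemma nehari_single:
  fixes p S a :: real
  assumes "2 < p" "0 < S" "0 < a" "S \<le> a powr (1 - 2 / p)"
  shows "S powr (p / (p - 2)) \<le> a"
proof -
  have "S powr (p / (p - 2)) \<le> (a powr (1 - 2 / p)) powr (p / (p - 2))"
    using assms by (intro powr_mono2) auto
  also have "(1 - 2 / p) * (p / (p - 2)) = 1" using assms(1) by (simp add: field_simps)
  then have "(a powr (1 - 2 / p)) powr (p / (p - 2)) = a" using assms(3) by (simp only: powr_powr powr_one)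
  finally show ?thesis .
qed

text \<open>
  A weak coupling moves the one-equation bound only slightly. The assumption \<open>2 \<le> \<gamma>\<close> enters here: the coupling
  contains \<open>a powr (\<gamma> / p)\<close>, and after division by \<open>a powr (2 / p)\<close> a nonnegative power of \<open>a\<close> remains, which is
  bounded by a power of \<open>M\<close> even when \<open>a\<close> is small.
\<close>

lemma nehari_coupled_gap:
  fixes p S a b c K M H \<gamma> \<delta> :: real
  assumes p: "2 < p" and exps: "2 \<le> \<gamma>" "0 < \<delta>" and nn: "0 \<le> c" "0 \<le> H"
    and ab: "0 < a" "a \<le> M" "0 \<le> b" "b \<le> M"
    and K: "K \<le> H * a powr (\<gamma> / p) * b powr (\<delta> / p)"
    and ineq: "S * a powr (2 / p) \<le> a + c * K"
  shows "S - c * (H * M powr ((\<gamma> - 2) / p) * M powr (\<delta> / p)) \<le> a powr (1 - 2 / p)"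
proof -
  let ?A = "a powr (2 / p)" and ?B = "H * M powr ((\<gamma> - 2) / p) * M powr (\<delta> / p)"
  have A: "0 < ?A" using ab by simp
  have split: "a powr (\<gamma> / p) = a powr ((\<gamma> - 2) / p) * ?A" "a = a powr (1 - 2 / p) * ?A"
    using ab by (simp_all add: diff_divide_distrib flip: powr_add)
  have "K \<le> H * (a powr ((\<gamma> - 2) / p) * ?A) * b powr (\<delta> / p)"
    using K unfolding split(1) .
  also have "\<dots> = H * a powr ((\<gamma> - 2) / p) * b powr (\<delta> / p) * ?A" by simp
  also have "\<dots> \<le> ?B * ?A"
    using p exps nn ab by (intro mult_right_mono mult_mono mult_left_mono powr_mono2) auto
  finally have "c * K \<le> c * (?B * ?A)" using nn by (intro mult_left_mono) auto
  then have "S * ?A \<le> a powr (1 - 2 / p) * ?A + c * ?B * ?A"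
    using ineq split(2) by (simp add: mult.assoc)
  then have "(S - c * ?B) * ?A \<le> a powr (1 - 2 / p) * ?A" by (simp add: left_diff_distrib)
  then show ?thesis using A by (simp only: mult_le_cancel_right_pos)
qed

text \<open>
  Here \<open>a\<close> and \<open>b\<close> stand for the critical integrals of the two components and \<open>K\<close> for the coupling integral.
  If one component vanishes, so does the coupling, and the other one alone reaches the level. If both are
  nonzero and \<open>S2 < S1\<close>, the first alone exceeds the level as soon as its loss is below \<open>S1 - S2\<close>. If \<open>S1 = S2\<close>,
  then each reaches at least half of it.
\<close>

lemma nehari_lower_bound:
  fixes p S1 S2 \<alpha> \<beta> H :: real
  assumes p: "2 < p" and S: "0 < S2" "S2 \<le> S1"
    and exps: "2 \<le> \<alpha>" "1 < \<beta>" and strict: "S2 < S1 \<or> 2 \<le> \<beta>" and H: "0 \<le> H"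
  shows "\<exists>\<nu>0>0. \<forall>\<nu> a b K. 0 < \<nu> \<and> \<nu> < \<nu>0 \<and> 0 \<le> a \<and> 0 \<le> b \<and> (a \<noteq> 0 \<or> b \<noteq> 0) \<and> 0 \<le> K \<and>
      K \<le> H * a powr (\<alpha> / p) * b powr (\<beta> / p) \<and>
      S1 * a powr (2 / p) \<le> a + \<nu> * \<alpha> * K \<and> S2 * b powr (2 / p) \<le> b + \<nu> * \<beta> * K \<longrightarrow>
      S2 powr (p / (p - 2)) \<le> a + b"
proof -
  let ?r = "p / (p - 2)"
  define M where "M = S2 powr ?r"
  define c1 where "c1 = \<alpha> * (H * M powr ((\<alpha> - 2) / p) * M powr (\<beta> / p))"
  define c2 where "c2 = \<beta> * (H * M powr ((\<beta> - 2) / p) * M powr (\<alpha> / p))"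
  have r: "0 < ?r" using p by simp
  \<comment> \<open>The factor with \<open>(1 - \<theta>) powr r = 1 / 2\<close>: two components of half the critical size
    already reach the level of a single one.\<close>
  define \<theta> where "\<theta> = 1 - (1 / 2) powr (1 / ?r)"
  have \<theta>: "0 < \<theta>" "(1 - \<theta>) powr ?r = 1 / 2"
  proof -
    have "(1 / 2 :: real) powr (1 / ?r) < (1 / 2) powr 0" using r p by (intro powr_less_mono') auto
    then show "0 < \<theta>" by (simp add: \<theta>_def)
    show "(1 - \<theta>) powr ?r = 1 / 2" using p by (simp add: \<theta>_def powr_powr)
  qed
  \<comment> \<open>The loss that each case can afford.\<close>
  define \<tau> where "\<tau> = (if S2 < S1 then S1 - S2 else \<theta> * S2)"
  have \<tau>: "0 < \<tau>" using \<theta> S by (simp add: \<tau>_def)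
  have c: "0 \<le> c1" "0 \<le> c2" using H exps by (simp_all add: c1_def c2_def)
  define \<nu>0 where "\<nu>0 = \<tau> / (c1 + c2 + 1)"
  have "S2 powr ?r \<le> a + b" if \<nu>: "0 < \<nu>" "\<nu> < \<nu>0" and ab: "0 \<le> a" "0 \<le> b" "a \<noteq> 0 \<or> b \<noteq> 0"
      and K: "0 \<le> K" "K \<le> H * a powr (\<alpha> / p) * b powr (\<beta> / p)"
      and A: "S1 * a powr (2 / p) \<le> a + \<nu> * \<alpha> * K" and B: "S2 * b powr (2 / p) \<le> b + \<nu> * \<beta> * K"
    for \<nu> a b K
  proof (rule ccontr)
    assume "\<not> S2 powr ?r \<le> a + b"
    then have le: "a + b < M" by (simp add: M_def)
    have single: "S2 powr ?r \<le> e" if e: "0 < e" and ineq: "S * e powr (2 / p) \<le> e" and "S2 \<le> S" for S e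
    proof (rule nehari_single[OF p S(1) e])
      have "e = e powr (1 - 2 / p) * e powr (2 / p)" using e by (simp flip: powr_add)
      with ineq have "S * e powr (2 / p) \<le> e powr (1 - 2 / p) * e powr (2 / p)" by simp
      then have "S \<le> e powr (1 - 2 / p)" using e by (simp only: mult_le_cancel_right_pos powr_gt_zero)
      then show "S2 \<le> e powr (1 - 2 / p)" using \<open>S2 \<le> S\<close> by simp
    qed
    have \<nu>c: "\<nu> * c1 \<le> \<tau>" "\<nu> * c2 \<le> \<tau>"
    proof -
      have "\<nu> * (c1 + c2 + 1) \<le> \<tau>" using \<nu> c by (simp add: \<nu>0_def field_simps)
      moreover have "0 \<le> \<nu> * c1" "0 \<le> \<nu> * c2" using \<nu> c by auto
      ultimately show "\<nu> * c1 \<le> \<tau>" "\<nu> * c2 \<le> \<tau>" using \<nu> by (auto simp: distrib_left)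
    qed
    show False
    proof (cases "a = 0 \<or> b = 0")
      case True
      then have K0: "K = 0" using K by auto
      show False
      proof (cases "a = 0")
        case True
        then show False using single[of b S2] B K0 ab le by (simp add: M_def)
      next
        case False
        then show False using single[of a S1] A K0 ab le S by (simp add: M_def)
      qed
    next
      case False
      then have pos: "0 < a" "0 < b" using ab by auto
      have ga: "S1 - \<nu> * c1 \<le> a powr (1 - 2 / p)"
        using nehari_coupled_gap[OF p exps(1), of \<beta> "\<nu> * \<alpha>" H a M b K S1] exps H \<nu> pos le K A
        by (simp add: c1_def mult.assoc)
      show False
      proof (cases "S2 < S1")
        case True
        then have "S2 \<le> a powr (1 - 2 / p)" using ga \<nu>c(1) by (simp add: \<tau>_def)
        from nehari_single[OF p S(1) pos(1) this] show False using le pos by (simp add: M_def)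
      next
        case False
        then have eq: "S1 = S2" and \<beta>: "2 \<le> \<beta>" using S strict by auto
        have \<tau>': "\<tau> = \<theta> * S2" using False by (simp add: \<tau>_def)
        have K': "K \<le> H * b powr (\<beta> / p) * a powr (\<alpha> / p)" using K(2) by (simp add: mult.commute mult.left_commute)
        have gb: "S2 - \<nu> * c2 \<le> b powr (1 - 2 / p)"
          using nehari_coupled_gap[OF p \<beta>, of \<alpha> "\<nu> * \<beta>" H b M a K S2] exps H \<nu> pos le K' B
          by (simp add: c2_def mult.assoc)
        have \<theta>1: "0 < 1 - \<theta>" by (simp add: \<theta>_def)
        have half: "M / 2 \<le> e" if "0 < e" "(1 - \<theta>) * S2 \<le> e powr (1 - 2 / p)" for e
          using nehari_single[OF p _ that] \<theta>1 S(1) \<theta>(2) by (simp add: powr_mult M_def)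
        have "(1 - \<theta>) * S2 \<le> a powr (1 - 2 / p)" "(1 - \<theta>) * S2 \<le> b powr (1 - 2 / p)"
          using ga gb \<nu>c unfolding eq \<tau>' by (simp_all add: left_diff_distrib)
        from half[OF pos(1) this(1)] half[OF pos(2) this(2)] show False using le by simp
      qed
    qed
  qed
  moreover have "0 < \<nu>0" using \<tau> c by (simp add: \<nu>0_def)
  ultimately show ?thesis by blast
qed

section \<open>The coupled system\<close>

lemma J_fun_swap:
  fixes h u v :: "'a::euclidean_space \<Rightarrow> real"
  shows "J_fun lam2 lam1 t s \<beta> \<alpha> h \<nu> (v, u) = J_fun lam1 lam2 t s \<alpha> \<beta> h \<nu> (u, v)"
  by (simp add: J_fun_def pair_norm_def add.commute mult.commute)

lemma pair_norm_swap: "pair_norm lam2 lam1 s (v, u) = pair_norm lam1 lam2 s (u, v)"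
  by (simp add: pair_norm_def add.commute)

lemma critical_point_swap:
  "critical_point lam1 lam2 t s \<alpha> \<beta> h \<nu> (u, v) \<Longrightarrow> critical_point lam2 lam1 t s \<beta> \<alpha> h \<nu> (v, u)"
  unfolding critical_point_def prod.case
  by (subst (1 2) J_fun_swap, subst (1 2) pair_norm_swap) blast

lemma nonneg_bound_states_swap:
  "(u, v) \<in> nonneg_bound_states lam1 lam2 t s \<alpha> \<beta> h \<nu> \<longleftrightarrow>
    (v, u) \<in> nonneg_bound_states lam2 lam1 t s \<beta> \<alpha> h \<nu>"
  using critical_point_swap[of lam1 lam2 t s \<alpha> \<beta> h \<nu> u v] critical_point_swap[of lam2 lam1 t s \<beta> \<alpha> h \<nu> v u]
  by (auto simp: nonneg_bound_states_def bound_state_def)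

lemma ground_state_swap:
  assumes "ground_state lam1 lam2 t s \<alpha> \<beta> h \<nu> (u, v)"
  shows "ground_state lam2 lam1 t s \<beta> \<alpha> h \<nu> (v, u)"
  unfolding ground_state_def is_arg_min_def
proof (intro conjI notI)
  have "(u, v) \<in> nonneg_bound_states lam1 lam2 t s \<alpha> \<beta> h \<nu>"
    using assms by (simp add: ground_state_def is_arg_min_def)
  then show "(v, u) \<in> nonneg_bound_states lam2 lam1 t s \<beta> \<alpha> h \<nu>"
    by (rule nonneg_bound_states_swap[THEN iffD1])
next
  assume "\<exists>q. q \<in> nonneg_bound_states lam2 lam1 t s \<beta> \<alpha> h \<nu> \<and>
    J_fun lam2 lam1 t s \<beta> \<alpha> h \<nu> q < J_fun lam2 lam1 t s \<beta> \<alpha> h \<nu> (v, u)"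
  then obtain v' u' where q: "(v', u') \<in> nonneg_bound_states lam2 lam1 t s \<beta> \<alpha> h \<nu>"
    "J_fun lam2 lam1 t s \<beta> \<alpha> h \<nu> (v', u') < J_fun lam2 lam1 t s \<beta> \<alpha> h \<nu> (v, u)" by auto
  have "(u', v') \<in> nonneg_bound_states lam1 lam2 t s \<alpha> \<beta> h \<nu>"
    using q(1) by (rule nonneg_bound_states_swap[THEN iffD1])
  moreover have "J_fun lam1 lam2 t s \<alpha> \<beta> h \<nu> (u', v') < J_fun lam1 lam2 t s \<alpha> \<beta> h \<nu> (u, v)"
    using q(2) unfolding J_fun_swap[of lam2 lam1 t s \<beta> \<alpha> h \<nu>] .
  ultimately show False using assms by (auto simp: ground_state_def is_arg_min_def)
qed

text \<open>
  Two uncoupled equations with a common exponent \<open>p\<close>, together with a coupling of at most critical growth.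
  The axioms are symmetric in the two components, so every fact on the first one transfers to the second.
\<close>

locale coupled_system =
  A: hardy_sobolev s t lam1 p S1 z1 + B: hardy_sobolev s t lam2 p S2 z2
  for s t lam1 lam2 p S1 S2 :: real and z1 z2 :: "'a::euclidean_space \<Rightarrow> real" +
  fixes \<alpha> \<beta> :: real and h :: "'a \<Rightarrow> real"
  assumes exps: "1 < \<alpha>" "1 < \<beta>" "\<alpha> + \<beta> \<le> p"
    and h_nonneg: "AE x in lebesgue. 0 \<le> h x"
    and h_integrability:
      "if \<alpha> + \<beta> = p then h \<in> L_infinity else h \<in> weighted_Lp (p / (p - \<alpha> - \<beta>)) t"
begin

lemma swap: "coupled_system s t lam2 lam1 p S2 S1 z2 z1 \<beta> \<alpha> h"
proof -
  have "if \<beta> + \<alpha> = p then h \<in> L_infinity else h \<in> weighted_Lp (p / (p - \<beta> - \<alpha>)) t"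
  proof -
    have "p - \<beta> - \<alpha> = p - \<alpha> - \<beta>" by simp
    then show ?thesis using h_integrability by (simp only: add.commute[of \<beta> \<alpha>])
  qed
  then show ?thesis
    using exps h_nonneg
    by (intro coupled_system.intro A.hardy_sobolev_axioms B.hardy_sobolev_axioms coupled_system_axioms.intro) auto
qed

definition coupling :: "('a \<Rightarrow> real) \<Rightarrow> ('a \<Rightarrow> real) \<Rightarrow> real" where
  "coupling u v = (\<integral>x. h x * (\<bar>u x\<bar> powr \<alpha> * \<bar>v x\<bar> powr \<beta>) / norm x powr t \<partial>lebesgue)"

lemma coupling_nonneg: "0 \<le> coupling u v"
  unfolding coupling_def
  by (rule integral_nonneg_AE) (use h_nonneg in eventually_elim, simp)

lemma coupling_cmult: "coupling (\<lambda>x. k * u x) v = \<bar>k\<bar> powr \<alpha> * coupling u v"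
proof -
  have eq: "h x * (\<bar>k * u x\<bar> powr \<alpha> * \<bar>v x\<bar> powr \<beta>) / norm x powr t =
      \<bar>k\<bar> powr \<alpha> * (h x * (\<bar>u x\<bar> powr \<alpha> * \<bar>v x\<bar> powr \<beta>) / norm x powr t)" for x
    by (simp add: abs_mult powr_mult)
  show ?thesis unfolding coupling_def eq by (rule integral_mult_right_zero)
qed

text \<open>
  Hoelder's inequality with the exponents \<open>\<alpha> / p\<close>, \<open>\<beta> / p\<close> and, in the subcritical case, the remaining
  \<open>1 - (\<alpha> + \<beta>) / p\<close> for \<open>h\<close>; the weight \<open>1 / norm x powr t\<close> is distributed in the same proportion.
\<close>

lemma coupling_bound:
  "\<exists>H\<ge>0. \<forall>u\<in>D_space s. \<forall>v\<in>D_space s. coupling u v \<le>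
    H * crit_integral s t u powr (\<alpha> / p) * crit_integral s t v powr (\<beta> / p)"
proof -
  let ?w = "\<lambda>x::'a. norm x powr t"
  have p0: "0 < p" "p \<noteq> 0" using A.p_gt_2 by auto
  have mix: "(\<bar>u x\<bar> powr p / ?w x) powr (\<alpha> / p) * (\<bar>v x\<bar> powr p / ?w x) powr (\<beta> / p) =
      \<bar>u x\<bar> powr \<alpha> * \<bar>v x\<bar> powr \<beta> / ?w x powr ((\<alpha> + \<beta>) / p)" for u v :: "'a \<Rightarrow> real" and x
    using p0 by (simp add: powr_divide powr_powr add_divide_distrib powr_add)
  show ?thesis
  proof (cases "\<alpha> + \<beta> = p")
    case True
    then obtain C0 where C0: "AE x in lebesgue. \<bar>h x\<bar> \<le> C0"
      using h_integrability by (auto simp: L_infinity_def)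
    let ?C = "\<bar>C0\<bar>"
    have C: "AE x in lebesgue. \<bar>h x\<bar> \<le> ?C" using C0 by eventually_elim linarith
    show ?thesis
    proof (intro exI[of _ ?C] conjI ballI)
      fix u v :: "'a \<Rightarrow> real" assume u: "u \<in> D_space s" and v: "v \<in> D_space s"
      let ?P = "\<lambda>x. (\<bar>u x\<bar> powr p / ?w x) powr (\<alpha> / p) * (\<bar>v x\<bar> powr p / ?w x) powr (\<beta> / p)"
      note H = Holder2[OF _ _ _ A.hardy_sobolev_inequality(2)[OF u] A.hardy_sobolev_inequality(2)[OF v],
          of "\<alpha> / p" "\<beta> / p"]
      have e: "0 < \<alpha> / p" "0 < \<beta> / p" "\<alpha> / p + \<beta> / p = 1"
        using exps p0 True by (simp_all add: add_divide_distrib[symmetric])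
      have P: "?P x = \<bar>u x\<bar> powr \<alpha> * \<bar>v x\<bar> powr \<beta> / ?w x" for x
        unfolding mix using True p0 by simp
      have "\<bar>coupling u v\<bar> \<le> (\<integral>x. ?C * ?P x \<partial>lebesgue)"
        unfolding coupling_def
      proof (rule abs_integral_le_dominating)
        show "integrable lebesgue (\<lambda>x. ?C * ?P x)" using H(1) e by (intro integrable_mult_right) auto
        show "AE x in lebesgue. \<bar>h x * (\<bar>u x\<bar> powr \<alpha> * \<bar>v x\<bar> powr \<beta>) / ?w x\<bar> \<le> ?C * ?P x"
          using C
        proof eventually_elim
          case (elim x)
          then show ?case unfolding P
            by (simp add: abs_mult mult_right_mono divide_right_mono)
        qed
      qed
      also have "\<dots> = ?C * (\<integral>x. ?P x \<partial>lebesgue)" by (rule integral_mult_right_zero)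
      also have "\<dots> \<le> ?C * (crit_integral s t u powr (\<alpha> / p) * crit_integral s t v powr (\<beta> / p))"
        using H(2) e unfolding A.crit_eq by (intro mult_left_mono) auto
      finally show "coupling u v \<le> ?C * crit_integral s t u powr (\<alpha> / p) * crit_integral s t v powr (\<beta> / p)"
        by (simp add: mult.assoc)
    qed simp
  next
    case False
    define \<gamma> where "\<gamma> = (p - \<alpha> - \<beta>) / p"
    let ?q = "p / (p - \<alpha> - \<beta>)"
    have \<gamma>: "0 < \<gamma>" "1 / \<gamma> = ?q" using False exps p0 by (simp_all add: \<gamma>_def)
    have hL: "h \<in> weighted_Lp ?q t" using False h_integrability by simp
    let ?k = "\<lambda>x. \<bar>h x\<bar> powr ?q / ?w x"
    have ki: "integrable lebesgue ?k"
    proof (rule integrableI_nonneg)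
      have [measurable]: "h \<in> borel_measurable lebesgue" using hL by (simp add: weighted_Lp_def)
      have "(\<lambda>x. \<bar>h x\<bar> powr ?q) \<in> borel_measurable lebesgue" by measurable
      then show "?k \<in> borel_measurable lebesgue" by (rule borel_measurable_weight)
      show "(\<integral>\<^sup>+x. ennreal (?k x) \<partial>lebesgue) < \<infinity>" using hL by (simp add: weighted_Lp_def)
    qed simp
    let ?H = "(\<integral>x. ?k x \<partial>lebesgue) powr \<gamma>"
    show ?thesis
    proof (intro exI[of _ ?H] conjI ballI)
      fix u v :: "'a \<Rightarrow> real" assume u: "u \<in> D_space s" and v: "v \<in> D_space s"
      let ?P = "\<lambda>x. (\<bar>u x\<bar> powr p / ?w x) powr (\<alpha> / p) * (\<bar>v x\<bar> powr p / ?w x) powr (\<beta> / p) * ?k x powr \<gamma>"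
      note H = Holder3[OF _ _ _ _ A.hardy_sobolev_inequality(2)[OF u] A.hardy_sobolev_inequality(2)[OF v] ki,
          of "\<alpha> / p" "\<beta> / p" \<gamma>]
      have e: "0 < \<alpha> / p" "0 < \<beta> / p" "\<alpha> / p + \<beta> / p + \<gamma> = 1"
        using exps p0 by (simp_all add: \<gamma>_def add_divide_distrib[symmetric])
      have P: "?P x = \<bar>h x\<bar> * (\<bar>u x\<bar> powr \<alpha> * \<bar>v x\<bar> powr \<beta>) / ?w x" for x
      proof -
        have "?k x powr \<gamma> = \<bar>h x\<bar> / ?w x powr \<gamma>"
          using \<gamma> by (simp add: powr_divide powr_powr flip: \<gamma>(2))
        moreover have "?w x powr ((\<alpha> + \<beta>) / p) * ?w x powr \<gamma> = ?w x"
          using e(3) by (simp add: add_divide_distrib flip: powr_add)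
        ultimately show ?thesis unfolding mix by simp
      qed
      have "\<bar>coupling u v\<bar> \<le> (\<integral>x. ?P x \<partial>lebesgue)"
        unfolding coupling_def
      proof (rule abs_integral_le_dominating)
        show "integrable lebesgue ?P" using H(1) e \<gamma> by auto
        show "AE x in lebesgue. \<bar>h x * (\<bar>u x\<bar> powr \<alpha> * \<bar>v x\<bar> powr \<beta>) / ?w x\<bar> \<le> ?P x"
          unfolding P by (simp add: abs_mult)
      qed
      also have "\<dots> \<le> crit_integral s t u powr (\<alpha> / p) * crit_integral s t v powr (\<beta> / p) * ?H"
        using H(2) e \<gamma> unfolding A.crit_eq by auto
      finally show "coupling u v \<le> ?H * crit_integral s t u powr (\<alpha> / p) * crit_integral s t v powr (\<beta> / p)"
        by (simp add: mult_ac)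
    qed simp
  qed
qed

text \<open>
  The square root is harmless only for nonnegative arguments, which coercivity guarantees.
\<close>

lemma pair_norm_sq:
  fixes u v :: "'a \<Rightarrow> real"
  shows "u \<in> D_space s \<Longrightarrow> v \<in> D_space s \<Longrightarrow>
    (pair_norm lam1 lam2 s (u, v))\<^sup>2 = norm_sq lam1 s u + norm_sq lam2 s v"
  using A.norm_sq_nonneg B.norm_sq_nonneg by (simp add: pair_norm_def add_nonneg_nonneg)

lemma J_fun_eq:
  assumes u: "u \<in> D_space s" and v: "v \<in> D_space s"
  shows "J_fun lam1 lam2 t s \<alpha> \<beta> h \<nu> (u, v) = A.energy u + B.energy v - \<nu> * coupling u v"
proof -
  have "(\<integral>x. (\<bar>u x\<bar> powr p + \<bar>v x\<bar> powr p) / norm x powr t \<partial>lebesgue) =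
      crit_integral s t u + crit_integral s t v"
    unfolding A.crit_eq add_divide_distrib
    by (rule Bochner_Integration.integral_add[OF A.hardy_sobolev_inequality(2)[OF u] A.hardy_sobolev_inequality(2)[OF v]])
  then show ?thesis
    unfolding J_fun_def prod.case pair_norm_sq[OF u v] A.energy_def B.energy_def coupling_def A.p_eq[symmetric]
    by (simp add: add_divide_distrib)
qed

lemma zero_D_space: "(\<lambda>x::'a. 0) \<in> D_space s"
  using D_space_cmult[OF A.z_D_space, of 0] by simp

text \<open>
  Along the ray \<open>((1 + e) u, v)\<close> the functional is an explicit function of \<open>e\<close>, since each term is
  homogeneous in \<open>u\<close>; its derivative at \<open>0\<close> vanishes at a critical point.
\<close>

lemma nehari_first:
  assumes crit: "critical_point lam1 lam2 t s \<alpha> \<beta> h \<nu> (u, v)"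
  shows "norm_sq lam1 s u = crit_integral s t u + \<nu> * \<alpha> * coupling u v"
proof -
  have u: "u \<in> D_space s" and v: "v \<in> D_space s"
    and small: "\<And>\<epsilon>. \<epsilon> > 0 \<Longrightarrow> \<exists>\<delta>>0. \<forall>\<phi> \<in> D_space s. \<forall>\<psi> \<in> D_space s. pair_norm lam1 lam2 s (\<phi>, \<psi>) < \<delta> \<longrightarrow>
        \<bar>J_fun lam1 lam2 t s \<alpha> \<beta> h \<nu> (\<lambda>x. u x + \<phi> x, \<lambda>x. v x + \<psi> x)
           - J_fun lam1 lam2 t s \<alpha> \<beta> h \<nu> (u, v)\<bar> \<le> \<epsilon> * pair_norm lam1 lam2 s (\<phi>, \<psi>)"
    using crit by (auto simp: critical_point_def)
  let ?n = "norm_sq lam1 s u" and ?c = "crit_integral s t u" and ?K = "coupling u v"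
  define g where "g e = ?n * (1 + e)\<^sup>2 / 2 - ?c * \<bar>1 + e\<bar> powr p / p + B.energy v - \<nu> * ?K * \<bar>1 + e\<bar> powr \<alpha>" for e
  let ?N = "sqrt ?n"
  have n: "0 \<le> ?n" by (rule A.norm_sq_nonneg[OF u])
  have J: "J_fun lam1 lam2 t s \<alpha> \<beta> h \<nu> (\<lambda>x. (1 + e) * u x, v) = g e" for e
    unfolding J_fun_eq[OF D_space_cmult[OF u, of "1 + e"] v, of \<nu>] A.energy_def norm_sq_cmult
      crit_integral_cmult[of s t "1 + e" u, folded A.p_eq] coupling_cmult g_def
    by (simp add: mult_ac)
  have N: "pair_norm lam1 lam2 s (\<lambda>x. e * u x, \<lambda>x. 0) = ?N * \<bar>e\<bar>" for e
  proof -
    have "norm_sq lam2 s (\<lambda>x::'a. 0) = 0" using norm_sq_cmult[of lam2 s 0 u] by simp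
    then show ?thesis by (simp add: pair_norm_def norm_sq_cmult real_sqrt_mult mult.commute)
  qed
  have "?n - ?c - \<nu> * \<alpha> * ?K = 0"
  proof (rule DERIV_eq_0_of_sublinear)
    have p0: "p \<noteq> 0" using A.p_gt_2 by simp
    \<comment> \<open>Near \<open>e = 0\<close> the absolute values may be dropped before differentiating.\<close>
    have D: "((\<lambda>e. ?n * (1 + e)\<^sup>2 / 2 - ?c * (1 + e) powr p / p + B.energy v - \<nu> * ?K * (1 + e) powr \<alpha>)
        has_real_derivative ?n - ?c - \<nu> * \<alpha> * ?K) (at 0)"
      using p0 by (auto intro!: derivative_eq_intros)
    have ev: "eventually (\<lambda>e. g e = ?n * (1 + e)\<^sup>2 / 2 - ?c * (1 + e) powr p / p + B.energy v - \<nu> * ?K * (1 + e) powr \<alpha>) (nhds 0)"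
      unfolding eventually_nhds_metric by (rule exI[of _ 1]) (auto simp: g_def dist_real_def abs_if)
    show "(g has_real_derivative ?n - ?c - \<nu> * \<alpha> * ?K) (at 0)"
      by (rule DERIV_cong_ev[OF refl ev refl, THEN iffD2, OF D])
    fix \<eta> :: real assume \<eta>: "0 < \<eta>"
    obtain \<delta> where \<delta>: "\<delta> > 0" "\<And>\<phi> \<psi>. \<phi> \<in> D_space s \<Longrightarrow> \<psi> \<in> D_space s \<Longrightarrow> pair_norm lam1 lam2 s (\<phi>, \<psi>) < \<delta> \<Longrightarrow>
        \<bar>J_fun lam1 lam2 t s \<alpha> \<beta> h \<nu> (\<lambda>x. u x + \<phi> x, \<lambda>x. v x + \<psi> x)
           - J_fun lam1 lam2 t s \<alpha> \<beta> h \<nu> (u, v)\<bar> \<le> \<eta> / (?N + 1) * pair_norm lam1 lam2 s (\<phi>, \<psi>)"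
      using small[of "\<eta> / (?N + 1)"] \<eta> n by (auto simp: add_nonneg_pos)
    show "\<exists>\<delta>>0. \<forall>e. \<bar>e\<bar> < \<delta> \<longrightarrow> \<bar>g e - g 0\<bar> \<le> \<eta> * \<bar>e\<bar>"
    proof (intro exI[of _ "\<delta> / (?N + 1)"] conjI allI impI)
      show "0 < \<delta> / (?N + 1)" using \<delta>(1) n by (auto simp: add_nonneg_pos)
      fix e assume e: "\<bar>e\<bar> < \<delta> / (?N + 1)"
      have N1: "0 < ?N + 1" using n by (simp add: add_nonneg_pos)
      have "?N * \<bar>e\<bar> \<le> (?N + 1) * \<bar>e\<bar>" by (simp add: distrib_right)
      also have "\<dots> < \<delta>" using e N1 by (simp add: field_simps)
      finally have "pair_norm lam1 lam2 s (\<lambda>x. e * u x, \<lambda>x. 0) < \<delta>" unfolding N .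
      from \<delta>(2)[OF D_space_cmult[OF u] zero_D_space this]
      have "\<bar>g e - g 0\<bar> \<le> \<eta> / (?N + 1) * (?N * \<bar>e\<bar>)"
        unfolding N using J[of e] J[of 0] by (simp add: distrib_right)
      also have "\<dots> = \<eta> * \<bar>e\<bar> * (?N / (?N + 1))" by simp
      also have "\<dots> \<le> \<eta> * \<bar>e\<bar> * 1"
        using \<eta> N1 by (intro mult_left_mono) auto
      finally show "\<bar>g e - g 0\<bar> \<le> \<eta> * \<bar>e\<bar>" by simp
    qed
  qed
  then show ?thesis by simp
qed

lemma nehari_second:
  assumes "critical_point lam1 lam2 t s \<alpha> \<beta> h \<nu> (u, v)"
  shows "norm_sq lam2 s v = crit_integral s t v + \<nu> * \<beta> * coupling u v"
proof -
  interpret swap: coupled_system s t lam2 lam1 p S2 S1 z2 z1 \<beta> \<alpha> h by (rule swap)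
  have "swap.coupling v u = coupling u v"
    by (simp add: swap.coupling_def coupling_def mult.commute)
  then show ?thesis using swap.nehari_first[OF critical_point_swap[OF assms]] by simp
qed

text \<open>
  The increment of the functional at \<open>(0, z)\<close> splits into the energy of \<open>\<phi>\<close>, the increment of the energy at
  \<open>z\<close>, and the coupling of \<open>\<phi>\<close> with \<open>z + \<psi>\<close>. The first two are quadratic or smaller. The coupling is of order
  \<open>\<alpha>\<close> in \<open>\<phi>\<close>, as it vanishes on the semitrivial couple, and \<open>1 < \<alpha>\<close> makes it superlinear.
\<close>

lemma semitrivial_critical_point:
  assumes \<mu>: "0 < \<mu>"
  shows "critical_point lam1 lam2 t s \<alpha> \<beta> h \<nu> (\<lambda>x. 0, rescale s z2 \<mu>)"
proof -
  let ?z = "rescale s z2 \<mu>"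
  have zD: "?z \<in> D_space s" by (rule rescale_D_space[OF B.z_D_space \<mu>])
  have cz: "crit_integral s t ?z = crit_integral s t z2"
    by (rule crit_integral_rescale[OF D_space_borel[OF B.z_D_space] \<mu> A.s(3)])
  obtain C where C: "0 \<le> C" "\<And>\<psi>. \<psi> \<in> D_space s \<Longrightarrow>
    \<bar>B.energy (\<lambda>x. ?z x + \<psi> x) - B.energy ?z\<bar> \<le> C * (norm_sq lam2 s \<psi> + norm_sq lam2 s \<psi> powr (p / 2))"
    using B.energy_expansion \<mu> by blast
  obtain H where H: "0 \<le> H" "\<And>u v. u \<in> D_space s \<Longrightarrow> v \<in> D_space s \<Longrightarrow>
    coupling u v \<le> H * crit_integral s t u powr (\<alpha> / p) * crit_integral s t v powr (\<beta> / p)"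
    using coupling_bound by blast
  have p: "2 < p" "p \<noteq> 0" using A.p_gt_2 by auto
  \<comment> \<open>\<open>M\<close> bounds the factor that the second component contributes to the coupling while the norm of the
    increment is at most 1.\<close>
  define M where "M = (2 powr p * (crit_integral s t z2 + (1 / S2) powr (p / 2))) powr (\<beta> / p)"
  define L where "L = 1 + (1 / S1) powr (p / 2) + 2 * C + \<bar>\<nu>\<bar> * (H * (1 / S1) powr (\<alpha> / 2) * M)"
  define \<gamma> where "\<gamma> = min \<alpha> 2"
  have \<gamma>: "1 < \<gamma>" "\<gamma> \<le> \<alpha>" "\<gamma> \<le> 2" using exps by (auto simp: \<gamma>_def)
  have L: "0 \<le> L" using C(1) H(1) by (simp add: L_def M_def)
  have zero: "norm_sq lam1 s (\<lambda>x::'a. 0) = 0" "crit_integral s t (\<lambda>x::'a. 0) = 0"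
    using norm_sq_cmult[of lam1 s 0 z1] crit_integral_cmult[of s t 0 z1] by simp_all
  have K0: "coupling (\<lambda>x. 0) v = 0" for v
    using exps coupling_cmult[of 0 z1 v] by simp
  have bound: "\<bar>J_fun lam1 lam2 t s \<alpha> \<beta> h \<nu> (\<lambda>x. 0 + \<phi> x, \<lambda>x. ?z x + \<psi> x)
      - J_fun lam1 lam2 t s \<alpha> \<beta> h \<nu> (\<lambda>x. 0, ?z)\<bar> \<le> L * pair_norm lam1 lam2 s (\<phi>, \<psi>) powr \<gamma>"
    if \<phi>: "\<phi> \<in> D_space s" and \<psi>: "\<psi> \<in> D_space s" and le1: "pair_norm lam1 lam2 s (\<phi>, \<psi>) \<le> 1" for \<phi> \<psi>
  proof -
    let ?n = "pair_norm lam1 lam2 s (\<phi>, \<psi>)" and ?a = "norm_sq lam1 s \<phi>" and ?b = "norm_sq lam2 s \<psi>"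
    have ab: "0 \<le> ?a" "0 \<le> ?b" using A.norm_sq_nonneg[OF \<phi>] B.norm_sq_nonneg[OF \<psi>] .
    have n: "0 \<le> ?n" using ab by (simp add: pair_norm_def)
    have absq: "?a \<le> ?n\<^sup>2" "?b \<le> ?n\<^sup>2" using pair_norm_sq[OF \<phi> \<psi>] ab by auto
    \<comment> \<open>Every exponent that occurs is at least \<open>\<gamma>\<close>, and the norm is at most 1.\<close>
    have pw: "y powr (r / 2) \<le> ?n powr \<gamma>" if "0 \<le> y" "y \<le> ?n\<^sup>2" "\<gamma> \<le> r" for y r
    proof -
      have "y powr (r / 2) \<le> (?n\<^sup>2) powr (r / 2)" using that \<gamma> by (intro powr_mono2) auto
      also have "\<dots> = ?n powr r"
      proof (cases "?n = 0")
        case False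
        then have "?n\<^sup>2 = ?n powr 2" using n by simp
        then show ?thesis by (simp add: powr_powr)
      qed simp
      also have "\<dots> \<le> ?n powr \<gamma>"
        using n le1 that(3) by (cases "?n = 0") (auto intro: powr_mono')
      finally show ?thesis .
    qed
    have a1: "?a \<le> ?n powr \<gamma>" "?a powr (p / 2) \<le> ?n powr \<gamma>" "?a powr (\<alpha> / 2) \<le> ?n powr \<gamma>"
      and b1: "?b \<le> ?n powr \<gamma>" "?b powr (p / 2) \<le> ?n powr \<gamma>"
      using pw[of ?a 2] pw[of ?a p] pw[of ?a \<alpha>] pw[of ?b 2] pw[of ?b p] ab absq \<gamma> p by auto
    have "crit_integral s t \<phi> \<le> (1 / S1) powr (p / 2) * ?n powr \<gamma>"
    proof -
      have "crit_integral s t \<phi> \<le> (?a / S1) powr (p / 2)"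
        using A.crit_le_norm_sq[OF \<phi>, of 1] crit_integral_nonneg[of s t \<phi>] by simp
      also have "\<dots> = (1 / S1) powr (p / 2) * ?a powr (p / 2)"
        using ab A.S_pos by (simp add: powr_divide)
      finally show ?thesis using a1(2) by (smt (verit) mult_left_mono powr_ge_zero)
    qed
    moreover have "crit_integral s t \<phi> / p \<le> crit_integral s t \<phi>"
      using p crit_integral_nonneg[of s t \<phi>] by (simp add: divide_le_eq mult_le_cancel_left1)
    moreover have "0 \<le> crit_integral s t \<phi> / p" using p crit_integral_nonneg[of s t \<phi>] by simp
    ultimately have E1: "\<bar>A.energy \<phi>\<bar> \<le> (1 + (1 / S1) powr (p / 2)) * ?n powr \<gamma>"
      using a1(1) ab by (simp add: A.energy_def distrib_right)
    have E2: "\<bar>B.energy (\<lambda>x. ?z x + \<psi> x) - B.energy ?z\<bar> \<le> 2 * C * ?n powr \<gamma>"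
    proof -
      have "C * (?b + ?b powr (p / 2)) \<le> C * (2 * ?n powr \<gamma>)" using b1 C(1) by (intro mult_left_mono) auto
      then show ?thesis using C(2)[OF \<psi>] by simp
    qed
    have E3: "coupling \<phi> (\<lambda>x. ?z x + \<psi> x) \<le> H * (1 / S1) powr (\<alpha> / 2) * M * ?n powr \<gamma>"
    proof -
      have zp: "(\<lambda>x. ?z x + \<psi> x) \<in> D_space s" by (rule D_space_add[OF zD \<psi>])
      have c1: "crit_integral s t \<phi> powr (\<alpha> / p) \<le> (1 / S1) powr (\<alpha> / 2) * ?n powr \<gamma>"
      proof -
        have "crit_integral s t \<phi> powr (\<alpha> / p) \<le> (?a / S1) powr (\<alpha> / p * p / 2)"
          using A.crit_le_norm_sq[OF \<phi>, of "\<alpha> / p"] exps p by simp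
        also have "\<dots> = (1 / S1) powr (\<alpha> / 2) * ?a powr (\<alpha> / 2)"
          using ab A.S_pos p by (simp add: powr_divide)
        finally show ?thesis using a1(3) by (smt (verit) mult_left_mono powr_ge_zero)
      qed
      have c2: "crit_integral s t (\<lambda>x. ?z x + \<psi> x) powr (\<beta> / p) \<le> M"
        unfolding M_def
      proof (rule powr_mono2)
        have b\<psi>: "crit_integral s t \<psi> \<le> (1 / S2) powr (p / 2)"
        proof -
          have "?b \<le> 1" using absq(2) le1 n power_le_one[of ?n 2] by linarith
          then have "(?b / S2) powr (p / 2) \<le> (1 / S2) powr (p / 2)"
            using ab B.S_pos p by (intro powr_mono2 divide_right_mono) auto
          then show ?thesis
            using B.crit_le_norm_sq[OF \<psi>, of 1] crit_integral_nonneg[of s t \<psi>] by simp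
        qed
        note zi = A.hardy_sobolev_inequality(2)[OF zD] and \<psi>i = A.hardy_sobolev_inequality(2)[OF \<psi>]
        have "crit_integral s t (\<lambda>x. ?z x + \<psi> x) \<le>
            (\<integral>x. 2 powr p * (\<bar>?z x\<bar> powr p / norm x powr t + \<bar>\<psi> x\<bar> powr p / norm x powr t) \<partial>lebesgue)"
          unfolding A.crit_eq
        proof (rule integral_mono)
          show "integrable lebesgue (\<lambda>x. \<bar>?z x + \<psi> x\<bar> powr p / norm x powr t)"
            by (rule A.hardy_sobolev_inequality(2)[OF zp])
          show "integrable lebesgue (\<lambda>x. 2 powr p * (\<bar>?z x\<bar> powr p / norm x powr t + \<bar>\<psi> x\<bar> powr p / norm x powr t))"
            by (intro integrable_mult_right Bochner_Integration.integrable_add zi \<psi>i)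
          fix x :: 'a
          have "\<bar>?z x + \<psi> x\<bar> powr p / norm x powr t \<le>
              2 powr p * (\<bar>?z x\<bar> powr p + \<bar>\<psi> x\<bar> powr p) / norm x powr t"
            using p by (intro divide_right_mono abs_add_powr_le) auto
          then show "\<bar>?z x + \<psi> x\<bar> powr p / norm x powr t \<le>
              2 powr p * (\<bar>?z x\<bar> powr p / norm x powr t + \<bar>\<psi> x\<bar> powr p / norm x powr t)"
            by (simp only: add_divide_distrib[symmetric] times_divide_eq_right)
        qed
        also have "\<dots> = 2 powr p * (crit_integral s t ?z + crit_integral s t \<psi>)"
          unfolding A.crit_eq integral_mult_right_zero by (simp only: Bochner_Integration.integral_add[OF zi \<psi>i])
        also have "\<dots> \<le> 2 powr p * (crit_integral s t z2 + (1 / S2) powr (p / 2))"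
          using b\<psi> unfolding cz by (intro mult_left_mono) auto
        finally show "crit_integral s t (\<lambda>x. ?z x + \<psi> x) \<le> 2 powr p * (crit_integral s t z2 + (1 / S2) powr (p / 2))" .
      qed (use exps p crit_integral_nonneg in auto)
      have "coupling \<phi> (\<lambda>x. ?z x + \<psi> x) \<le>
          H * crit_integral s t \<phi> powr (\<alpha> / p) * crit_integral s t (\<lambda>x. ?z x + \<psi> x) powr (\<beta> / p)"
        by (rule H(2)[OF \<phi> zp])
      also have "\<dots> \<le> H * ((1 / S1) powr (\<alpha> / 2) * ?n powr \<gamma>) * M"
        using c1 c2 H(1) by (intro mult_mono) auto
      finally show ?thesis by (simp add: mult_ac)
    qed
    have "\<bar>\<nu> * coupling \<phi> (\<lambda>x. ?z x + \<psi> x)\<bar> \<le> \<bar>\<nu>\<bar> * (H * (1 / S1) powr (\<alpha> / 2) * M * ?n powr \<gamma>)"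
      unfolding abs_mult using E3 coupling_nonneg[of \<phi>] by (intro mult_left_mono) auto
    then have E3': "\<bar>\<nu> * coupling \<phi> (\<lambda>x. ?z x + \<psi> x)\<bar> \<le> \<bar>\<nu>\<bar> * (H * (1 / S1) powr (\<alpha> / 2) * M) * ?n powr \<gamma>"
      by (simp only: mult.assoc)
    have "J_fun lam1 lam2 t s \<alpha> \<beta> h \<nu> (\<lambda>x. 0 + \<phi> x, \<lambda>x. ?z x + \<psi> x)
      - J_fun lam1 lam2 t s \<alpha> \<beta> h \<nu> (\<lambda>x. 0, ?z) =
      A.energy \<phi> + (B.energy (\<lambda>x. ?z x + \<psi> x) - B.energy ?z) - \<nu> * coupling \<phi> (\<lambda>x. ?z x + \<psi> x)"
      using J_fun_eq[OF \<phi> D_space_add[OF zD \<psi>], of \<nu>] J_fun_eq[OF zero_D_space zD, of \<nu>]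
      by (simp add: K0 A.energy_def zero)
    then show ?thesis using E1 E2 E3' unfolding L_def distrib_right by linarith
  qed
  show ?thesis
    unfolding critical_point_def prod.case
  proof (intro conjI allI impI zero_D_space zD)
    fix \<epsilon> :: real assume \<epsilon>: "0 < \<epsilon>"
    obtain \<delta> where \<delta>: "\<delta> > 0" "\<delta> \<le> 1" "\<And>n. 0 \<le> n \<Longrightarrow> n < \<delta> \<Longrightarrow> L * n powr \<gamma> \<le> \<epsilon> * n"
      using superlinear_small[OF \<gamma>(1) L \<epsilon>] by blast
    show "\<exists>\<delta>>0. \<forall>\<phi>\<in>D_space s. \<forall>\<psi>\<in>D_space s. pair_norm lam1 lam2 s (\<phi>, \<psi>) < \<delta> \<longrightarrow>
        \<bar>J_fun lam1 lam2 t s \<alpha> \<beta> h \<nu> (\<lambda>x. 0 + \<phi> x, \<lambda>x. ?z x + \<psi> x)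
          - J_fun lam1 lam2 t s \<alpha> \<beta> h \<nu> (\<lambda>x. 0, ?z)\<bar> \<le> \<epsilon> * pair_norm lam1 lam2 s (\<phi>, \<psi>)"
    proof (intro exI[of _ \<delta>] conjI ballI impI \<delta>(1))
      fix \<phi> \<psi> :: "'a \<Rightarrow> real" assume D: "\<phi> \<in> D_space s" "\<psi> \<in> D_space s"
        and lt: "pair_norm lam1 lam2 s (\<phi>, \<psi>) < \<delta>"
      have "0 \<le> pair_norm lam1 lam2 s (\<phi>, \<psi>)"
        using A.norm_sq_nonneg[OF D(1)] B.norm_sq_nonneg[OF D(2)] by (simp add: pair_norm_def)
      then show "\<bar>J_fun lam1 lam2 t s \<alpha> \<beta> h \<nu> (\<lambda>x. 0 + \<phi> x, \<lambda>x. ?z x + \<psi> x)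
          - J_fun lam1 lam2 t s \<alpha> \<beta> h \<nu> (\<lambda>x. 0, ?z)\<bar> \<le> \<epsilon> * pair_norm lam1 lam2 s (\<phi>, \<psi>)"
        using bound[OF D] \<delta>(2) \<delta>(3) lt by (meson less_le_trans less_imp_le order_trans)
    qed
  qed
qed

lemma semitrivial_level:
  assumes "0 < \<mu>"
  shows "J_fun lam1 lam2 t s \<alpha> \<beta> h \<nu> (\<lambda>x. 0, rescale s z2 \<mu>) = (1 / 2 - 1 / p) * S2 powr (p / (p - 2))"
proof -
  let ?z = "rescale s z2 \<mu>"
  have p: "2 < p" by (rule A.p_gt_2)
  have zero: "norm_sq lam1 s (\<lambda>x::'a. 0) = 0" "crit_integral s t (\<lambda>x::'a. 0) = 0" "coupling (\<lambda>x. 0) ?z = 0"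
    using norm_sq_cmult[of lam1 s 0 z1] crit_integral_cmult[of s t 0 z1] coupling_cmult[of 0 z1 ?z] exps
    by simp_all
  have "S2 powr (p / (p - 2)) = crit_integral s t z2"
  proof -
    have "(1 - 2 / p) * (p / (p - 2)) = 1" using p by (simp add: field_simps)
    then show ?thesis unfolding B.S_crit_z using B.crit_z_pos by (simp only: powr_powr powr_one)
  qed
  moreover have "B.energy ?z = B.energy z2"
    by (rule B.energy_rescale[OF D_space_borel[OF B.z_D_space] assms])
  moreover have "B.energy z2 = (1 / 2 - 1 / p) * crit_integral s t z2"
    by (simp add: B.energy_def B.norm_sq_z left_diff_distrib)
  ultimately show ?thesis
    using J_fun_eq[OF zero_D_space rescale_D_space[OF B.z_D_space assms]]
    by (simp add: A.energy_def zero)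
qed

lemma semitrivial_bound_state:
  assumes \<mu>: "0 < \<mu>"
  shows "(\<lambda>x. 0, rescale s z2 \<mu>) \<in> nonneg_bound_states lam1 lam2 t s \<alpha> \<beta> h \<nu>"
proof -
  have pos: "0 < rescale s z2 \<mu> x" if "x \<noteq> 0" for x
    using B.z_pos[of "x /\<^sub>R \<mu>"] that \<mu> by (simp add: rescale_def)
  have "AE x in lebesgue. 0 \<le> rescale s z2 \<mu> x"
    using AE_lebesgue_nonzero by eventually_elim (use pos in \<open>auto intro: less_imp_le\<close>)
  moreover have "\<not> (AE x in lebesgue. rescale s z2 \<mu> x = 0)"
    using B.hardy_sobolev_inequality(3)[OF rescale_D_space[OF B.z_D_space \<mu>]]
      crit_integral_rescale[OF D_space_borel[OF B.z_D_space] \<mu> A.s(3)] B.crit_z_pos by simp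
  ultimately show ?thesis
    using semitrivial_critical_point[OF \<mu>] by (simp add: nonneg_bound_states_def bound_state_def)
qed

text \<open>
  On a critical point the two Nehari identities eliminate the quadratic form: the functional equals
  \<open>(1 / 2 - 1 / p) (a + b)\<close>, with \<open>a\<close> and \<open>b\<close> the critical integrals, plus a multiple of the coupling that is
  nonnegative because \<open>\<alpha> + \<beta> > 2\<close>. Hence a lower bound on \<open>a + b\<close> is one on the level.
\<close>

theorem semitrivial_ground_state:
  assumes S: "S2 \<le> S1" and \<alpha>: "2 \<le> \<alpha>" and strict: "S2 < S1 \<or> 2 \<le> \<beta>"
  shows "\<exists>\<nu>0>0. \<forall>\<nu>. 0 < \<nu> \<and> \<nu> < \<nu>0 \<longrightarrow> (\<forall>\<mu>>0.
    ground_state lam1 lam2 t s \<alpha> \<beta> h \<nu> (\<lambda>x. 0, rescale s z2 \<mu>))"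
proof -
  have p: "2 < p" by (rule A.p_gt_2)
  let ?c = "crit_integral s t :: ('a \<Rightarrow> real) \<Rightarrow> real"
  obtain H where H: "0 \<le> H" "\<And>u v. u \<in> D_space s \<Longrightarrow> v \<in> D_space s \<Longrightarrow>
    coupling u v \<le> H * ?c u powr (\<alpha> / p) * ?c v powr (\<beta> / p)"
    using coupling_bound by blast
  obtain \<nu>0 where \<nu>0: "0 < \<nu>0" "\<And>\<nu> a b K. 0 < \<nu> \<and> \<nu> < \<nu>0 \<and> 0 \<le> a \<and> 0 \<le> b \<and> (a \<noteq> 0 \<or> b \<noteq> 0) \<and> 0 \<le> K \<and>
      K \<le> H * a powr (\<alpha> / p) * b powr (\<beta> / p) \<and>
      S1 * a powr (2 / p) \<le> a + \<nu> * \<alpha> * K \<and> S2 * b powr (2 / p) \<le> b + \<nu> * \<beta> * K \<Longrightarrow>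
      S2 powr (p / (p - 2)) \<le> a + b"
    using nehari_lower_bound[OF p B.S_pos S \<alpha> exps(2) strict H(1)] by blast
  have "ground_state lam1 lam2 t s \<alpha> \<beta> h \<nu> (\<lambda>x. 0, rescale s z2 \<mu>)"
    if \<nu>: "0 < \<nu>" "\<nu> < \<nu>0" and \<mu>: "0 < \<mu>" for \<nu> \<mu>
    unfolding ground_state_def is_arg_min_def
  proof (intro conjI notI)
    show "(\<lambda>x. 0, rescale s z2 \<mu>) \<in> nonneg_bound_states lam1 lam2 t s \<alpha> \<beta> h \<nu>"
      by (rule semitrivial_bound_state[OF \<mu>])
  next
    assume "\<exists>q. q \<in> nonneg_bound_states lam1 lam2 t s \<alpha> \<beta> h \<nu> \<and>
      J_fun lam1 lam2 t s \<alpha> \<beta> h \<nu> q < J_fun lam1 lam2 t s \<alpha> \<beta> h \<nu> (\<lambda>x. 0, rescale s z2 \<mu>)"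
    then obtain u v where uv: "(u, v) \<in> nonneg_bound_states lam1 lam2 t s \<alpha> \<beta> h \<nu>"
      and less: "J_fun lam1 lam2 t s \<alpha> \<beta> h \<nu> (u, v) < (1 / 2 - 1 / p) * S2 powr (p / (p - 2))"
      unfolding semitrivial_level[OF \<mu>] by auto
    have crit: "critical_point lam1 lam2 t s \<alpha> \<beta> h \<nu> (u, v)"
      and nz: "\<not> ((AE x in lebesgue. u x = 0) \<and> (AE x in lebesgue. v x = 0))"
      using uv by (auto simp: nonneg_bound_states_def bound_state_def)
    have u: "u \<in> D_space s" and v: "v \<in> D_space s" using crit by (auto simp: critical_point_def)
    let ?K = "coupling u v"
    note n1 = nehari_first[OF crit] and n2 = nehari_second[OF crit]
    have K: "0 \<le> ?K" by (rule coupling_nonneg)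
    have ab: "?c u \<noteq> 0 \<or> ?c v \<noteq> 0"
      using nz A.hardy_sobolev_inequality(3)[OF u] A.hardy_sobolev_inequality(3)[OF v] by auto
    have level: "S2 powr (p / (p - 2)) \<le> ?c u + ?c v"
      using \<nu> ab K crit_integral_nonneg[of s t u] crit_integral_nonneg[of s t v] H(2)[OF u v]
        A.hardy_sobolev_inequality(1)[OF u] B.hardy_sobolev_inequality(1)[OF v]
      unfolding n1 n2 by (intro \<nu>0(2)[of \<nu> _ _ ?K]) auto
    have "J_fun lam1 lam2 t s \<alpha> \<beta> h \<nu> (u, v) =
        (1 / 2 - 1 / p) * (?c u + ?c v) + \<nu> * ((\<alpha> + \<beta>) / 2 - 1) * ?K"
      unfolding J_fun_eq[OF u v] A.energy_def B.energy_def n1 n2 by (simp add: field_simps)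
    moreover have "0 \<le> \<nu> * ((\<alpha> + \<beta>) / 2 - 1) * ?K"
      using \<nu> exps K by (intro mult_nonneg_nonneg) auto
    moreover have "(1 / 2 - 1 / p) * S2 powr (p / (p - 2)) \<le> (1 / 2 - 1 / p) * (?c u + ?c v)"
      using level p by (intro mult_left_mono) (auto simp: field_simps)
    ultimately show False using less by linarith
  qed
  then show ?thesis using \<nu>0(1) by blast
qed

end

text \<open>
  The level \<open>C_const\<close> is an increasing function of the best constant.
\<close>

lemma C_const_less_iff:
  fixes lam1 lam2 s t :: real
  assumes "2 * s < real DIM('a::euclidean_space)" "t < 2 * s"
    and "0 < S_const TYPE('a) lam1 t s" "0 < S_const TYPE('a) lam2 t s"
  shows "C_const TYPE('a) lam2 t s < C_const TYPE('a) lam1 t s \<longleftrightarrow>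
    S_const TYPE('a) lam2 t s < S_const TYPE('a) lam1 t s"
proof -
  have k: "0 < (2 * s - t) / (2 * (real DIM('a) - t))" and r: "0 < (real DIM('a) - t) / (2 * s - t)"
    using assms(1,2) by auto
  have "C_const TYPE('a) lam2 t s < C_const TYPE('a) lam1 t s \<longleftrightarrow>
    S_const TYPE('a) lam2 t s powr ((real DIM('a) - t) / (2 * s - t)) <
    S_const TYPE('a) lam1 t s powr ((real DIM('a) - t) / (2 * s - t))"
    unfolding C_const_def using k by (simp only: mult_less_cancel_left_pos)
  also have "\<dots> \<longleftrightarrow> S_const TYPE('a) lam2 t s < S_const TYPE('a) lam1 t s"
    using assms(3,4) r by (meson linorder_not_less powr_less_mono2 powr_mono2 less_imp_le)
  finally show ?thesis .
qed

theorem theorem3: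
  fixes s t lam1 lam2 \<alpha> \<beta> :: real
    and h z1 z2 :: "'a::euclidean_space \<Rightarrow> real"
  assumes s: "0 < s" "s < 1" "real DIM('a) > 2 * s"
    and t: "0 < t" "t < 2 * s"
    and lam1_range: "0 < lam1" "lam1 < hardy_constant TYPE('a) s"
    and lam2_range: "0 < lam2" "lam2 < hardy_constant TYPE('a) s"
    and exponents: "1 < \<alpha>" "1 < \<beta>" "\<alpha> + \<beta> \<le> crit_exp TYPE('a) s t"
    and h_nonneg: "AE x in lebesgue. 0 \<le> h x"
    and h_nonzero: "\<not> (AE x in lebesgue. h x = 0)"
    and h_integrability:
      "if \<alpha> + \<beta> = crit_exp TYPE('a) s t then h \<in> L_infinity
       else h \<in> weighted_Lp (crit_exp TYPE('a) s t / (crit_exp TYPE('a) s t - \<alpha> - \<beta>)) t"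
    and h_cases:
      "\<alpha> + \<beta> < crit_exp TYPE('a) s t \<or>
       (\<alpha> + \<beta> = crit_exp TYPE('a) s t \<and>
        (\<exists>r>0. continuous_on (ball 0 r) h) \<and> (\<exists>R. continuous_on {x. R < norm x} h) \<and>
        h 0 = 0 \<and> (h \<longlongrightarrow> 0) at_infinity)"
    and z1: "normalized_minimizer lam1 t s z1"
    and z2: "normalized_minimizer lam2 t s z2"
  shows
    "(\<alpha> \<ge> 2 \<and> C_const TYPE('a) lam1 t s > C_const TYPE('a) lam2 t s \<longrightarrow>
       (\<exists>\<nu>0>0. \<forall>\<nu>. 0 < \<nu> \<and> \<nu> < \<nu>0 \<longrightarrow> (\<forall>\<mu>>0.
          ground_state lam1 lam2 t s \<alpha> \<beta> h \<nu> (\<lambda>x. 0, rescale s z2 \<mu>)))) \<and>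
     (\<beta> \<ge> 2 \<and> C_const TYPE('a) lam2 t s > C_const TYPE('a) lam1 t s \<longrightarrow>
       (\<exists>\<nu>0>0. \<forall>\<nu>. 0 < \<nu> \<and> \<nu> < \<nu>0 \<longrightarrow> (\<forall>\<mu>>0.
          ground_state lam1 lam2 t s \<alpha> \<beta> h \<nu> (rescale s z1 \<mu>, \<lambda>x. 0)))) \<and>
     (\<alpha> \<ge> 2 \<and> \<beta> \<ge> 2 \<longrightarrow>
       (\<exists>\<nu>0>0. \<forall>\<nu>. 0 < \<nu> \<and> \<nu> < \<nu>0 \<longrightarrow> (\<forall>\<mu>>0.
          if C_const TYPE('a) lam1 t s > C_const TYPE('a) lam2 t s
          then ground_state lam1 lam2 t s \<alpha> \<beta> h \<nu> (\<lambda>x. 0, rescale s z2 \<mu>)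
          else ground_state lam1 lam2 t s \<alpha> \<beta> h \<nu> (rescale s z1 \<mu>, \<lambda>x. 0))))"
proof -
  let ?p = "crit_exp TYPE('a) s t"
  let ?S1 = "S_const TYPE('a) lam1 t s" and ?S2 = "S_const TYPE('a) lam2 t s"
  interpret A: hardy_sobolev s t lam1 ?p ?S1 z1
    by unfold_locales (use s t lam1_range z1 in auto)
  interpret B: hardy_sobolev s t lam2 ?p ?S2 z2
    by unfold_locales (use s t lam2_range z2 in auto)
  interpret sys: coupled_system s t lam1 lam2 ?p ?S1 ?S2 z1 z2 \<alpha> \<beta> h
    by unfold_locales (use exponents h_nonneg h_integrability in auto)
  interpret swapped: coupled_system s t lam2 lam1 ?p ?S2 ?S1 z2 z1 \<beta> \<alpha> h
    by (rule sys.swap)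
  note cmp = C_const_less_iff[where 'a='a, OF s(3) t(2)]
  have cmp12: "C_const TYPE('a) lam2 t s < C_const TYPE('a) lam1 t s \<longleftrightarrow> ?S2 < ?S1"
    and cmp21: "C_const TYPE('a) lam1 t s < C_const TYPE('a) lam2 t s \<longleftrightarrow> ?S1 < ?S2"
    using cmp A.S_pos B.S_pos by blast+
  have second: "\<exists>\<nu>0>0. \<forall>\<nu>. 0 < \<nu> \<and> \<nu> < \<nu>0 \<longrightarrow> (\<forall>\<mu>>0.
      ground_state lam1 lam2 t s \<alpha> \<beta> h \<nu> (\<lambda>x. 0, rescale s z2 \<mu>))"
    if "2 \<le> \<alpha>" "?S2 < ?S1"
    using sys.semitrivial_ground_state that by auto
  have first: "\<exists>\<nu>0>0. \<forall>\<nu>. 0 < \<nu> \<and> \<nu> < \<nu>0 \<longrightarrow> (\<forall>\<mu>>0.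
      ground_state lam1 lam2 t s \<alpha> \<beta> h \<nu> (rescale s z1 \<mu>, \<lambda>x. 0))"
    if "2 \<le> \<beta>" "?S1 \<le> ?S2" "?S1 < ?S2 \<or> 2 \<le> \<alpha>"
    using swapped.semitrivial_ground_state[OF that(2) that(1) that(3)] ground_state_swap by meson
  show ?thesis
    unfolding cmp12 cmp21
  proof (intro conjI impI)
    assume "2 \<le> \<alpha> \<and> ?S2 < ?S1"
    then show "\<exists>\<nu>0>0. \<forall>\<nu>. 0 < \<nu> \<and> \<nu> < \<nu>0 \<longrightarrow> (\<forall>\<mu>>0.
      ground_state lam1 lam2 t s \<alpha> \<beta> h \<nu> (\<lambda>x. 0, rescale s z2 \<mu>))" using second by blast
  next
    assume "2 \<le> \<beta> \<and> ?S1 < ?S2"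
    then show "\<exists>\<nu>0>0. \<forall>\<nu>. 0 < \<nu> \<and> \<nu> < \<nu>0 \<longrightarrow> (\<forall>\<mu>>0.
      ground_state lam1 lam2 t s \<alpha> \<beta> h \<nu> (rescale s z1 \<mu>, \<lambda>x. 0))" using first by simp
  next
    assume "2 \<le> \<alpha> \<and> 2 \<le> \<beta>"
    then show "\<exists>\<nu>0>0. \<forall>\<nu>. 0 < \<nu> \<and> \<nu> < \<nu>0 \<longrightarrow> (\<forall>\<mu>>0.
      if ?S2 < ?S1 then ground_state lam1 lam2 t s \<alpha> \<beta> h \<nu> (\<lambda>x. 0, rescale s z2 \<mu>)
      else ground_state lam1 lam2 t s \<alpha> \<beta> h \<nu> (rescale s z1 \<mu>, \<lambda>x. 0))"
      using first second by (cases "?S2 < ?S1") (simp_all add: not_less)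
  qed
qed

end
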